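(* Let $\psi$, $F$, $\Omega$, $T$ be as in the context, let $\mathbf{g}\in W^{1,2}_0(\Omega;\mathbb{R}^m)$, and let $\mathbf{v}$ be a weak solution of $$\begin{cases}D\psi(\mathbf{v}_t)=\operatorname{div}DF(D\mathbf{v}), & \Omega\times(0,T)\\ \mathbf{v}=\mathbf{0}, & \partial\Omega\times[0,T)\\ \mathbf{v}=\mathbf{g}, & \Omega\times\{0\}\end{cases}$$ arising as a subsequential limit of the implicit time scheme. Then $D\mathbf{v}_t\in L^2_{\mathrm{loc}}(\Omega\times(0,T);\mathbb{M}^{m\times n})$. Moreover, there is a constant $C=C(m,n,\theta,\Theta,\alpha,A)$ such that $$\int_0^T\int_\Omega\eta^2|D\mathbf{v}_t|^2\,dxdt\le C\int_0^T\int_\Omega\left(|\eta||\eta_t|+|D\eta|^2\right)|\mathbf{v}_t|^2\,dxdt$$ for each $\eta\in C^\infty_c(\Omega\times(0,T))$.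
   Context: Setting: $m>1$, $\Omega\subset\mathbb R^n$ is a bounded domain with smooth boundary, $T>0$. $\mathbb M^{m\times n}$ is the space of real $m\times n$ matrices with $M\cdot N=\operatorname{tr}(M^tN)$. $\psi\in C^2(\mathbb R^m)$, $F\in C^2(\mathbb M^{m\times n})$, $\inf_{\mathbb R^m}\psi=\psi(0)=0$, and there are positive constants $\alpha,A,\theta,\Theta$ with $$\alpha|z|^2\le\sum_{i,j=1}^m\psi_{w_iw_j}(w)z_iz_j\le A|z|^2,\qquad \theta|\xi|^2\le\sum_{i,k=1}^m\sum_{j,l=1}^nF_{M^i_jM^k_l}(M)\xi^i_j\xi^k_l\le\Theta|\xi|^2$$ for all $w,z\in\mathbb R^m$ and $M,\xi\in\mathbb M^{m\times n}$. Weak solution of the initial value problem: $\mathbf v_t\in L^2(\Omega\times(0,T);\mathbb R^m)$, $\mathbf v\in L^\infty([0,T];W^{1,2}_0(\Omega;\mathbb R^m))$, $\int_\Omega D\psi(\mathbf v_t(x,t))\cdot\mathbf w\,dx+\int_\Omega DF(D\mathbf v(x,t))\cdot D\mathbf w\,dx=0$ for each $\mathbf w\in W^{1,2}_0(\Omega;\mathbb R^m)$ and a.e. $t\in[0,T]$, and $\mathbf v(\cdot,0)=\mathbf g$. Implicit time scheme: for $N\in\mathbb N$ put $\tau=T/N$, $\tau_k=k\tau$, $\mathbf v^0=\mathbf g$, and for $k=1,\dots,N$ let $\mathbf v^k\in W^{1,2}_0(\Omega;\mathbb R^m)$ be the unique solution of $\int_\Omega D\psi\left(\frac{\mathbf v^k-\mathbf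 v^{k-1}}{\tau}\right)\cdot\mathbf w\,dx+\int_\Omega DF(D\mathbf v^k)\cdot D\mathbf w\,dx=0$ for all $\mathbf w\in W^{1,2}_0(\Omega;\mathbb R^m)$. Set $\mathbf v_N(\cdot,0)=\mathbf g$, $\mathbf v_N(\cdot,t)=\mathbf v^k$ for $\tau_{k-1}<t\le\tau_k$, and $\mathbf u_N(\cdot,t)=\mathbf v^{k-1}+\frac{t-\tau_{k-1}}{\tau}(\mathbf v^k-\mathbf v^{k-1})$ for $\tau_{k-1}\le t\le\tau_k$. That $\mathbf v$ arises as a subsequential limit of the implicit time scheme means: $\mathbf v$ is a weak solution of the initial value problem, and there are $N_j\to\infty$ such that $\mathbf v_{N_j}\to\mathbf v$ and $\mathbf u_{N_j}\to\mathbf v$ in $L^2(\Omega;\mathbb R^m)$ uniformly in $t\in[0,T]$ and in $L^r([0,T];W^{1,2}_0(\Omega;\mathbb R^m))$ for all $1\le r<\infty$, and $\partial_t\mathbf u_{N_j}\to\mathbf v_t$ in $L^2(\Omega\times[0,T];\mathbb R^m)$. *)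

theory Defs
  imports "HOL-Analysis.Analysis"
begin

section \<open>Classical derivatives\<close>

text \<open>Meant for open \<open>S\<close> (the derivatives are taken in the full space).\<close>

primrec Ck_on :: "nat \<Rightarrow> ('a::euclidean_space \<Rightarrow> 'b::euclidean_space) \<Rightarrow> 'a set \<Rightarrow> bool" where
  "Ck_on 0 f S \<longleftrightarrow> continuous_on S f"
| "Ck_on (Suc k) f S \<longleftrightarrow>
     (\<forall>x\<in>S. f differentiable (at x)) \<and> (\<forall>e. Ck_on k (\<lambda>x. frechet_derivative f (at x) e) S)"

definition smooth_on :: "('a::euclidean_space \<Rightarrow> 'b::euclidean_space) \<Rightarrow> 'a set \<Rightarrow> bool" where
  "smooth_on f S \<longleftrightarrow> (\<forall>k. Ck_on k f S)"

text \<open>The space \<open>C\<^sub>c\<^sup>\<infinity>(U)\<close>; its elements are extended by zero to the whole space.\<close>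

definition test_function :: "'a::euclidean_space set \<Rightarrow> ('a \<Rightarrow> 'b::euclidean_space) \<Rightarrow> bool" where
  "test_function U \<phi> \<longleftrightarrow>
     smooth_on \<phi> UNIV \<and> compact (closure {x. \<phi> x \<noteq> 0}) \<and> closure {x. \<phi> x \<noteq> 0} \<subseteq> U"

definition grad :: "('a::euclidean_space \<Rightarrow> real) \<Rightarrow> 'a \<Rightarrow> 'a" where
  "grad f x = (\<Sum>b\<in>Basis. frechet_derivative f (at x) b *\<^sub>R b)"

text \<open>The sum of \<open>f\<^sub>b\<^sub>c(x) z\<^sub>b z\<^sub>c\<close> over all pairs of coordinates. The standard basis of
  \<open>real ^ 'n ^ 'm\<close> consists of the matrix units, and its inner product is the trace product.\<close>

definition hessian_form :: "('a::euclidean_space \<Rightarrow> real) \<Rightarrow> 'a \<Rightarrow> 'a \<Rightarrow> real" where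
  "hessian_form f x z =
     (\<Sum>b\<in>Basis. \<Sum>c\<in>Basis.
        frechet_derivative (\<lambda>y. frechet_derivative f (at y) b) (at x) c * (z \<bullet> b) * (z \<bullet> c))"

definition C2_hessian_bounds :: "real \<Rightarrow> real \<Rightarrow> ('a::euclidean_space \<Rightarrow> real) \<Rightarrow> bool" where
  "C2_hessian_bounds a b f \<longleftrightarrow>
     Ck_on 2 f UNIV \<and>
     (\<forall>x z. a * (norm z)\<^sup>2 \<le> hessian_form f x z \<and> hessian_form f x z \<le> b * (norm z)\<^sup>2)"


section \<open>Bounded domains with smooth boundary\<close>

text \<open>Near each boundary point, \<open>\<Omega>\<close> is the strict epigraph, in some direction \<open>e\<close>, of a smooth
  function of the coordinates orthogonal to \<open>e\<close>.\<close>

definition smooth_boundary :: "'a::euclidean_space set \<Rightarrow> bool" where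
  "smooth_boundary \<Omega> \<longleftrightarrow>
     (\<forall>p\<in>frontier \<Omega>. \<exists>r>0. \<exists>e. \<exists>\<gamma>::'a \<Rightarrow> real.
        norm e = 1 \<and> smooth_on \<gamma> UNIV \<and>
        \<Omega> \<inter> ball p r = {x \<in> ball p r. \<gamma> (x - (x \<bullet> e) *\<^sub>R e) < x \<bullet> e})"

definition bounded_smooth_domain :: "'a::euclidean_space set \<Rightarrow> bool" where
  "bounded_smooth_domain \<Omega> \<longleftrightarrow>
     open \<Omega> \<and> connected \<Omega> \<and> \<Omega> \<noteq> {} \<and> bounded \<Omega> \<and> smooth_boundary \<Omega>"


section \<open>Lebesgue and Sobolev spaces\<close>

definition L2_on :: "'a::euclidean_space set \<Rightarrow> ('a \<Rightarrow> 'b::euclidean_space) \<Rightarrow> bool" where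
  "L2_on S f \<longleftrightarrow>
     f \<in> borel_measurable (lebesgue_on S) \<and> integrable (lebesgue_on S) (\<lambda>x. (norm (f x))\<^sup>2)"

definition L2_norm_on :: "'a::euclidean_space set \<Rightarrow> ('a \<Rightarrow> 'b::euclidean_space) \<Rightarrow> real" where
  "L2_norm_on S f = sqrt (LINT x|lebesgue_on S. (norm (f x))\<^sup>2)"

definition L2_loc :: "'a::euclidean_space set \<Rightarrow> ('a \<Rightarrow> 'b::euclidean_space) \<Rightarrow> bool" where
  "L2_loc U f \<longleftrightarrow> (\<forall>K. compact K \<and> K \<subseteq> U \<longrightarrow> L2_on K f)"

definition L1_loc :: "'a::euclidean_space set \<Rightarrow> ('a \<Rightarrow> 'b::euclidean_space) \<Rightarrow> bool" where
  "L1_loc U f \<longleftrightarrow> (\<forall>K. compact K \<and> K \<subseteq> U \<longrightarrow> f absolutely_integrable_on K)"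

text \<open>\<open>d\<close> is the weak derivative of \<open>u\<close> in direction \<open>e\<close> on the open set \<open>U\<close>.\<close>

definition has_weak_deriv ::
  "'a::euclidean_space set \<Rightarrow> 'a \<Rightarrow> ('a \<Rightarrow> 'b::euclidean_space) \<Rightarrow> ('a \<Rightarrow> 'b) \<Rightarrow> bool" where
  "has_weak_deriv U e u d \<longleftrightarrow>
     L1_loc U u \<and> L1_loc U d \<and>
     (\<forall>\<phi>::'a \<Rightarrow> real. test_function U \<phi> \<longrightarrow>
        (LINT x|lebesgue_on U. frechet_derivative \<phi> (at x) e *\<^sub>R u x)
          = - (LINT x|lebesgue_on U. \<phi> x *\<^sub>R d x))"

definition has_weak_grad ::
  "(real ^ 'n) set \<Rightarrow> (real ^ 'n \<Rightarrow> real ^ 'm) \<Rightarrow> (real ^ 'n \<Rightarrow> real ^ 'n ^ 'm) \<Rightarrow> bool" where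
  "has_weak_grad \<Omega> u G \<longleftrightarrow> (\<forall>j. has_weak_deriv \<Omega> (axis j 1) u (\<lambda>x. column j (G x)))"

text \<open>Weak gradients are unique up to null sets, so the choice made here is immaterial.\<close>

definition wgrad :: "(real ^ 'n) set \<Rightarrow> (real ^ 'n \<Rightarrow> real ^ 'm) \<Rightarrow> real ^ 'n \<Rightarrow> real ^ 'n ^ 'm" where
  "wgrad \<Omega> u = (SOME G. has_weak_grad \<Omega> u G)"

definition W12 :: "(real ^ 'n) set \<Rightarrow> (real ^ 'n \<Rightarrow> real ^ 'm) \<Rightarrow> bool" where
  "W12 \<Omega> u \<longleftrightarrow> L2_on \<Omega> u \<and> (\<exists>G. has_weak_grad \<Omega> u G \<and> L2_on \<Omega> G)"

definition W12_norm :: "(real ^ 'n) set \<Rightarrow> (real ^ 'n \<Rightarrow> real ^ 'm) \<Rightarrow> real" where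
  "W12_norm \<Omega> u = sqrt ((L2_norm_on \<Omega> u)\<^sup>2 + (L2_norm_on \<Omega> (wgrad \<Omega> u))\<^sup>2)"

text \<open>The closure of \<open>C\<^sub>c\<^sup>\<infinity>(\<Omega>)\<close> in \<open>W\<^sup>1\<^sup>,\<^sup>2(\<Omega>)\<close>.\<close>

definition W12_0 :: "(real ^ 'n) set \<Rightarrow> (real ^ 'n \<Rightarrow> real ^ 'm) \<Rightarrow> bool" where
  "W12_0 \<Omega> u \<longleftrightarrow>
     W12 \<Omega> u \<and>
     (\<exists>\<phi>. (\<forall>k. test_function \<Omega> (\<phi> k)) \<and> (\<lambda>k. W12_norm \<Omega> (\<lambda>x. \<phi> k x - u x)) \<longlonglongrightarrow> 0)"


section \<open>Functions of space and time\<close>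

abbreviation (input) slice :: "('a \<times> real \<Rightarrow> 'b) \<Rightarrow> real \<Rightarrow> 'a \<Rightarrow> 'b" where
  "slice v t \<equiv> (\<lambda>x. v (x, t))"

text \<open>Bochner measurability of \<open>t \<mapsto> v(\<cdot>,t)\<close>: almost everywhere limit, in the norm of \<open>W\<^sup>1\<^sup>,\<^sup>2\<close>, of
  simple functions \<open>s k\<close> with values in \<open>W\<^sup>1\<^sup>,\<^sup>2\<^sub>0\<close>.\<close>

definition bochner_measurable_W12_0 ::
  "(real ^ 'n) set \<Rightarrow> real \<Rightarrow> ((real ^ 'n) \<times> real \<Rightarrow> real ^ 'm) \<Rightarrow> bool" where
  "bochner_measurable_W12_0 \<Omega> T v \<longleftrightarrow>
     (\<exists>s :: nat \<Rightarrow> real \<Rightarrow> real ^ 'n \<Rightarrow> real ^ 'm.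
        (\<forall>k. finite (s k ` {0..T}) \<and> (\<forall>t\<in>{0..T}. W12_0 \<Omega> (s k t)) \<and>
             (\<forall>h. {t\<in>{0..T}. s k t = h} \<in> sets lebesgue)) \<and>
        (AE t in lebesgue_on {0..T}. (\<lambda>k. W12_norm \<Omega> (\<lambda>x. s k t x - v (x, t))) \<longlonglongrightarrow> 0))"

definition Linfty_W12_0 ::
  "(real ^ 'n) set \<Rightarrow> real \<Rightarrow> ((real ^ 'n) \<times> real \<Rightarrow> real ^ 'm) \<Rightarrow> bool" where
  "Linfty_W12_0 \<Omega> T v \<longleftrightarrow>
     bochner_measurable_W12_0 \<Omega> T v \<and>
     (AE t in lebesgue_on {0..T}. W12_0 \<Omega> (slice v t)) \<and>
     (\<exists>B. AE t in lebesgue_on {0..T}. W12_norm \<Omega> (slice v t) \<le> B)"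

definition continuous_into_L2 ::
  "(real ^ 'n) set \<Rightarrow> real \<Rightarrow> ((real ^ 'n) \<times> real \<Rightarrow> real ^ 'm) \<Rightarrow> bool" where
  "continuous_into_L2 \<Omega> T v \<longleftrightarrow>
     (\<forall>t\<in>{0..T}. L2_on \<Omega> (slice v t)) \<and>
     (\<forall>s\<in>{0..T}. ((\<lambda>t. L2_norm_on \<Omega> (\<lambda>x. v (x, t) - v (x, s))) \<longlongrightarrow> 0) (at s within {0..T}))"

text \<open>\<open>G\<close> is the weak gradient of \<open>u\<close> in the space variables on \<open>\<Omega> \<times> (0,T)\<close>.\<close>

definition has_weak_space_grad ::
  "(real ^ 'n) set \<Rightarrow> real \<Rightarrow> ((real ^ 'n) \<times> real \<Rightarrow> real ^ 'm) \<Rightarrow>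
     ((real ^ 'n) \<times> real \<Rightarrow> real ^ 'n ^ 'm) \<Rightarrow> bool" where
  "has_weak_space_grad \<Omega> T u G \<longleftrightarrow>
     (\<forall>j. has_weak_deriv (\<Omega> \<times> {0<..<T}) (axis j 1, 0) u (\<lambda>p. column j (G p)))"

definition space_grad :: "((real ^ 'n) \<times> real \<Rightarrow> real) \<Rightarrow> (real ^ 'n) \<times> real \<Rightarrow> real ^ 'n" where
  "space_grad \<eta> p = (\<chi> j. frechet_derivative \<eta> (at p) (axis j 1, 0))"

definition time_deriv :: "((real ^ 'n) \<times> real \<Rightarrow> real) \<Rightarrow> (real ^ 'n) \<times> real \<Rightarrow> real" where
  "time_deriv \<eta> p = frechet_derivative \<eta> (at p) (0, 1)"


section \<open>Weak solutions and the implicit time scheme\<close>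

text \<open>\<open>vt\<close> is the weak time derivative of \<open>v\<close>. It belongs to \<open>L\<^sup>2\<close>, so \<open>v\<close> has a representative that is
  continuous in time with values in \<open>L\<^sup>2(\<Omega>)\<close>; \<open>v\<close> denotes such a representative, and this is what
  gives the initial condition its meaning.\<close>

definition weak_solution ::
  "(real ^ 'n) set \<Rightarrow> real \<Rightarrow> (real ^ 'm \<Rightarrow> real) \<Rightarrow> (real ^ 'n ^ 'm \<Rightarrow> real) \<Rightarrow>
     (real ^ 'n \<Rightarrow> real ^ 'm) \<Rightarrow>
     ((real ^ 'n) \<times> real \<Rightarrow> real ^ 'm) \<Rightarrow> ((real ^ 'n) \<times> real \<Rightarrow> real ^ 'm) \<Rightarrow> bool" where
  "weak_solution \<Omega> T \<psi> F g v vt \<longleftrightarrow>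
     has_weak_deriv (\<Omega> \<times> {0<..<T}) (0, 1) v vt \<and>
     L2_on (\<Omega> \<times> {0<..<T}) vt \<and>
     Linfty_W12_0 \<Omega> T v \<and>
     (\<forall>w. W12_0 \<Omega> w \<longrightarrow>
        (AE t in lebesgue_on {0..T}.
           (LINT x|lebesgue_on \<Omega>. grad \<psi> (vt (x, t)) \<bullet> w x)
           + (LINT x|lebesgue_on \<Omega>. grad F (wgrad \<Omega> (slice v t) x) \<bullet> wgrad \<Omega> w x) = 0)) \<and>
     continuous_into_L2 \<Omega> T v \<and>
     (AE x in lebesgue_on \<Omega>. v (x, 0) = g x)"

definition implicit_scheme ::
  "(real ^ 'n) set \<Rightarrow> real \<Rightarrow> (real ^ 'm \<Rightarrow> real) \<Rightarrow> (real ^ 'n ^ 'm \<Rightarrow> real) \<Rightarrow>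
     (real ^ 'n \<Rightarrow> real ^ 'm) \<Rightarrow> nat \<Rightarrow> (nat \<Rightarrow> real ^ 'n \<Rightarrow> real ^ 'm) \<Rightarrow> bool" where
  "implicit_scheme \<Omega> T \<psi> F g N V \<longleftrightarrow>
     V 0 = g \<and>
     (\<forall>k\<in>{1..N}. W12_0 \<Omega> (V k) \<and>
        (\<forall>w. W12_0 \<Omega> w \<longrightarrow>
           (LINT x|lebesgue_on \<Omega>. grad \<psi> ((V k x - V (k - 1) x) /\<^sub>R (T / real N)) \<bullet> w x)
           + (LINT x|lebesgue_on \<Omega>. grad F (wgrad \<Omega> (V k) x) \<bullet> wgrad \<Omega> w x) = 0))"

text \<open>The index of the time step with \<open>\<tau>\<^sub>k\<^sub>-\<^sub>1 < t \<le> \<tau>\<^sub>k\<close>, and \<open>0\<close> for \<open>t = 0\<close>.\<close>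

definition step_index :: "real \<Rightarrow> nat \<Rightarrow> real \<Rightarrow> nat" where
  "step_index T N t = nat \<lceil>t / (T / real N)\<rceil>"

definition step_interp ::
  "real \<Rightarrow> nat \<Rightarrow> (nat \<Rightarrow> 'a \<Rightarrow> 'b::real_vector) \<Rightarrow> 'a \<times> real \<Rightarrow> 'b" where
  "step_interp T N V = (\<lambda>(x, t). V (step_index T N t) x)"

definition linear_interp ::
  "real \<Rightarrow> nat \<Rightarrow> (nat \<Rightarrow> 'a \<Rightarrow> 'b::real_vector) \<Rightarrow> 'a \<times> real \<Rightarrow> 'b" where
  "linear_interp T N V = (\<lambda>(x, t).
     let \<tau> = T / real N; k = step_index T N t
     in V (k - 1) x + ((t - real (k - 1) * \<tau>) / \<tau>) *\<^sub>R (V k x - V (k - 1) x))"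

definition converges_unif_L2 ::
  "(real ^ 'n) set \<Rightarrow> real \<Rightarrow> (nat \<Rightarrow> (real ^ 'n) \<times> real \<Rightarrow> real ^ 'm) \<Rightarrow>
     ((real ^ 'n) \<times> real \<Rightarrow> real ^ 'm) \<Rightarrow> bool" where
  "converges_unif_L2 \<Omega> T f v \<longleftrightarrow>
     uniform_limit {0..T} (\<lambda>j t. L2_norm_on \<Omega> (\<lambda>x. f j (x, t) - v (x, t))) (\<lambda>t. 0) sequentially"

definition converges_Lr_W12 ::
  "(real ^ 'n) set \<Rightarrow> real \<Rightarrow> real \<Rightarrow> (nat \<Rightarrow> (real ^ 'n) \<times> real \<Rightarrow> real ^ 'm) \<Rightarrow>
     ((real ^ 'n) \<times> real \<Rightarrow> real ^ 'm) \<Rightarrow> bool" where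
  "converges_Lr_W12 \<Omega> T r f v \<longleftrightarrow>
     (\<lambda>j. \<integral>\<^sup>+ t. ennreal (W12_norm \<Omega> (\<lambda>x. f j (x, t) - v (x, t)) powr r) \<partial>lebesgue_on {0..T})
       \<longlonglongrightarrow> 0"

text \<open>The time derivative of the piecewise linear interpolation exists off the grid points, that is,
  for almost every \<open>t\<close>.\<close>

definition scheme_limit ::
  "(real ^ 'n) set \<Rightarrow> real \<Rightarrow> (real ^ 'm \<Rightarrow> real) \<Rightarrow> (real ^ 'n ^ 'm \<Rightarrow> real) \<Rightarrow>
     (real ^ 'n \<Rightarrow> real ^ 'm) \<Rightarrow>
     ((real ^ 'n) \<times> real \<Rightarrow> real ^ 'm) \<Rightarrow> ((real ^ 'n) \<times> real \<Rightarrow> real ^ 'm) \<Rightarrow> bool" where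
  "scheme_limit \<Omega> T \<psi> F g v vt \<longleftrightarrow>
     (\<exists>(N :: nat \<Rightarrow> nat) (V :: nat \<Rightarrow> nat \<Rightarrow> real ^ 'n \<Rightarrow> real ^ 'm).
        filterlim N at_top sequentially \<and>
        (\<forall>j. 0 < N j \<and> implicit_scheme \<Omega> T \<psi> F g (N j) (V j)) \<and>
        converges_unif_L2 \<Omega> T (\<lambda>j. step_interp T (N j) (V j)) v \<and>
        converges_unif_L2 \<Omega> T (\<lambda>j. linear_interp T (N j) (V j)) v \<and>
        (\<forall>r\<ge>1. converges_Lr_W12 \<Omega> T r (\<lambda>j. step_interp T (N j) (V j)) v \<and>
               converges_Lr_W12 \<Omega> T r (\<lambda>j. linear_interp T (N j) (V j)) v) \<and>
        (\<lambda>j. L2_norm_on (\<Omega> \<times> {0..T})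
               (\<lambda>(x, t). vector_derivative (\<lambda>s. linear_interp T (N j) (V j) (x, s)) (at t) - vt (x, t)))
          \<longlonglongrightarrow> 0)"

end

theory Submission
  imports Defs
begin

text \<open>
  Formally, one differentiates the equation in time and tests with \<open>\<eta>\<^sup>2 v\<^sub>t\<close>. The term with \<open>\<psi>\<close> is then
  the time derivative of \<open>P(v\<^sub>t)\<close>, where \<open>P(w) = D\<psi>(w) \<bullet> w - \<psi>(w)\<close> lies between \<open>0\<close> and
  \<open>A |w|\<^sup>2 / 2\<close>, and an integration by parts in time moves the derivative to \<open>\<eta>\<^sup>2\<close>. The term with \<open>F\<close>
  controls \<open>\<theta> \<eta>\<^sup>2 |Dv\<^sub>t|\<^sup>2\<close> up to a product of \<open>\<eta> Dv\<^sub>t\<close> and \<open>v\<^sub>t D\<eta>\<close>, which Young's inequality absorbs.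

  The weak solution is not regular enough for this, but the implicit scheme is: with
  \<open>d\<^sub>k = (V\<^sub>k - V\<^sub>k\<^sub>-\<^sub>1) / \<tau>\<close>, the difference of the equations for two consecutive steps may be tested
  with \<open>\<eta>\<^sup>2 d\<^sub>k\<close>. Convexity of \<open>\<psi>\<close> replaces the chain rule (\<open>dual_energy_diff_le\<close>), summation by parts
  replaces integration by parts, and the result is \<open>Caccioppoli_discrete\<close>. Its proof needs
  \<open>\<eta>\<^sup>2 d\<^sub>k\<close> to be an admissible test function with the expected gradient (\<open>W12_0_product\<close>). Since
  weak gradients enter the scheme through an arbitrary choice, this rests on their uniqueness, hence
  on \<open>fundamental_lemma\<close> and on the smooth bump functions behind it.

  The limit is taken in two stages. First \<open>\<eta>(x,t) = t\<close> is inserted. The resulting bound says that the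
  functions \<open>t Dd\<close>, from the second step on, are bounded in \<open>L\<^sup>2\<close> of the cylinder; convex combinations of them
  converge strongly to some \<open>h\<close> (\<open>bounded_L2_convex_combinations_converge\<close>), and \<open>h / t\<close> is the
  gradient of \<open>v\<^sub>t\<close>, because the difference quotients converge to \<open>v\<^sub>t\<close> in \<open>L\<^sup>2\<close>. Then the
  inequality for a given test function \<open>\<eta>\<close> passes to the limit by convexity of the squared norm.
\<close>

section \<open>Calculus of smooth functions\<close>

lemma Ck_on_has_derivative:
  "Ck_on (Suc k) f UNIV \<Longrightarrow> (f has_derivative frechet_derivative f (at x)) (at x)"
  using frechet_derivative_works by auto

lemma Ck_on_continuous: "Ck_on k f UNIV \<Longrightarrow> continuous_on UNIV f"
  by (cases k) (auto intro!: continuous_at_imp_continuous_on differentiable_imp_continuous_within)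

lemma Ck_on_SucD: "Ck_on (Suc k) f UNIV \<Longrightarrow> Ck_on k f UNIV"
proof (induction k arbitrary: f)
  case 0
  then show ?case using Ck_on_continuous[of "Suc 0" f] by simp
next
  case (Suc k)
  then show ?case by (metis Ck_on.simps(2))
qed

lemma Ck_on_SucI:
  assumes "\<And>x. (f has_derivative f' x) (at x)" and "\<And>e. Ck_on k (\<lambda>x. f' x e) UNIV"
  shows "Ck_on (Suc k) f UNIV"
proof -
  have "frechet_derivative f (at x) = f' x" for x
    using assms(1) frechet_derivative_at by metis
  then show ?thesis using assms by (auto simp: differentiable_def)
qed

lemma Ck_on_const: "Ck_on k (\<lambda>x. c) UNIV"
  by (induction k arbitrary: c) auto

lemma Ck_on_add:
  "Ck_on k f UNIV \<Longrightarrow> Ck_on k g UNIV \<Longrightarrow> Ck_on k (\<lambda>x. f x + g x) UNIV"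
proof (induction k arbitrary: f g)
  case 0
  then show ?case by (auto intro: continuous_on_add)
next
  case (Suc k)
  show ?case
  proof (rule Ck_on_SucI)
    show "((\<lambda>x. f x + g x) has_derivative (\<lambda>e. frechet_derivative f (at x) e + frechet_derivative g (at x) e)) (at x)" for x
      using Suc.prems by (intro has_derivative_add Ck_on_has_derivative)
    show "Ck_on k (\<lambda>x. frechet_derivative f (at x) e + frechet_derivative g (at x) e) UNIV" for e
      using Suc by simp
  qed
qed

lemma Ck_on_scaleR:
  fixes f :: "_ \<Rightarrow> real"
  shows "Ck_on k f UNIV \<Longrightarrow> Ck_on k g UNIV \<Longrightarrow> Ck_on k (\<lambda>x. f x *\<^sub>R g x) UNIV"
proof (induction k arbitrary: f g)
  case 0
  then show ?case by (auto intro: continuous_on_scaleR)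
next
  case (Suc k)
  show ?case
  proof (rule Ck_on_SucI)
    show "((\<lambda>x. f x *\<^sub>R g x) has_derivative
      (\<lambda>e. f x *\<^sub>R frechet_derivative g (at x) e + frechet_derivative f (at x) e *\<^sub>R g x)) (at x)" for x
      using Suc.prems by (intro has_derivative_scaleR Ck_on_has_derivative)
    show "Ck_on k (\<lambda>x. f x *\<^sub>R frechet_derivative g (at x) e + frechet_derivative f (at x) e *\<^sub>R g x) UNIV" for e
      using Suc.prems Ck_on_SucD[OF Suc.prems(1)] Ck_on_SucD[OF Suc.prems(2)]
      by (intro Ck_on_add Suc.IH) auto
  qed
qed

text \<open>Time slices of functions on space-time and rescaled functions of one coordinate are of this form.\<close>

lemma Ck_on_compose_affine:
  assumes L: "linear L"
  shows "Ck_on k f UNIV \<Longrightarrow> Ck_on k (\<lambda>x. f (L x + c)) UNIV"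
proof (induction k arbitrary: f)
  case 0
  then show ?case
    using linear_continuous_on[OF linear_conv_bounded_linear[THEN iffD1, OF L], of UNIV]
    by (auto intro!: continuous_on_compose2[of UNIV f] continuous_intros)
next
  case (Suc k)
  have "((\<lambda>x. L x + c) has_derivative L) (at x)" for x
    using L linear_imp_has_derivative by (auto intro!: derivative_eq_intros)
  with Suc.prems have "((\<lambda>x. f (L x + c)) has_derivative
      (\<lambda>e. frechet_derivative f (at (L x + c)) (L e))) (at x)" for x
    using has_derivative_compose Ck_on_has_derivative by blast
  then show ?case
    using Suc by (intro Ck_on_SucI) auto
qed

lemma smooth_on_Ck_on: "smooth_on f UNIV \<Longrightarrow> Ck_on k f UNIV"
  by (simp add: smooth_on_def)

lemma smooth_on_continuous: "smooth_on f UNIV \<Longrightarrow> continuous_on S f"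
  using Ck_on_continuous continuous_on_subset smooth_on_Ck_on by blast

lemma smooth_on_has_derivative:
  "smooth_on f UNIV \<Longrightarrow> (f has_derivative frechet_derivative f (at x)) (at x)"
  using Ck_on_has_derivative smooth_on_Ck_on by blast

lemma smooth_on_frechet_derivative:
  "smooth_on f UNIV \<Longrightarrow> smooth_on (\<lambda>x. frechet_derivative f (at x) e) UNIV"
  unfolding smooth_on_def by (metis Ck_on.simps(2))

lemma smooth_on_const: "smooth_on (\<lambda>x. c) UNIV"
  by (simp add: smooth_on_def Ck_on_const)

lemma smooth_on_add: "smooth_on f UNIV \<Longrightarrow> smooth_on g UNIV \<Longrightarrow> smooth_on (\<lambda>x. f x + g x) UNIV"
  by (simp add: smooth_on_def Ck_on_add)

lemma smooth_on_scaleR: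
  fixes f :: "_ \<Rightarrow> real"
  shows "smooth_on f UNIV \<Longrightarrow> smooth_on g UNIV \<Longrightarrow> smooth_on (\<lambda>x. f x *\<^sub>R g x) UNIV"
  by (simp add: smooth_on_def Ck_on_scaleR)

lemma smooth_on_mult:
  fixes f :: "_ \<Rightarrow> real"
  shows "smooth_on f UNIV \<Longrightarrow> smooth_on g UNIV \<Longrightarrow> smooth_on (\<lambda>x. f x * g x) UNIV"
  using smooth_on_scaleR[of f g] by simp

lemma smooth_on_prod:
  fixes f :: "'i \<Rightarrow> _ \<Rightarrow> real"
  assumes "\<And>i. i \<in> I \<Longrightarrow> smooth_on (f i) UNIV"
  shows "smooth_on (\<lambda>x. \<Prod>i\<in>I. f i x) UNIV"
  using assms
  by (induction I rule: infinite_finite_induct) (auto intro: smooth_on_const smooth_on_mult)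

lemma smooth_on_compose_affine:
  "linear L \<Longrightarrow> smooth_on f UNIV \<Longrightarrow> smooth_on (\<lambda>x. f (L x + c)) UNIV"
  by (simp add: smooth_on_def Ck_on_compose_affine)

lemma smooth_on_linear:
  assumes "linear L"
  shows "smooth_on L UNIV"
proof -
  have "Ck_on k L UNIV" for k
  proof (cases k)
    case 0
    then show ?thesis
      using assms linear_continuous_on linear_conv_bounded_linear by auto
  next
    case (Suc n)
    then show ?thesis
      using Ck_on_SucI[of L "\<lambda>_. L" n] Ck_on_const linear_imp_has_derivative[OF assms] by blast
  qed
  then show ?thesis by (simp add: smooth_on_def)
qed

text \<open>Differentiation preserves the span of this family, so that all its members are smooth; the
  first one is the standard example of a smooth function that is not analytic.\<close>

definition flat_exp :: "nat \<Rightarrow> real \<Rightarrow> real" where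
  "flat_exp n t = (if t > 0 then inverse t ^ n * exp (- inverse t) else 0)"

lemma flat_exp_tendsto_0: "(flat_exp n \<longlongrightarrow> 0) (at_right 0)"
proof -
  have "((\<lambda>y. y ^ n / exp y) \<longlongrightarrow> 0) (at_top::real filter)"
    by (rule tendsto_power_div_exp_0)
  then have "((\<lambda>t::real. inverse t ^ n / exp (inverse t)) \<longlongrightarrow> 0) (at_right 0)"
    using filterlim_compose filterlim_inverse_at_top_right by blast
  then show ?thesis
    by (rule Lim_transform_eventually)
      (auto simp: flat_exp_def exp_minus divide_inverse eventually_at_filter)
qed

lemma flat_exp_has_derivative:
  "(flat_exp n has_real_derivative flat_exp (n + 2) t - real n * flat_exp (n + 1) t) (at t)"
proof (cases t "0::real" rule: linorder_cases)
  case less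
  have "((\<lambda>t. 0) has_real_derivative 0) (at t)" by simp
  then have "(flat_exp n has_real_derivative 0) (at t)"
    by (rule has_field_derivative_transform_within_open[of _ _ _ "{..<0}"])
       (use less in \<open>auto simp: flat_exp_def\<close>)
  then show ?thesis using less by (simp add: flat_exp_def)
next
  case equal
  \<comment> \<open>For positive \<open>h\<close> this difference quotient is \<open>flat_exp (n + 1) h\<close>.\<close>
  have "((\<lambda>h. (flat_exp n (0 + h) - flat_exp n 0) / h) \<longlongrightarrow> 0) (at 0)"
  proof (rule filterlim_split_at)
    show "((\<lambda>h. (flat_exp n (0 + h) - flat_exp n 0) / h) \<longlongrightarrow> 0) (at_left 0)"
      by (rule Lim_transform_eventually[OF tendsto_const])
         (auto simp: flat_exp_def eventually_at_filter)
    show "((\<lambda>h. (flat_exp n (0 + h) - flat_exp n 0) / h) \<longlongrightarrow> 0) (at_right 0)"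
      by (rule Lim_transform_eventually[OF flat_exp_tendsto_0[of "Suc n"]])
         (auto simp: flat_exp_def eventually_at_filter divide_inverse)
  qed
  then show ?thesis using equal by (simp add: DERIV_def flat_exp_def)
next
  case greater
  have "((\<lambda>t. inverse t ^ n * exp (- inverse t)) has_real_derivative
      inverse t ^ n * (exp (- inverse t) * inverse t ^ 2) -
      real n * (inverse t ^ (n - 1) * inverse t ^ 2) * exp (- inverse t)) (at t)"
    using greater
    by (auto intro!: derivative_eq_intros simp: power2_eq_square algebra_simps)
  also have "real n * (inverse t ^ (n - 1) * inverse t ^ 2) = real n * inverse t ^ (n + 1)"
    by (cases n) (simp_all add: power2_eq_square)
  finally have "((\<lambda>t. inverse t ^ n * exp (- inverse t)) has_real_derivative
      flat_exp (n + 2) t - real n * flat_exp (n + 1) t) (at t)"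
    using greater by (simp add: flat_exp_def power2_eq_square algebra_simps)
  then show ?thesis
    by (rule has_field_derivative_transform_within_open[of _ _ _ "{0<..}"])
       (use greater in \<open>auto simp: flat_exp_def\<close>)
qed

lemma smooth_on_flat_exp: "smooth_on (flat_exp n) UNIV"
proof -
  have cont: "continuous_on UNIV (flat_exp n)" for n
    using flat_exp_has_derivative DERIV_isCont continuous_at_imp_continuous_on by blast
  have "Ck_on k (flat_exp n) UNIV" for k
  proof (induction k arbitrary: n)
    case 0
    then show ?case using cont by simp
  next
    case (Suc k)
    have "Ck_on k (\<lambda>t. e *\<^sub>R (flat_exp (n + 2) t + (- real n) *\<^sub>R flat_exp (n + 1) t)) UNIV" for e
      by (intro Ck_on_scaleR Ck_on_add Ck_on_const Suc)
    then have "Ck_on k (\<lambda>t. (flat_exp (n + 2) t - real n * flat_exp (n + 1) t) * e) UNIV" for e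
      by (simp add: mult.commute)
    then show ?case
      using flat_exp_has_derivative[of n]
      by (intro Ck_on_SucI[where f' = "\<lambda>t e. (flat_exp (n + 2) t - real n * flat_exp (n + 1) t) * e"])
         (simp_all add: has_field_derivative_def)
  qed
  then show ?thesis by (simp add: smooth_on_def)
qed

section \<open>The fundamental lemma of the calculus of variations\<close>

text \<open>The sets over which an integrable function has vanishing integral form a Dynkin system, and
  open boxes are a generator of the Borel sets that is stable under intersections.\<close>

lemma AE_zero_if_box_integrals_zero:
  fixes f :: "'a::euclidean_space \<Rightarrow> real"
  assumes f: "integrable lebesgue f"
    and box: "\<And>a b. (LINT x|lebesgue. indicator (box a b) x * f x) = 0"
  shows "AE x in lebesgue. f x = 0"
proof -
  have [measurable]: "f \<in> borel_measurable lebesgue" using f by auto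
  have int: "integrable lebesgue (\<lambda>x. indicator A x * f x)" if "A \<in> sets borel" for A
    using integrable_mult_indicator[OF _ f, of A] that by simp
  have total: "integral\<^sup>L lebesgue f = 0"
  proof -
    let ?B = "\<lambda>n::nat. box (- real n *\<^sub>R One) (real n *\<^sub>R One) :: 'a set"
    have "(\<lambda>n. LINT x|lebesgue. indicator (?B n) x * f x) \<longlonglongrightarrow> integral\<^sup>L lebesgue f"
    proof (rule integral_dominated_convergence[where w = "\<lambda>x. norm (f x)"])
      show "AE x in lebesgue. (\<lambda>n. indicator (?B n) x * f x) \<longlonglongrightarrow> f x"
      proof (rule AE_I2)
        fix x :: 'a
        have "x \<in> (\<Union>i::nat. ?B i)" using UN_box_eq_UNIV by auto
        then obtain n0 where n0: "x \<in> ?B n0" by auto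
        have "x \<in> ?B n" if "n \<ge> n0" for n
        proof -
          have "?B n0 \<subseteq> ?B n"
            unfolding subset_box using that by auto
          then show ?thesis using n0 by blast
        qed
        then have "eventually (\<lambda>n. f x = indicator (?B n) x * f x) sequentially"
          unfolding eventually_sequentially by (intro exI[of _ n0]) (simp add: indicator_def)
        then show "(\<lambda>n. indicator (?B n) x * f x) \<longlonglongrightarrow> f x"
          by (rule Lim_transform_eventually[OF tendsto_const])
      qed
      show "AE x in lebesgue. norm (indicator (?B n) x * f x) \<le> norm (f x)" for n
        by (rule AE_I2) (auto simp: indicator_def)
    qed (use f int in auto)
    then have "(\<lambda>n. 0) \<longlonglongrightarrow> integral\<^sup>L lebesgue f" using box by simp
    then show ?thesis by (rule LIMSEQ_unique[OF tendsto_const, symmetric])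
  qed
  have zero: "(LINT x|lebesgue. indicator A x * f x) = 0" if "A \<in> sets borel" for A
  proof -
    have "Int_stable (range (\<lambda>(a, b). box a b :: 'a set))"
      by (auto simp: Int_stable_def box_Int_box)
    moreover have "range (\<lambda>(a, b). box a b :: 'a set) \<subseteq> Pow UNIV" by auto
    moreover have "A \<in> sigma_sets UNIV (range (\<lambda>(a, b). box a b))"
      using that unfolding borel_eq_box by simp
    ultimately show ?thesis
    proof (induction rule: sigma_sets_induct_disjoint)
      case (basic A)
      then show ?case using box by auto
    next
      case empty
      then show ?case by simp
    next
      case (compl A)
      then have A: "A \<in> sets borel" by (simp add: borel_eq_box)
      have "(\<lambda>x. indicator (UNIV - A) x * f x) = (\<lambda>x. f x - indicator A x * f x)"
        by (auto simp: indicator_def)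
      then show ?case using compl total f int[OF A] by simp
    next
      case (union F)
      then have F: "\<And>i. F i \<in> sets borel" by (simp add: borel_eq_box subset_eq)
      have "(LINT x:(\<Union>i. F i)|lebesgue. f x) = (\<Sum>i. (LINT x:(F i)|lebesgue. f x))"
      proof (rule lebesgue_integral_countable_add)
        show "set_integrable lebesgue (\<Union>i. F i) f"
          using int[of "\<Union>i. F i"] F by (simp add: set_integrable_def)
      qed (use union(1) F in \<open>auto simp: disjoint_family_on_def\<close>)
      then show ?case using union by (simp add: set_lebesgue_integral_def)
    qed
  qed
  \<comment> \<open>A Borel version of \<open>f\<close> makes the sets on which its sign is constant Borel sets.\<close>
  obtain g where g[measurable]: "g \<in> borel_measurable borel" and fg: "AE x in lborel. f x = g x"
    using completion_ex_borel_measurable_real[of f lborel] f by auto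
  have fg: "AE x in lebesgue. f x = g x" using fg by (rule AE_completion)
  have half: "AE x in lebesgue. indicator A x * f x = 0"
    if A: "A \<in> sets borel" and sgn: "\<And>x. x \<in> A \<Longrightarrow> 0 \<le> s * g x" "s \<noteq> 0" for A s
  proof -
    have "AE x in lebesgue. s * (indicator A x * f x) = 0"
    proof (rule integral_nonneg_eq_0_iff_AE[THEN iffD1])
      show "AE x in lebesgue. 0 \<le> s * (indicator A x * f x)"
        using fg by eventually_elim (use sgn in \<open>auto simp: indicator_def\<close>)
    qed (use int[OF A] zero[OF A] in auto)
    then show ?thesis using sgn by auto
  qed
  have "AE x in lebesgue. indicator {x. 0 \<le> g x} x * f x = 0"
    by (rule half[where s = 1]) auto
  moreover have "AE x in lebesgue. indicator {x. g x \<le> 0} x * f x = 0"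
    by (rule half[where s = "-1"]) auto
  ultimately show ?thesis
    by eventually_elim (auto simp: indicator_def split: if_splits)
qed

text \<open>As \<open>k\<close> tends to infinity these functions increase to the indicator function of the box.\<close>

definition box_bump :: "real \<Rightarrow> 'a::euclidean_space \<Rightarrow> 'a \<Rightarrow> 'a \<Rightarrow> real" where
  "box_bump k a b x =
     (\<Prod>i\<in>Basis. flat_exp 0 (k * (x \<bullet> i - a \<bullet> i)) * flat_exp 0 (k * (b \<bullet> i - x \<bullet> i)))"

lemma smooth_on_box_bump: "smooth_on (box_bump k a b) UNIV"
proof -
  have lin: "linear (\<lambda>x::'a. c * (x \<bullet> i))" for c :: real and i
    by (auto intro!: linearI simp: inner_simps algebra_simps)
  have "smooth_on (\<lambda>x. flat_exp 0 (k * (x \<bullet> i) + (- k * (a \<bullet> i)))) UNIV" for i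
    by (rule smooth_on_compose_affine[OF lin smooth_on_flat_exp])
  moreover have "smooth_on (\<lambda>x. flat_exp 0 ((- k) * (x \<bullet> i) + k * (b \<bullet> i))) UNIV" for i
    by (rule smooth_on_compose_affine[OF lin smooth_on_flat_exp])
  ultimately show ?thesis
    unfolding box_bump_def
    by (intro smooth_on_prod smooth_on_mult) (simp_all add: algebra_simps)
qed

lemma flat_exp_0_bounds: "0 \<le> flat_exp 0 t" "flat_exp 0 t \<le> 1"
  by (auto simp: flat_exp_def)

lemma box_bump_bounds: "0 \<le> box_bump k a b x" "box_bump k a b x \<le> 1"
  unfolding box_bump_def
  by (auto intro!: prod_nonneg prod_le_1 mult_nonneg_nonneg mult_le_one flat_exp_0_bounds)

lemma box_bump_eq_0:
  assumes "k > 0" "x \<notin> box a b"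
  shows "box_bump k a b x = 0"
proof -
  obtain i where "i \<in> Basis" "x \<bullet> i \<le> a \<bullet> i \<or> b \<bullet> i \<le> x \<bullet> i"
    using assms(2) by (force simp: mem_box)
  then show ?thesis
    unfolding box_bump_def using assms(1)
    by (intro prod_zero[OF finite_Basis] bexI[of _ i]) (auto simp: flat_exp_def zero_less_mult_iff)
qed

lemma box_bump_tendsto: "(\<lambda>n. box_bump (real (Suc n)) a b x) \<longlonglongrightarrow> indicator (box a b) x"
proof (cases "x \<in> box a b")
  case True
  have "(\<lambda>n. flat_exp 0 (real (Suc n) * t)) \<longlonglongrightarrow> 1" if "t > 0" for t
  proof -
    have "(\<lambda>n. inverse (real (Suc n)) * inverse t) \<longlonglongrightarrow> 0"
      using tendsto_mult_left_zero[OF LIMSEQ_inverse_real_of_nat] by simp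
    then have "(\<lambda>n. exp (- (inverse (real (Suc n)) * inverse t))) \<longlonglongrightarrow> exp (- 0)"
      by (intro tendsto_intros)
    then show ?thesis using that by (simp add: flat_exp_def inverse_mult_distrib zero_less_mult_iff del: of_nat_Suc)
  qed
  then have "(\<lambda>n. box_bump (real (Suc n)) a b x) \<longlonglongrightarrow> (\<Prod>i\<in>(Basis::'a set). 1 * 1)"
    unfolding box_bump_def using True
    by (intro tendsto_prod tendsto_mult) (auto simp: mem_box simp del: of_nat_Suc)
  then show ?thesis using True by simp
next
  case False
  then show ?thesis by (simp add: box_bump_eq_0)
qed

lemma test_functionI:
  assumes "smooth_on f UNIV" "compact K" "K \<subseteq> U" "\<And>x. x \<notin> K \<Longrightarrow> f x = 0"
  shows "test_function U f"
proof -
  have *: "closure {x. f x \<noteq> 0} \<subseteq> K"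
    using assms(2,4) by (intro closure_minimal compact_imp_closed) auto
  have "compact (closure {x. f x \<noteq> 0})"
    using compact_Int_closed[OF assms(2) closed_closure] * by (metis inf.absorb_iff2)
  then show ?thesis using assms * by (auto simp: test_function_def)
qed

lemma test_functionD:
  assumes "test_function U f"
  shows "\<exists>K. compact K \<and> K \<subseteq> U \<and> smooth_on f UNIV \<and>
    (\<forall>x. x \<notin> K \<longrightarrow> f x = 0 \<and> (\<forall>e. frechet_derivative f (at x) e = 0))"
proof -
  define K where "K = closure {x. f x \<noteq> 0}"
  have 0: "f x = 0" if "x \<notin> K" for x
    using that closure_subset[of "{x. f x \<noteq> 0}"] unfolding K_def by blast
  have "closed K" by (simp add: K_def)
  have "frechet_derivative f (at x) e = 0" if "x \<notin> K" for x e
  proof -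
    have "((\<lambda>_. 0) has_derivative (\<lambda>_. 0)) (at x)" by simp
    moreover have "open (- K)" using \<open>closed K\<close> by (simp add: open_Compl)
    moreover have "x \<in> - K" using that by simp
    ultimately have "(f has_derivative (\<lambda>_. 0)) (at x)"
      by (rule has_derivative_transform_within_open) (use 0 in simp)
    from frechet_derivative_at[OF this, symmetric] show ?thesis by simp
  qed
  then show ?thesis
    using assms 0 unfolding test_function_def K_def[symmetric] by blast
qed

lemma test_function_box_bump:
  assumes "k > 0" "cbox a b \<subseteq> U"
  shows "test_function U (box_bump k a b)"
proof (rule test_functionI)
  show "box_bump k a b x = 0" if "x \<notin> cbox a b" for x
    using that box_subset_cbox[of a b] by (intro box_bump_eq_0[OF assms(1)]) auto
qed (use assms smooth_on_box_bump in auto)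

lemma L1_loc_scaleR_integrable:
  fixes \<phi> :: "'a::euclidean_space \<Rightarrow> real" and u :: "'a \<Rightarrow> 'b::euclidean_space"
  assumes U: "U \<in> sets lebesgue" and u: "L1_loc U u"
    and \<phi>: "\<phi> \<in> borel_measurable borel" "\<And>x. x \<in> K \<Longrightarrow> \<bar>\<phi> x\<bar> \<le> B"
    and K: "compact K" "K \<subseteq> U" "\<And>x. x \<notin> K \<Longrightarrow> \<phi> x = 0"
  shows "integrable (lebesgue_on U) (\<lambda>x. \<phi> x *\<^sub>R u x)"
proof -
  have uK: "integrable lebesgue (\<lambda>x. indicator K x *\<^sub>R u x)"
    using u K by (auto simp: L1_loc_def set_integrable_def)
  have "integrable lebesgue (\<lambda>x. \<phi> x *\<^sub>R (indicator K x *\<^sub>R u x))"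
  proof (rule Bochner_Integration.integrable_bound)
    show "integrable lebesgue (\<lambda>x. B *\<^sub>R (indicator K x *\<^sub>R u x))"
      using uK by (rule integrable_scaleR_right)
    have "\<phi> \<in> borel_measurable lebesgue" using \<phi> by (simp add: measurable_completion)
    then show "(\<lambda>x. \<phi> x *\<^sub>R (indicator K x *\<^sub>R u x)) \<in> borel_measurable lebesgue"
      using borel_measurable_integrable[OF uK] by (rule borel_measurable_scaleR)
    show "AE x in lebesgue. norm (\<phi> x *\<^sub>R (indicator K x *\<^sub>R u x)) \<le> norm (B *\<^sub>R (indicator K x *\<^sub>R u x))"
    proof (rule AE_I2)
      fix x
      show "norm (\<phi> x *\<^sub>R (indicator K x *\<^sub>R u x)) \<le> norm (B *\<^sub>R (indicator K x *\<^sub>R u x))"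
      proof (cases "x \<in> K")
        case True
        then have "\<bar>\<phi> x\<bar> \<le> \<bar>B\<bar>" using \<phi>(2)[OF True] by simp
        then show ?thesis using True by (simp add: mult_right_mono)
      qed simp
    qed
  qed
  moreover have "(\<lambda>x. \<phi> x *\<^sub>R (indicator K x *\<^sub>R u x)) = (\<lambda>x. indicator U x *\<^sub>R (\<phi> x *\<^sub>R u x))"
  proof
    fix x
    show "\<phi> x *\<^sub>R (indicator K x *\<^sub>R u x) = indicator U x *\<^sub>R (\<phi> x *\<^sub>R u x)"
      using K by (cases "x \<in> K") auto
  qed
  ultimately have "integrable lebesgue (\<lambda>x. indicator U x *\<^sub>R (\<phi> x *\<^sub>R u x))" by simp
  then show ?thesis using U by (subst integrable_restrict_space) auto
qed

lemma continuous_bounded_on_compact: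
  fixes \<phi> :: "'a::topological_space \<Rightarrow> real"
  assumes "continuous_on UNIV \<phi>" "compact K"
  shows "\<exists>B. \<forall>x\<in>K. \<bar>\<phi> x\<bar> \<le> B"
proof -
  have "bounded (\<phi> ` K)"
    by (intro compact_imp_bounded compact_continuous_image continuous_on_subset[OF assms(1)] assms(2)) simp
  then obtain B where "\<forall>y\<in>\<phi> ` K. norm y \<le> B" by (auto simp: bounded_iff)
  then show ?thesis by auto
qed

lemma integrable_test_function_scaleR:
  assumes "open U" "L1_loc U u" "test_function U (\<phi> :: _ \<Rightarrow> real)"
  shows "integrable (lebesgue_on U) (\<lambda>x. \<phi> x *\<^sub>R u x)"
    and "integrable (lebesgue_on U) (\<lambda>x. frechet_derivative \<phi> (at x) e *\<^sub>R u x)"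
proof -
  obtain K where K: "compact K" "K \<subseteq> U" "smooth_on \<phi> UNIV"
    "\<forall>x. x \<notin> K \<longrightarrow> \<phi> x = 0 \<and> (\<forall>e. frechet_derivative \<phi> (at x) e = 0)"
    using test_functionD[OF assms(3)] by blast
  have *: "integrable (lebesgue_on U) (\<lambda>x. f x *\<^sub>R u x)"
    if f: "smooth_on f UNIV" "\<And>x. x \<notin> K \<Longrightarrow> f x = 0" for f :: "_ \<Rightarrow> real"
  proof -
    have "continuous_on UNIV f" by (rule smooth_on_continuous[OF f(1)])
    moreover obtain B where "\<forall>x\<in>K. \<bar>f x\<bar> \<le> B"
      using continuous_bounded_on_compact[OF \<open>continuous_on UNIV f\<close> K(1)] by blast
    ultimately show ?thesis
      using assms K(1,2) f(2)
      by (intro L1_loc_scaleR_integrable[where K = K and B = B])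
         (simp_all add: borel_measurable_continuous_onI)
  qed
  show "integrable (lebesgue_on U) (\<lambda>x. \<phi> x *\<^sub>R u x)"
    by (rule *) (use K(3,4) in simp_all)
  show "integrable (lebesgue_on U) (\<lambda>x. frechet_derivative \<phi> (at x) e *\<^sub>R u x)"
    by (rule *) (use smooth_on_frechet_derivative[OF K(3)] K(4) in simp_all)
qed

text \<open>Testing with bumps that tend to the indicator function of a box shows that the integral of \<open>h\<close> over
  every box inside \<open>U\<close> vanishes.\<close>

lemma fundamental_lemma_real:
  fixes h :: "'a::euclidean_space \<Rightarrow> real"
  assumes U: "open U" and h: "L1_loc U h"
    and zero: "\<And>\<phi>. test_function U \<phi> \<Longrightarrow> (LINT x|lebesgue_on U. \<phi> x * h x) = 0"
  shows "AE x in lebesgue_on U. h x = 0"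
proof -
  have on_cbox: "AE x in lebesgue. x \<in> cbox p q \<longrightarrow> h x = 0" if pq: "cbox p q \<subseteq> U" for p q
  proof -
    have hI: "integrable lebesgue (\<lambda>x. indicator (cbox p q) x * h x)"
      using h pq by (auto simp: L1_loc_def set_integrable_def)
    note hm = borel_measurable_integrable[OF hI]
    have open_box: "(LINT x|lebesgue. indicator (box a b) x * (indicator (cbox p q) x * h x)) = 0"
      if ab: "cbox a b \<subseteq> cbox p q" for a b
    proof -
      have "(\<lambda>n. LINT x|lebesgue. box_bump (real (Suc n)) a b x * (indicator (cbox p q) x * h x))
          \<longlonglongrightarrow> (LINT x|lebesgue. indicator (box a b) x * (indicator (cbox p q) x * h x))"
      proof (rule integral_dominated_convergence[where w = "\<lambda>x. norm (indicator (cbox p q) x * h x)"])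
        show "AE x in lebesgue. (\<lambda>n. box_bump (real (Suc n)) a b x * (indicator (cbox p q) x * h x))
          \<longlonglongrightarrow> indicator (box a b) x * (indicator (cbox p q) x * h x)"
          by (intro AE_I2 tendsto_mult_right box_bump_tendsto)
        show "AE x in lebesgue. norm (box_bump (real (Suc n)) a b x * (indicator (cbox p q) x * h x))
          \<le> norm (indicator (cbox p q) x * h x)" for n
        proof (rule AE_I2)
          fix x
          have "\<bar>box_bump (real (Suc n)) a b x\<bar> \<le> 1"
            using box_bump_bounds[of "real (Suc n)" a b x] by (simp del: of_nat_Suc)
          then show "norm (box_bump (real (Suc n)) a b x * (indicator (cbox p q) x * h x))
            \<le> norm (indicator (cbox p q) x * h x)"
            by (simp add: abs_mult[of "box_bump (real (Suc n)) a b x"] mult_left_le_one_le del: of_nat_Suc)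
        qed
        show "integrable lebesgue (\<lambda>x. norm (indicator (cbox p q) x * h x))"
          using hI by (rule integrable_norm)
        have m: "box_bump k a b \<in> borel_measurable lebesgue" for k
          by (intro measurable_completion)
             (simp add: borel_measurable_continuous_onI smooth_on_continuous smooth_on_box_bump)
        show "(\<lambda>x. box_bump (real (Suc n)) a b x * (indicator (cbox p q) x * h x)) \<in> borel_measurable lebesgue" for n
          by (rule borel_measurable_times[OF m hm])
        show "(\<lambda>x. indicator (box a b) x * (indicator (cbox p q) x * h x)) \<in> borel_measurable lebesgue"
          by (rule borel_measurable_times[OF borel_measurable_indicator hm]) simp
      qed
      moreover have "(LINT x|lebesgue. box_bump (real (Suc n)) a b x * (indicator (cbox p q) x * h x)) = 0" for n
      proof -
        have eq: "box_bump (real (Suc n)) a b x * (indicator (cbox p q) x * h x)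
            = indicator U x *\<^sub>R (box_bump (real (Suc n)) a b x * h x)" for x
        proof (cases "x \<in> box a b")
          case True
          then have "x \<in> cbox p q" "x \<in> U" using ab pq box_subset_cbox[of a b] by auto
          then show ?thesis by simp
        next
          case False
          then show ?thesis by (simp add: box_bump_eq_0 del: of_nat_Suc)
        qed
        have "(LINT x|lebesgue. box_bump (real (Suc n)) a b x * (indicator (cbox p q) x * h x))
           = (LINT x|lebesgue_on U. box_bump (real (Suc n)) a b x * h x)"
          unfolding eq by (rule integral_restrict_space[symmetric]) (use U in simp)
        also have "\<dots> = 0"
          by (rule zero[OF test_function_box_bump]) (use ab pq in auto)
        finally show ?thesis .
      qed
      ultimately have "(\<lambda>n. 0) \<longlonglongrightarrow> (LINT x|lebesgue. indicator (box a b) x * (indicator (cbox p q) x * h x))"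
        by (simp del: of_nat_Suc)
      then show ?thesis by (rule LIMSEQ_unique[OF tendsto_const, symmetric])
    qed
    have "AE x in lebesgue. indicator (cbox p q) x * h x = 0"
    proof (rule AE_zero_if_box_integrals_zero[OF hI])
      fix a b :: 'a
      obtain r s where rs: "box a b \<inter> box p q = box r s" using box_Int_box[of a b p q] by blast
      have null: "AE x in lebesgue. x \<notin> cbox p q - box p q"
        using negligible_frontier_interval[of p q] unfolding negligible_iff_null_sets by (rule AE_not_in)
      have "(LINT x|lebesgue. indicator (box a b) x * (indicator (cbox p q) x * h x))
          = (LINT x|lebesgue. indicator (box r s) x * (indicator (cbox p q) x * h x))"
      proof (rule integral_cong_AE)
        show "AE x in lebesgue. indicator (box a b) x * (indicator (cbox p q) x * h x)
          = indicator (box r s) x * (indicator (cbox p q) x * h x)"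
          using null
        proof eventually_elim
          case (elim x)
          have "x \<in> box r s \<longleftrightarrow> x \<in> box a b \<and> x \<in> box p q" unfolding rs[symmetric] by simp
          then show ?case using elim by (simp add: indicator_def)
        qed
      qed (rule borel_measurable_times[OF borel_measurable_indicator hm], simp)+
      also have "\<dots> = 0"
      proof (cases "box r s = {}")
        case False
        then have "cbox r s = closure (box r s)" by (simp add: closure_box)
        also have "\<dots> \<subseteq> cbox p q"
          using rs box_subset_cbox[of p q] by (intro closure_minimal) auto
        finally show ?thesis by (rule open_box)
      qed simp
      finally show "(LINT x|lebesgue. indicator (box a b) x * (indicator (cbox p q) x * h x)) = 0" .
    qed
    then show ?thesis by eventually_elim (auto simp: indicator_def split: if_splits)
  qed
  obtain \<D> where D: "countable \<D>" "\<D> \<subseteq> Pow U" "\<And>X. X \<in> \<D> \<Longrightarrow> \<exists>a b. X = cbox a b" "\<Union>\<D> = U"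
    using open_countable_Union_open_cbox[OF U] by metis
  have "AE x in lebesgue. \<forall>X\<in>\<D>. x \<in> X \<longrightarrow> h x = 0"
  proof (subst AE_ball_countable[OF D(1)], rule ballI)
    fix X assume "X \<in> \<D>"
    then obtain a b where "X = cbox a b" "cbox a b \<subseteq> U" using D(2,3) by blast
    then show "AE x in lebesgue. x \<in> X \<longrightarrow> h x = 0" using on_cbox by auto
  qed
  then have "AE x in lebesgue. x \<in> U \<longrightarrow> h x = 0"
    by eventually_elim (use D(4) in auto)
  then show ?thesis using U by (simp add: AE_restrict_space_iff)
qed

lemma L1_loc_bounded_linear:
  fixes T :: "'b::euclidean_space \<Rightarrow> 'c::euclidean_space" and u :: "'a::euclidean_space \<Rightarrow> 'b"
  assumes "bounded_linear T" "L1_loc U u"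
  shows "L1_loc U (\<lambda>x. T (u x))"
  unfolding L1_loc_def
proof (intro allI impI)
  fix K assume "compact K \<and> K \<subseteq> U"
  then have "u absolutely_integrable_on K" using assms(2) by (simp add: L1_loc_def)
  from absolutely_integrable_linear[OF this assms(1)]
  show "(\<lambda>x. T (u x)) absolutely_integrable_on K" by (simp add: o_def)
qed

lemma fundamental_lemma:
  fixes h :: "'a::euclidean_space \<Rightarrow> 'b::euclidean_space"
  assumes U: "open U" and h: "L1_loc U h"
    and zero: "\<And>\<phi>. test_function U \<phi> \<Longrightarrow> (LINT x|lebesgue_on U. \<phi> x *\<^sub>R h x) = 0"
  shows "AE x in lebesgue_on U. h x = 0"
proof -
  have "AE x in lebesgue_on U. h x \<bullet> b = 0" if b: "b \<in> Basis" for b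
  proof (rule fundamental_lemma_real[OF U])
    show "L1_loc U (\<lambda>x. h x \<bullet> b)"
      by (rule L1_loc_bounded_linear[OF bounded_linear_inner_left h])
    fix \<phi> :: "'a \<Rightarrow> real" assume \<phi>: "test_function U \<phi>"
    have "(LINT x|lebesgue_on U. \<phi> x * (h x \<bullet> b)) = (LINT x|lebesgue_on U. (\<phi> x *\<^sub>R h x) \<bullet> b)"
      by simp
    also have "\<dots> = (LINT x|lebesgue_on U. \<phi> x *\<^sub>R h x) \<bullet> b"
      by (rule integral_inner_left) (use integrable_test_function_scaleR[OF U h \<phi>] in auto)
    finally show "(LINT x|lebesgue_on U. \<phi> x * (h x \<bullet> b)) = 0" using zero[OF \<phi>] by simp
  qed
  then have "AE x in lebesgue_on U. \<forall>b\<in>Basis. h x \<bullet> b = 0"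
    by (simp add: AE_finite_all)
  then show ?thesis by eventually_elim (simp add: euclidean_all_zero_iff)
qed

section \<open>Square integrable functions\<close>

definition square_integrable :: "'a measure \<Rightarrow> ('a \<Rightarrow> 'b::euclidean_space) \<Rightarrow> bool" where
  "square_integrable M f \<longleftrightarrow> f \<in> borel_measurable M \<and> integrable M (\<lambda>x. (norm (f x))\<^sup>2)"

abbreviation sq_norm :: "'a measure \<Rightarrow> ('a \<Rightarrow> 'b::euclidean_space) \<Rightarrow> real" where
  "sq_norm M f \<equiv> LINT x|M. (norm (f x))\<^sup>2"

lemma L2_on_eq: "L2_on S f \<longleftrightarrow> square_integrable (lebesgue_on S) f"
  by (simp add: L2_on_def square_integrable_def)

lemma square_integrable_measurable: "square_integrable M f \<Longrightarrow> f \<in> borel_measurable M"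
  by (simp add: square_integrable_def)

lemma square_integrable_integrable: "square_integrable M f \<Longrightarrow> integrable M (\<lambda>x. (norm (f x))\<^sup>2)"
  by (simp add: square_integrable_def)

lemma square_integrable_bound:
  assumes "square_integrable M f" "g \<in> borel_measurable M"
    and "AE x in M. norm (g x) \<le> B * norm (f x)"
  shows "square_integrable M g"
    and "sq_norm M g \<le> B\<^sup>2 * sq_norm M f"
proof -
  have *: "AE x in M. (norm (g x))\<^sup>2 \<le> B\<^sup>2 * (norm (f x))\<^sup>2"
    using assms(3)
  proof eventually_elim
    case (elim x)
    then have "(norm (g x))\<^sup>2 \<le> (B * norm (f x))\<^sup>2" by (intro power_mono) auto
    then show ?case by (simp add: power_mult_distrib)
  qed
  have i: "integrable M (\<lambda>x. B\<^sup>2 * (norm (f x))\<^sup>2)"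
    using assms(1) by (simp add: square_integrable_def)
  have g2: "integrable M (\<lambda>x. (norm (g x))\<^sup>2)"
  proof (rule Bochner_Integration.integrable_bound[OF i])
    show "(\<lambda>x. (norm (g x))\<^sup>2) \<in> borel_measurable M" using assms(2) by measurable
    show "AE x in M. norm ((norm (g x))\<^sup>2) \<le> norm (B\<^sup>2 * (norm (f x))\<^sup>2)"
      using * by eventually_elim simp
  qed
  then show "square_integrable M g" using assms(2) by (simp add: square_integrable_def)
  have "sq_norm M g \<le> (LINT x|M. B\<^sup>2 * (norm (f x))\<^sup>2)"
    by (rule integral_mono_AE[OF g2 i *])
  then show "sq_norm M g \<le> B\<^sup>2 * sq_norm M f" by simp
qed

lemma norm_add_square_le:
  fixes x y :: "'a::real_normed_vector"
  shows "(norm (x + y))\<^sup>2 \<le> 2 * (norm x)\<^sup>2 + 2 * (norm y)\<^sup>2"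
proof -
  have "(norm (x + y))\<^sup>2 \<le> (norm x + norm y)\<^sup>2"
    by (intro power_mono norm_triangle_ineq) auto
  also have "\<dots> \<le> 2 * (norm x)\<^sup>2 + 2 * (norm y)\<^sup>2"
    using zero_le_power2[of "norm x - norm y"] by (simp add: power2_eq_square algebra_simps)
  finally show ?thesis .
qed

lemma square_integrable_add:
  assumes "square_integrable M f" "square_integrable M g"
  shows "square_integrable M (\<lambda>x. f x + g x)"
    and "sq_norm M (\<lambda>x. f x + g x) \<le> 2 * sq_norm M f + 2 * sq_norm M g"
proof -
  have m: "(\<lambda>x. f x + g x) \<in> borel_measurable M"
    using assms by (auto simp: square_integrable_def)
  have i: "integrable M (\<lambda>x. 2 * (norm (f x))\<^sup>2 + 2 * (norm (g x))\<^sup>2)"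
    using assms by (simp add: square_integrable_def)
  have s: "integrable M (\<lambda>x. (norm (f x + g x))\<^sup>2)"
  proof (rule Bochner_Integration.integrable_bound[OF i])
    show "(\<lambda>x. (norm (f x + g x))\<^sup>2) \<in> borel_measurable M" using m by measurable
    show "AE x in M. norm ((norm (f x + g x))\<^sup>2) \<le> norm (2 * (norm (f x))\<^sup>2 + 2 * (norm (g x))\<^sup>2)"
      by (intro AE_I2) (simp add: norm_add_square_le)
  qed
  then show "square_integrable M (\<lambda>x. f x + g x)" using m by (simp add: square_integrable_def)
  have "sq_norm M (\<lambda>x. f x + g x) \<le> (LINT x|M. 2 * (norm (f x))\<^sup>2 + 2 * (norm (g x))\<^sup>2)"
    by (intro integral_mono s i norm_add_square_le)
  then show "sq_norm M (\<lambda>x. f x + g x) \<le> 2 * sq_norm M f + 2 * sq_norm M g"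
    using assms by (simp add: square_integrable_def)
qed

lemma square_integrable_scaleR:
  assumes "square_integrable M f"
  shows "square_integrable M (\<lambda>x. c *\<^sub>R f x)" "sq_norm M (\<lambda>x. c *\<^sub>R f x) = c\<^sup>2 * sq_norm M f"
  using assms by (auto simp: square_integrable_def power_mult_distrib)

lemma square_integrable_diff:
  assumes "square_integrable M f" "square_integrable M g"
  shows "square_integrable M (\<lambda>x. f x - g x)"
  using square_integrable_add(1)[OF assms(1) square_integrable_scaleR(1)[OF assms(2), of "-1"]]
  by simp

lemma square_integrable_zero: "square_integrable M (\<lambda>x. 0)"
  by (simp add: square_integrable_def)

lemma square_integrable_sum:
  assumes "\<And>i. i \<in> I \<Longrightarrow> square_integrable M (f i)"
  shows "square_integrable M (\<lambda>x. \<Sum>i\<in>I. f i x)"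
  using assms
  by (induction I rule: infinite_finite_induct)
     (auto intro: square_integrable_add(1) square_integrable_zero)

lemma integrable_norm_product:
  assumes "square_integrable M f" "square_integrable M g"
  shows "integrable M (\<lambda>x. norm (f x) * norm (g x))"
proof (rule Bochner_Integration.integrable_bound)
  show "integrable M (\<lambda>x. (norm (f x))\<^sup>2 + (norm (g x))\<^sup>2)"
    using assms by (simp add: square_integrable_def)
  show "(\<lambda>x. norm (f x) * norm (g x)) \<in> borel_measurable M"
    using assms by (auto simp: square_integrable_def)
  have "a * b \<le> a\<^sup>2 + b\<^sup>2" if "0 \<le> a" "0 \<le> b" for a b :: real
    using sum_squares_bound[of a b] mult_nonneg_nonneg[OF that] by linarith
  then show "AE x in M. norm (norm (f x) * norm (g x)) \<le> norm ((norm (f x))\<^sup>2 + (norm (g x))\<^sup>2)"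
    by (intro AE_I2) simp
qed

lemma integrable_inner_product:
  assumes "square_integrable M f" "square_integrable M g"
  shows "integrable M (\<lambda>x. f x \<bullet> g x)"
proof (rule Bochner_Integration.integrable_bound[OF integrable_norm_product[OF assms]])
  show "(\<lambda>x. f x \<bullet> g x) \<in> borel_measurable M"
    using assms by (auto simp: square_integrable_def)
  show "AE x in M. norm (f x \<bullet> g x) \<le> norm (norm (f x) * norm (g x))"
    by (intro AE_I2) (simp add: Cauchy_Schwarz_ineq2)
qed

lemma integrable_scaleR_product:
  assumes "square_integrable M \<phi>" "square_integrable M g"
  shows "integrable M (\<lambda>x. \<phi> x *\<^sub>R g x)"
proof (rule Bochner_Integration.integrable_bound[OF integrable_norm_product[OF assms]])
  show "(\<lambda>x. \<phi> x *\<^sub>R g x) \<in> borel_measurable M"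
    using assms by (auto simp: square_integrable_def)
qed simp

lemma Cauchy_Schwarz_integral:
  assumes f: "square_integrable M f" and g: "square_integrable M g"
  shows "(LINT x|M. norm (f x) * norm (g x))\<^sup>2 \<le> sq_norm M f * sq_norm M g"
proof -
  define p q r where "p = sq_norm M f" "q = (LINT x|M. norm (f x) * norm (g x))" "r = sq_norm M g"
  note int = square_integrable_integrable[OF f] square_integrable_integrable[OF g]
    integrable_norm_product[OF f g]
  have nn: "0 \<le> s\<^sup>2 * p - 2 * s * q + r" for s
  proof -
    have "0 \<le> (LINT x|M. (s * norm (f x) - norm (g x))\<^sup>2)" by simp
    also have "\<dots> = (LINT x|M. s\<^sup>2 * (norm (f x))\<^sup>2 - 2 * s * (norm (f x) * norm (g x)) + (norm (g x))\<^sup>2)"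
      by (simp add: power2_eq_square algebra_simps)
    also have "\<dots> = s\<^sup>2 * p - 2 * s * q + r"
      using int by (simp add: p_q_r_def)
    finally show ?thesis .
  qed
  have p: "0 \<le> p" by (simp add: p_q_r_def)
  \<comment> \<open>The quadratic polynomial above is minimal at \<open>s = q / p\<close>; if \<open>p = 0\<close>, it is affine and nonnegative, hence constant.\<close>
  have "q\<^sup>2 \<le> p * r"
  proof (cases "p = 0")
    case True
    then have *: "2 * s * q \<le> r" for s using nn[of s] by simp
    have "q = 0"
    proof (rule ccontr)
      assume "q \<noteq> 0"
      then show False using *[of "(r + 1) / (2 * q)"] by simp
    qed
    then show ?thesis using True by simp
  next
    case False
    with p have "0 < p" by simp
    then have "0 \<le> p * ((q / p)\<^sup>2 * p - 2 * (q / p) * q + r)"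
      by (intro mult_nonneg_nonneg nn) simp
    also have "\<dots> = p * r - q\<^sup>2" using \<open>0 < p\<close> by (simp add: field_simps power2_eq_square)
    finally show ?thesis by simp
  qed
  then show ?thesis by (simp add: p_q_r_def)
qed

lemma tendsto_integral_scaleR_L2:
  assumes \<phi>: "square_integrable M (\<phi> :: _ \<Rightarrow> real)" and f: "\<And>n. square_integrable M (f n)" "square_integrable M g"
    and lim: "(\<lambda>n. sq_norm M (\<lambda>x. f n x - g x)) \<longlonglongrightarrow> 0"
  shows "(\<lambda>n. LINT x|M. \<phi> x *\<^sub>R f n x) \<longlonglongrightarrow> (LINT x|M. \<phi> x *\<^sub>R g x)"
proof (rule LIM_zero_cancel, rule Lim_null_comparison)
  have d: "square_integrable M (\<lambda>x. f n x - g x)" for n using f by (intro square_integrable_diff)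
  have "norm ((LINT x|M. \<phi> x *\<^sub>R f n x) - (LINT x|M. \<phi> x *\<^sub>R g x))
      \<le> sqrt (sq_norm M \<phi> * sq_norm M (\<lambda>x. f n x - g x))" for n
  proof -
    have "(LINT x|M. \<phi> x *\<^sub>R f n x) - (LINT x|M. \<phi> x *\<^sub>R g x) = (LINT x|M. \<phi> x *\<^sub>R (f n x - g x))"
      using \<phi> f by (simp add: integrable_scaleR_product scaleR_diff_right)
    also have "norm \<dots> \<le> (LINT x|M. norm (\<phi> x *\<^sub>R (f n x - g x)))"
      by (rule integral_norm_bound)
    also have "\<dots> = (LINT x|M. norm (\<phi> x) * norm (f n x - g x))" by simp
    also have "\<dots> \<le> sqrt (sq_norm M \<phi> * sq_norm M (\<lambda>x. f n x - g x))"
      using Cauchy_Schwarz_integral[OF \<phi> d] by (rule real_le_rsqrt)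
    finally show ?thesis .
  qed
  then show "\<forall>\<^sub>F n in sequentially. norm ((LINT x|M. \<phi> x *\<^sub>R f n x) - (LINT x|M. \<phi> x *\<^sub>R g x))
      \<le> sqrt (sq_norm M \<phi> * sq_norm M (\<lambda>x. f n x - g x))" by simp
  show "(\<lambda>n. sqrt (sq_norm M \<phi> * sq_norm M (\<lambda>x. f n x - g x))) \<longlonglongrightarrow> 0"
    using tendsto_real_sqrt[OF tendsto_mult_right_zero[OF lim, of "sq_norm M \<phi>"]] by simp
qed

lemma nn_integral_sq_norm:
  assumes "square_integrable M f"
  shows "(\<integral>\<^sup>+x. ennreal ((norm (f x))\<^sup>2) \<partial>M) = ennreal (sq_norm M f)"
  using assms by (intro nn_integral_eq_integral) (auto simp: square_integrable_def)

lemma square_integrable_nn_integralI: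
  assumes "f \<in> borel_measurable M" "(\<integral>\<^sup>+x. ennreal ((norm (f x))\<^sup>2) \<partial>M) \<le> ennreal B" "0 \<le> B"
  shows "square_integrable M f" "sq_norm M f \<le> B"
proof -
  have "integrable M (\<lambda>x. (norm (f x))\<^sup>2)"
    using assms by (intro integrableI_bounded) (auto intro: le_less_trans)
  then show *: "square_integrable M f" using assms by (simp add: square_integrable_def)
  show "sq_norm M f \<le> B" using assms nn_integral_sq_norm[OF *] by simp
qed

text \<open>Completeness of \<open>L\<^sup>2\<close>. A subsequence with fast decreasing differences converges almost
  everywhere, since \<open>\<Sum> 2\<^sup>k |g\<^sub>k\<^sub>+\<^sub>1 - g\<^sub>k|\<^sup>2\<close> has a finite integral; Fatou's lemma does the rest.\<close>

lemma L2_complete: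
  fixes g :: "nat \<Rightarrow> 'a \<Rightarrow> 'b::euclidean_space"
  assumes g: "\<And>n. square_integrable M (g n)"
    and cauchy: "\<And>e. e > 0 \<Longrightarrow> \<exists>K. \<forall>m\<ge>K. \<forall>n\<ge>K. sq_norm M (\<lambda>x. g m x - g n x) < e"
  shows "\<exists>h. square_integrable M h \<and> (\<lambda>n. sq_norm M (\<lambda>x. g n x - h x)) \<longlonglongrightarrow> 0"
proof -
  have [measurable]: "g n \<in> borel_measurable M" for n using g by (simp add: square_integrable_def)
  have d: "square_integrable M (\<lambda>x. g m x - g n x)" for m n using g by (intro square_integrable_diff)
  have "\<exists>K. \<forall>k. \<forall>m\<ge>K k. \<forall>n\<ge>K k. sq_norm M (\<lambda>x. g m x - g n x) < (1/4)^k"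
    by (intro choice allI cauchy) simp
  then obtain K where K: "\<And>k m n. m \<ge> K k \<Longrightarrow> n \<ge> K k \<Longrightarrow> sq_norm M (\<lambda>x. g m x - g n x) < (1/4)^k"
    by blast
  define r where "r k = k + (\<Sum>i\<le>k. K i)" for k
  have rK: "r k \<ge> K k" and rS: "r (Suc k) \<ge> K k" and rk: "r k \<ge> k" for k
    by (auto simp: r_def member_le_sum[of k] trans_le_add2 intro!: order_trans[OF member_le_sum[of k "{..k}" K]])
  let ?D = "\<lambda>k x. (norm (g (r (Suc k)) x - g (r k) x))\<^sup>2"
  have "(\<integral>\<^sup>+x. (\<Sum>k. ennreal (2^k * ?D k x)) \<partial>M) = (\<Sum>k. \<integral>\<^sup>+x. ennreal (2^k * ?D k x) \<partial>M)"
    by (rule nn_integral_suminf) measurable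
  also have "\<dots> \<le> (\<Sum>k. ennreal ((1/2)^k))"
  proof (intro suminf_le allI)
    fix k
    have "(\<integral>\<^sup>+x. ennreal (2^k * ?D k x) \<partial>M) = ennreal (2^k) * (\<integral>\<^sup>+x. ennreal (?D k x) \<partial>M)"
      by (simp add: ennreal_mult nn_integral_cmult)
    also have "\<dots> = ennreal (2^k * sq_norm M (\<lambda>x. g (r (Suc k)) x - g (r k) x))"
      by (simp add: nn_integral_sq_norm[OF d] ennreal_mult)
    also have "\<dots> \<le> ennreal (2^k * (1/4)^k)"
      by (intro ennreal_leI mult_left_mono less_imp_le K rK rS) auto
    also have "2^k * (1/4::real)^k = (1/2)^k" by (simp flip: power_mult_distrib)
    finally show "(\<integral>\<^sup>+x. ennreal (2^k * ?D k x) \<partial>M) \<le> ennreal ((1/2)^k)" .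
  qed auto
  also have "\<dots> < \<infinity>"
  proof -
    have "(\<lambda>k. (1/2::real)^k) sums 2" using geometric_sums[of "1/2::real"] by simp
    then have "(\<Sum>k. ennreal ((1/2)^k)) = ennreal 2" by (intro suminf_ennreal_eq) auto
    then show ?thesis by simp
  qed
  finally have fin: "(\<integral>\<^sup>+x. (\<Sum>k. ennreal (2^k * ?D k x)) \<partial>M) \<noteq> \<infinity>"
    by (rule less_imp_neq)
  have "(\<lambda>x. \<Sum>k. ennreal (2^k * ?D k x)) \<in> borel_measurable M" by measurable
  then have "AE x in M. (\<Sum>k. ennreal (2^k * ?D k x)) \<noteq> \<infinity>"
    using fin by (rule nn_integral_PInf_AE)
  then have conv: "AE x in M. convergent (\<lambda>k. g (r k) x)"
  proof eventually_elim
    case (elim x)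
    define S where "S = enn2real (\<Sum>k. ennreal (2^k * ?D k x))"
    have S: "0 \<le> S" by (simp add: S_def)
    have S': "(\<Sum>k. ennreal (2^k * ?D k x)) = ennreal S"
      unfolding S_def by (rule ennreal_enn2real[symmetric]) (use elim in \<open>simp only: less_top infinity_ennreal_def\<close>)
    have "norm (g (r (Suc k)) x - g (r k) x) \<le> sqrt S * (sqrt (1/2))^k" for k
    proof -
      have "(\<Sum>k\<in>{k}. ennreal (2^k * ?D k x)) \<le> (\<Sum>k. ennreal (2^k * ?D k x))"
        by (rule sum_le_suminf) simp_all
      then have "ennreal (2^k * ?D k x) \<le> ennreal S" unfolding S' by simp
      then have "2^k * ?D k x \<le> S" using S by (subst (asm) ennreal_le_iff)
      then have "?D k x \<le> S * (1/2)^k" by (simp add: field_simps)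
      then have "norm (g (r (Suc k)) x - g (r k) x) \<le> sqrt (S * (1/2)^k)"
        by (rule real_le_rsqrt)
      then show ?thesis by (simp add: real_sqrt_mult real_sqrt_power)
    qed
    moreover have "summable (\<lambda>k. sqrt S * (sqrt (1/2))^k)"
      by (intro summable_mult summable_geometric) (simp add: real_sqrt_divide)
    ultimately have "summable (\<lambda>k. g (r (Suc k)) x - g (r k) x)"
      by (rule summable_comparison_test'[rotated])
    then have "convergent (\<lambda>n. \<Sum>k<n. g (r (Suc k)) x - g (r k) x)"
      by (simp add: summable_iff_convergent)
    then have "convergent (\<lambda>n. g (r n) x - g (r 0) x)"
      by (simp only: sum_lessThan_telescope[of "\<lambda>k. g (r k) x"])
    then show ?case by (simp add: convergent_diff_const_right_iff)
  qed
  define h where "h x = lim (\<lambda>k. g (r k) x)" for x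
  have [measurable]: "h \<in> borel_measurable M" unfolding h_def by measurable
  have conv': "AE x in M. (\<lambda>k. g (r k) x) \<longlonglongrightarrow> h x"
    using conv by eventually_elim (simp add: h_def convergent_LIMSEQ_iff)
  have close: "square_integrable M (\<lambda>x. g n x - h x) \<and> sq_norm M (\<lambda>x. g n x - h x) \<le> (1/4)^k"
    if "n \<ge> K k" for n k
  proof -
    have "(\<integral>\<^sup>+x. ennreal ((norm (g n x - h x))\<^sup>2) \<partial>M)
        = (\<integral>\<^sup>+x. liminf (\<lambda>i. ennreal ((norm (g n x - g (r i) x))\<^sup>2)) \<partial>M)"
    proof (rule nn_integral_cong_AE)
      show "AE x in M. ennreal ((norm (g n x - h x))\<^sup>2)
          = liminf (\<lambda>i. ennreal ((norm (g n x - g (r i) x))\<^sup>2))"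
        using conv'
      proof eventually_elim
        case (elim x)
        have "(\<lambda>i. ennreal ((norm (g n x - g (r i) x))\<^sup>2)) \<longlonglongrightarrow> ennreal ((norm (g n x - h x))\<^sup>2)"
          by (intro tendsto_intros elim)
        from lim_imp_Liminf[OF sequentially_bot this, symmetric] show ?case .
      qed
    qed
    also have "\<dots> \<le> liminf (\<lambda>i. \<integral>\<^sup>+x. ennreal ((norm (g n x - g (r i) x))\<^sup>2) \<partial>M)"
      by (rule nn_integral_liminf) measurable
    also have "\<dots> \<le> ennreal ((1/4)^k)"
    proof (rule Liminf_le)
      show "\<forall>\<^sub>F i in sequentially. (\<integral>\<^sup>+x. ennreal ((norm (g n x - g (r i) x))\<^sup>2) \<partial>M) \<le> ennreal ((1/4)^k)"
        using eventually_ge_at_top[of "K k"]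
      proof eventually_elim
        case (elim i)
        then have "r i \<ge> K k" using rk[of i] by simp
        then show ?case
          using K[OF that] by (auto simp: nn_integral_sq_norm[OF d] intro!: ennreal_leI less_imp_le)
      qed
    qed simp
    finally show ?thesis
      using square_integrable_nn_integralI[of "\<lambda>x. g n x - h x" M "(1/4)^k"] by simp
  qed
  have "square_integrable M (\<lambda>x. g (K 0) x - (g (K 0) x - h x))"
    by (rule square_integrable_diff[OF g]) (use close[of 0 "K 0"] in simp)
  then have "square_integrable M h" by simp
  moreover have "(\<lambda>n. sq_norm M (\<lambda>x. g n x - h x)) \<longlonglongrightarrow> 0"
  proof (rule LIMSEQ_I)
    fix e :: real assume "e > 0"
    then obtain k where k: "(1/4::real)^k < e" using real_arch_pow_inv[of e "1/4"] by auto
    show "\<exists>no. \<forall>n\<ge>no. norm (sq_norm M (\<lambda>x. g n x - h x) - 0) < e"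
    proof (intro exI[of _ "K k"] allI impI)
      fix n assume "K k \<le> n"
      then have "sq_norm M (\<lambda>x. g n x - h x) < e" using close k by (meson le_less_trans)
      then show "norm (sq_norm M (\<lambda>x. g n x - h x) - 0) < e" by simp
    qed
  qed
  ultimately show ?thesis by blast
qed

text \<open>Convex combinations of members of the tail starting at index \<open>n\<close>. Weights are functions on all
  indices so that two of them can be averaged pointwise, whatever their supports are.\<close>

definition convex_weights :: "nat \<Rightarrow> (nat \<Rightarrow> real) \<Rightarrow> bool" where
  "convex_weights n c \<longleftrightarrow>
     (\<forall>m. 0 \<le> c m) \<and> finite {m. c m \<noteq> 0} \<and> (\<forall>m<n. c m = 0) \<and> (\<Sum>m | c m \<noteq> 0. c m) = 1"

definition weighted_sum :: "(nat \<Rightarrow> 'b::real_vector) \<Rightarrow> (nat \<Rightarrow> real) \<Rightarrow> 'b" where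
  "weighted_sum y c = (\<Sum>m | c m \<noteq> 0. c m *\<^sub>R y m)"

lemma weighted_sum_superset:
  "finite S \<Longrightarrow> {m. c m \<noteq> 0} \<subseteq> S \<Longrightarrow> weighted_sum y c = (\<Sum>m\<in>S. c m *\<^sub>R y m)"
  unfolding weighted_sum_def by (intro sum.mono_neutral_left) auto

lemma weighted_sum_unit: "weighted_sum y (\<lambda>m. if m = n then 1 else 0) = y n"
  by (subst weighted_sum_superset[of "{n}"]) auto

lemma convex_weights_midpoint:
  assumes "convex_weights n c" "convex_weights n c'"
  shows "convex_weights n (\<lambda>m. (c m + c' m) / 2)"
    and "weighted_sum y (\<lambda>m. (c m + c' m) / 2) = (1/2) *\<^sub>R (weighted_sum y c + weighted_sum y c')"
proof -
  let ?S = "{m. c m \<noteq> 0} \<union> {m. c' m \<noteq> 0}"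
  have S: "finite ?S" using assms by (simp add: convex_weights_def)
  have sub: "{m. (c m + c' m) / 2 \<noteq> 0} \<subseteq> ?S" by auto
  have "(\<Sum>m\<in>?S. c m) = (\<Sum>m | c m \<noteq> 0. c m)" "(\<Sum>m\<in>?S. c' m) = (\<Sum>m | c' m \<noteq> 0. c' m)"
    by (rule sum.mono_neutral_right[OF S]; blast)+
  then have 1: "(\<Sum>m\<in>?S. c m) = 1" "(\<Sum>m\<in>?S. c' m) = 1"
    using assms unfolding convex_weights_def by simp_all
  have "(\<Sum>m | (c m + c' m) / 2 \<noteq> 0. (c m + c' m) / 2) = (\<Sum>m\<in>?S. (c m + c' m) / 2)"
    by (rule sum.mono_neutral_left[OF S sub]) auto
  also have "\<dots> = 1" using 1 by (simp add: sum.distrib flip: sum_divide_distrib)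
  finally show "convex_weights n (\<lambda>m. (c m + c' m) / 2)"
    using assms S finite_subset[OF sub S] by (simp add: convex_weights_def)
  show "weighted_sum y (\<lambda>m. (c m + c' m) / 2) = (1/2) *\<^sub>R (weighted_sum y c + weighted_sum y c')"
    unfolding weighted_sum_superset[OF S sub] weighted_sum_superset[OF S Un_upper1]
      weighted_sum_superset[OF S Un_upper2]
    by (simp add: scaleR_sum_right scaleR_add_right scaleR_add_left add_divide_distrib sum.distrib)
qed

lemma norm_weighted_sum_square_le:
  fixes y :: "nat \<Rightarrow> 'b::real_normed_vector"
  assumes "convex_weights n c"
  shows "(norm (weighted_sum y c))\<^sup>2 \<le> weighted_sum (\<lambda>m. (norm (y m))\<^sup>2) c"
proof -
  let ?S = "{m. c m \<noteq> 0}"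
  have S: "finite ?S" "?S \<noteq> {}" "sum c ?S = 1" "\<And>m. 0 \<le> c m"
    using assms by (auto simp: convex_weights_def simp del: Collect_empty_eq)
  have "(norm (weighted_sum y c))\<^sup>2 \<le> (\<Sum>m\<in>?S. c m * norm (y m))\<^sup>2"
    unfolding weighted_sum_def using S(4)
    by (intro power_mono) (auto intro!: order_trans[OF norm_sum] sum_mono)
  also have "\<dots> = (\<Sum>m\<in>?S. c m *\<^sub>R norm (y m))\<^sup>2" by simp
  also have "\<dots> \<le> (\<Sum>m\<in>?S. c m * (norm (y m))\<^sup>2)"
    by (rule convex_on_sum[OF S(1,2) convex_power2 S(3)]) (use S(4) in auto)
  finally show ?thesis by (simp add: weighted_sum_def)
qed

text \<open>The substitute for weak compactness in \<open>L\<^sup>2\<close>: almost minimisers of the norm in the convex hulls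
  of the tails of a bounded sequence are a Cauchy sequence, by the parallelogram identity, because
  these minimal norms increase to a finite limit.\<close>

lemma bounded_L2_convex_combinations_converge:
  fixes f :: "nat \<Rightarrow> 'a \<Rightarrow> 'b::euclidean_space"
  assumes f: "\<And>n. square_integrable M (f n)" and B: "\<And>n. sq_norm M (f n) \<le> B"
  shows "\<exists>c h. (\<forall>n. convex_weights n (c n)) \<and> square_integrable M h \<and>
    (\<lambda>n. sq_norm M (\<lambda>x. weighted_sum (\<lambda>m. f m x) (c n) - h x)) \<longlonglongrightarrow> 0"
proof -
  define N where "N c = sq_norm M (\<lambda>x. weighted_sum (\<lambda>m. f m x) c)" for c
  have si: "square_integrable M (\<lambda>x. weighted_sum (\<lambda>m. f m x) c)" for c
    unfolding weighted_sum_def by (intro square_integrable_sum square_integrable_scaleR f)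
  have N0: "0 \<le> N c" for c by (simp add: N_def)
  define a where "a n = (INF c\<in>{c. convex_weights n c}. N c)" for n
  have bdd: "bdd_below (N ` {c. convex_weights n c})" for n
    using N0 by (intro bdd_belowI[of _ 0]) auto
  have unit: "convex_weights n (\<lambda>m. if m = n then 1 else 0)" for n
    by (auto simp: convex_weights_def)
  have a_le: "a n \<le> N c" if "convex_weights n c" for n c
    unfolding a_def by (rule cINF_lower[OF bdd]) (use that in simp)
  have "a n \<le> B" for n
    using a_le[OF unit, of n] B[of n] by (simp add: N_def weighted_sum_unit)
  moreover have inc: "incseq a"
  proof (rule incseq_SucI)
    fix n
    have "convex_weights (Suc n) c \<Longrightarrow> convex_weights n c" for c by (simp add: convex_weights_def)
    then show "a n \<le> a (Suc n)"
      unfolding a_def using unit[of "Suc n"] by (intro cINF_superset_mono bdd) auto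
  qed
  ultimately have "convergent a"
    by (meson incseq_convergent convergentI)
  have "\<exists>c. convex_weights n c \<and> N c < a n + 1 / Suc n" for n
  proof -
    have "\<exists>c\<in>{c. convex_weights n c}. N c < a n + 1 / Suc n"
      using unit[of n] bdd by (subst cINF_less_iff[symmetric]) (auto simp: a_def[symmetric])
    then show ?thesis by blast
  qed
  then obtain c where c: "\<And>n. convex_weights n (c n)" "\<And>n. N (c n) < a n + 1 / Suc n"
    by metis
  have dist: "sq_norm M (\<lambda>x. weighted_sum (\<lambda>m. f m x) (c p) - weighted_sum (\<lambda>m. f m x) (c q))
      \<le> 2 * (a p - a k) + 2 * (a q - a k) + 4 / Suc k" if "k \<le> p" "k \<le> q" for p q k
  proof -
    let ?g = "\<lambda>n x. weighted_sum (\<lambda>m. f m x) (c n)"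
    let ?c = "\<lambda>m. (c p m + c q m) / 2"
    have ck: "convex_weights k (c p)" "convex_weights k (c q)"
      using c(1)[of p] c(1)[of q] that by (auto simp: convex_weights_def)
    have par: "(norm (u - w))\<^sup>2 = 2 * (norm u)\<^sup>2 + 2 * (norm w)\<^sup>2 - 4 * (norm ((1/2) *\<^sub>R (u + w)))\<^sup>2"
      for u w :: 'b
      by (simp add: power2_norm_eq_inner power_mult_distrib inner_simps inner_commute algebra_simps)
    have "sq_norm M (\<lambda>x. ?g p x - ?g q x)
        = (LINT x|M. 2 * (norm (?g p x))\<^sup>2 + 2 * (norm (?g q x))\<^sup>2
            - 4 * (norm (weighted_sum (\<lambda>m. f m x) ?c))\<^sup>2)"
      by (simp only: par convex_weights_midpoint(2)[OF ck])
    also have "\<dots> = 2 * N (c p) + 2 * N (c q) - 4 * N ?c"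
      using si[THEN square_integrable_integrable] by (simp add: N_def)
    also have "\<dots> \<le> 2 * (a p + 1 / Suc p) + 2 * (a q + 1 / Suc q) - 4 * a k"
      using c(2)[of p] c(2)[of q] a_le[OF convex_weights_midpoint(1)[OF ck]] by simp
    also have "\<dots> \<le> 2 * (a p + 1 / Suc k) + 2 * (a q + 1 / Suc k) - 4 * a k"
    proof -
      have "1 / real (Suc p) \<le> 1 / real (Suc k)" "1 / real (Suc q) \<le> 1 / real (Suc k)"
        by (intro frac_le; use that in simp)+
      then show ?thesis by (intro diff_right_mono add_mono mult_left_mono) auto
    qed
    finally show ?thesis by (simp add: algebra_simps)
  qed
  have "\<exists>h. square_integrable M h \<and>
      (\<lambda>n. sq_norm M (\<lambda>x. weighted_sum (\<lambda>m. f m x) (c n) - h x)) \<longlonglongrightarrow> 0"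
  proof (rule L2_complete[OF si])
    fix e :: real assume e: "e > 0"
    obtain l where l: "a \<longlonglongrightarrow> l" using \<open>convergent a\<close> by (auto simp: convergent_def)
    have "\<forall>\<^sub>F k in sequentially. \<bar>a k - l\<bar> < e / 8"
      using tendstoD[OF l, of "e/8"] e by (simp add: dist_real_def)
    moreover have "\<forall>\<^sub>F k in sequentially. 1 / Suc k < e / 8"
      using order_tendstoD(2)[OF lim_1_over_n[THEN LIMSEQ_Suc], of "e/8"] e by simp
    ultimately have "\<forall>\<^sub>F k in sequentially. \<bar>a k - l\<bar> < e / 8 \<and> 1 / Suc k < e / 8"
      by (rule eventually_conj)
    then obtain k where k: "\<bar>a k - l\<bar> < e / 8" "1 / Suc k < e / 8"
      by (auto simp: eventually_sequentially)
    have al: "a n \<le> l" for n using inc l by (rule incseq_le)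
    show "\<exists>K. \<forall>m\<ge>K. \<forall>n\<ge>K. sq_norm M (\<lambda>x. weighted_sum (\<lambda>i. f i x) (c m) - weighted_sum (\<lambda>i. f i x) (c n)) < e"
    proof (intro exI[of _ k] allI impI)
      fix m n assume "k \<le> m" "k \<le> n"
      have combine: "S < e" if "S \<le> 2 * A + 2 * B + z" "A < e / 8" "B < e / 8" "z < e / 2"
        for S A B z :: real using that by linarith
      note dist[OF \<open>k \<le> m\<close> \<open>k \<le> n\<close>]
      moreover have "a m - a k < e / 8" using k(1) al[of m] by linarith
      moreover have "a n - a k < e / 8" using k(1) al[of n] by linarith
      moreover have "4 / real (Suc k) = 4 * (1 / real (Suc k))" by simp
      then have "4 / real (Suc k) < e / 2" using k(2) by linarith
      ultimately
      show "sq_norm M (\<lambda>x. weighted_sum (\<lambda>i. f i x) (c m) - weighted_sum (\<lambda>i. f i x) (c n)) < e"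
        by (rule combine)
    qed
  qed
  then show ?thesis using c(1) by blast
qed

section \<open>Weak derivatives\<close>

lemma integral_lebesgue_translation:
  fixes f :: "'a::euclidean_space \<Rightarrow> real"
  assumes [measurable]: "f \<in> borel_measurable borel"
  shows "(LINT x|lebesgue. f (x + c)) = integral\<^sup>L lebesgue f"
proof -
  have "(LINT x|lebesgue. f (x + c)) = (LINT x|lborel. f (c + x))"
    by (subst integral_completion) (auto simp: add.commute)
  also have "\<dots> = integral\<^sup>L (distr lborel borel ((+) c)) f"
    by (rule integral_distr[symmetric]) auto
  also have "\<dots> = integral\<^sup>L lborel f" by (simp add: lborel_distr_plus)
  also have "\<dots> = integral\<^sup>L lebesgue f" by (rule integral_completion[symmetric]) simp
  finally show ?thesis .
qed

lemma continuous_integrable_of_bounded_support: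
  fixes f :: "'a::euclidean_space \<Rightarrow> real"
  assumes "f \<in> borel_measurable borel" and B: "\<And>x. \<bar>f x\<bar> \<le> B" and 0: "\<And>x. x \<notin> cball 0 R \<Longrightarrow> f x = 0"
  shows "integrable lebesgue f"
proof (rule Bochner_Integration.integrable_bound)
  show "integrable lebesgue (\<lambda>x::'a. indicator (cball 0 R) x * B)"
    by (intro integrable_mult_left lmeasurable_iff_integrable[THEN iffD1] lmeasurable_cball)
  show "f \<in> borel_measurable lebesgue" using assms(1) by (simp add: measurable_completion)
  show "AE x in lebesgue. norm (f x) \<le> norm (indicator (cball 0 R) x * B)"
  proof (rule AE_I2)
    fix x
    show "norm (f x) \<le> norm (indicator (cball 0 R) x * B)"
    proof (cases "x \<in> cball 0 R")
      case True
      then have "indicator (cball 0 R) x = (1::real)" by simp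
      then show ?thesis using B[of x] by simp
    next
      case False
      then show ?thesis using 0[of x] by simp
    qed
  qed
qed

text \<open>The integral of a difference quotient vanishes by translation invariance.\<close>

lemma integral_frechet_derivative_test_function_real:
  fixes f :: "'a::euclidean_space \<Rightarrow> real"
  assumes "test_function UNIV f"
  shows "(LINT x|lebesgue. frechet_derivative f (at x) e) = 0"
proof -
  obtain K where K: "compact K" "smooth_on f UNIV"
    "\<forall>x. x \<notin> K \<longrightarrow> f x = 0 \<and> (\<forall>e. frechet_derivative f (at x) e = 0)"
    using test_functionD[OF assms] by blast
  obtain R where R: "\<And>x. x \<in> K \<Longrightarrow> norm x \<le> R"
    using compact_imp_bounded[OF K(1)] by (auto simp: bounded_iff)
  let ?D = "\<lambda>x. frechet_derivative f (at x) e"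
  have cont: "continuous_on UNIV f" "continuous_on UNIV ?D"
    using smooth_on_continuous[OF K(2)] smooth_on_continuous[OF smooth_on_frechet_derivative[OF K(2)]] by blast+
  note meas = borel_measurable_continuous_onI[OF cont(1)] borel_measurable_continuous_onI[OF cont(2)]
  have shift: "(\<lambda>x. f (x + c)) \<in> borel_measurable borel" for c
    by (rule measurable_compose[OF _ meas(1)]) measurable
  obtain B0 where B0: "\<forall>x\<in>K. \<bar>?D x\<bar> \<le> B0" using continuous_bounded_on_compact[OF cont(2) K(1)] by blast
  define B where "B = \<bar>B0\<bar>"
  have B: "\<bar>?D x\<bar> \<le> B" for x
  proof (cases "x \<in> K")
    case True
    then show ?thesis using B0 unfolding B_def by fastforce
  next
    case False
    then show ?thesis using K(3) by (simp add: B_def)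
  qed
  obtain C0 where C0: "\<forall>x\<in>K. \<bar>f x\<bar> \<le> C0" using continuous_bounded_on_compact[OF cont(1) K(1)] by blast
  have f_int: "integrable lebesgue f"
  proof (rule continuous_integrable_of_bounded_support[OF meas(1)])
    show "\<bar>f x\<bar> \<le> \<bar>C0\<bar>" for x
    proof (cases "x \<in> K")
      case True
      then show ?thesis using C0 by fastforce
    next
      case False
      then show ?thesis using K(3) by simp
    qed
    show "f x = 0" if "x \<notin> cball 0 R" for x using that R[of x] K(3) by auto
  qed
  define h where "h n = 1 / real (Suc n)" for n
  have h: "0 < h n" "h n \<le> 1" for n by (auto simp: h_def)
  have hlim: "h \<longlonglongrightarrow> 0" unfolding h_def using LIMSEQ_inverse_real_of_nat by (simp add: inverse_eq_divide)
  define q where "q n x = (f (x + h n *\<^sub>R e) - f x) / h n" for n x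
  have der: "((\<lambda>s. f (x + s *\<^sub>R e)) has_real_derivative ?D (x + s *\<^sub>R e)) (at s)" for x s
  proof -
    have "((\<lambda>s. x + s *\<^sub>R e) has_derivative (\<lambda>t. t *\<^sub>R e)) (at s)"
      by (auto intro!: derivative_eq_intros)
    from has_derivative_compose[OF this smooth_on_has_derivative[OF K(2)]]
    have "((\<lambda>s. f (x + s *\<^sub>R e)) has_derivative (\<lambda>t. frechet_derivative f (at (x + s *\<^sub>R e)) (t *\<^sub>R e))) (at s)" .
    moreover have "frechet_derivative f (at y) (t *\<^sub>R e) = ?D y * t" for y t
      using linear_scale[OF has_derivative_linear[OF smooth_on_has_derivative[OF K(2)]], of y t e] by simp
    ultimately show ?thesis by (simp add: has_field_derivative_def)
  qed
  have "(\<lambda>n. integral\<^sup>L lebesgue (q n)) \<longlonglongrightarrow> (LINT x|lebesgue. ?D x)"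
  proof (rule integral_dominated_convergence[where w = "\<lambda>x. indicator (cball 0 (R + norm e)) x * B"])
    show "?D \<in> borel_measurable lebesgue" using meas(2) by (simp add: measurable_completion)
    show "q n \<in> borel_measurable lebesgue" for n
      unfolding q_def
      by (intro borel_measurable_divide borel_measurable_diff borel_measurable_const measurable_completion)
         (simp_all add: shift meas(1))
    show "integrable lebesgue (\<lambda>x::'a. indicator (cball 0 (R + norm e)) x * B)"
      by (rule continuous_integrable_of_bounded_support[where B = B and R = "R + norm e"])
         (auto simp: B_def indicator_def)
    show "AE x in lebesgue. (\<lambda>n. q n x) \<longlonglongrightarrow> ?D x"
    proof (rule AE_I2)
      fix x
      have "((\<lambda>s. (f (x + s *\<^sub>R e) - f x) / s) \<longlongrightarrow> ?D x) (at 0)"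
        using der[of x 0] by (simp add: DERIV_def)
      moreover have "h n \<noteq> 0" for n using h(1)[of n] by simp
      then have "filterlim h (at 0) sequentially"
        by (simp add: filterlim_at hlim)
      ultimately show "(\<lambda>n. q n x) \<longlonglongrightarrow> ?D x"
        unfolding q_def by (rule filterlim_compose)
    qed
    show "AE x in lebesgue. norm (q n x) \<le> indicator (cball 0 (R + norm e)) x * B" for n
    proof (rule AE_I2)
      fix x
      obtain z where z: "0 < z" "z < h n" "f (x + h n *\<^sub>R e) - f (x + 0 *\<^sub>R e) = (h n - 0) * ?D (x + z *\<^sub>R e)"
        using MVT2[OF h(1)[of n], of "\<lambda>s. f (x + s *\<^sub>R e)" "\<lambda>s. ?D (x + s *\<^sub>R e)"] der by blast
      then have q: "q n x = ?D (x + z *\<^sub>R e)" using h(1)[of n] by (simp add: q_def)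
      show "norm (q n x) \<le> indicator (cball 0 (R + norm e)) x * B"
      proof (cases "x \<in> cball 0 (R + norm e)")
        case True
        then show ?thesis using B q by simp
      next
        case False
        have "norm (z *\<^sub>R e) \<le> norm e"
          using z h(2)[of n] by (simp add: mult_left_le_one_le)
        then have "norm (x + z *\<^sub>R e) > R"
          using False norm_diff_ineq[of x "z *\<^sub>R e"] by simp
        then have "x + z *\<^sub>R e \<notin> K" using R[of "x + z *\<^sub>R e"] by auto
        then show ?thesis using q K(3) False by simp
      qed
    qed
  qed
  moreover have "integral\<^sup>L lebesgue (q n) = 0" for n
  proof -
    have "integrable lebesgue (\<lambda>x. f (x + h n *\<^sub>R e))"
    proof (rule continuous_integrable_of_bounded_support[where R = "R + norm e" and B = "\<bar>C0\<bar>"])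
      show "(\<lambda>x. f (x + h n *\<^sub>R e)) \<in> borel_measurable borel" by (rule shift)
      show "\<bar>f (x + h n *\<^sub>R e)\<bar> \<le> \<bar>C0\<bar>" for x
      proof (cases "x + h n *\<^sub>R e \<in> K")
        case True
        then show ?thesis using C0 by fastforce
      next
        case False
        then show ?thesis using K(3) by simp
      qed
      show "f (x + h n *\<^sub>R e) = 0" if "x \<notin> cball 0 (R + norm e)" for x
      proof -
        have "norm (h n *\<^sub>R e) \<le> norm e"
          using h[of n] by (simp add: mult_left_le_one_le)
        then have "norm (x + h n *\<^sub>R e) > R"
          using that norm_diff_ineq[of x "h n *\<^sub>R e"] by simp
        then have "x + h n *\<^sub>R e \<notin> K" using R[of "x + h n *\<^sub>R e"] by auto
        then show ?thesis using K(3) by simp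
      qed
    qed
    then show ?thesis
      unfolding q_def using f_int integral_lebesgue_translation[OF meas(1), of "h n *\<^sub>R e"] by simp
  qed
  ultimately have "(\<lambda>n. 0) \<longlonglongrightarrow> (LINT x|lebesgue. ?D x)" by simp
  then show ?thesis by (rule LIMSEQ_unique[OF tendsto_const, symmetric])
qed

lemma test_function_scaleR_left:
  fixes f :: "'a::euclidean_space \<Rightarrow> real"
  assumes "test_function U f" "smooth_on g UNIV"
  shows "test_function U (\<lambda>x. f x *\<^sub>R g x)"
proof -
  obtain K where K: "compact K" "K \<subseteq> U" "smooth_on f UNIV" "\<forall>x. x \<notin> K \<longrightarrow> f x = 0"
    using test_functionD[OF assms(1)] by blast
  then show ?thesis
    by (intro test_functionI[of _ K] smooth_on_scaleR assms(2)) auto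
qed

lemma test_function_scaleR_right:
  fixes f :: "'a::euclidean_space \<Rightarrow> real"
  assumes "test_function U g" "smooth_on f UNIV"
  shows "test_function U (\<lambda>x. f x *\<^sub>R g x)"
proof -
  obtain K where K: "compact K" "K \<subseteq> U" "smooth_on g UNIV" "\<forall>x. x \<notin> K \<longrightarrow> g x = 0"
    using test_functionD[OF assms(1)] by blast
  then show ?thesis
    by (intro test_functionI[of _ K] smooth_on_scaleR assms(2)) auto
qed

lemma test_function_add:
  assumes "test_function U f" "test_function U g"
  shows "test_function U (\<lambda>x. f x + g x)"
proof -
  obtain K where K: "compact K" "K \<subseteq> U" "smooth_on f UNIV" "\<forall>x. x \<notin> K \<longrightarrow> f x = 0"
    using test_functionD[OF assms(1)] by blast
  obtain L where L: "compact L" "L \<subseteq> U" "smooth_on g UNIV" "\<forall>x. x \<notin> L \<longrightarrow> g x = 0"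
    using test_functionD[OF assms(2)] by blast
  show ?thesis
    by (rule test_functionI[of _ "K \<union> L"]) (use K L in \<open>auto intro: smooth_on_add\<close>)
qed

lemma test_function_mono: "test_function U f \<Longrightarrow> U \<subseteq> V \<Longrightarrow> test_function V f"
  by (auto simp: test_function_def)

lemma integral_lebesgue_on_supported:
  fixes f :: "'a::euclidean_space \<Rightarrow> 'b::euclidean_space"
  assumes "U \<in> sets lebesgue" "\<And>x. x \<notin> U \<Longrightarrow> f x = 0"
  shows "integral\<^sup>L (lebesgue_on U) f = integral\<^sup>L lebesgue f"
    and "integrable (lebesgue_on U) f \<longleftrightarrow> integrable lebesgue f"
proof -
  have *: "(\<lambda>x. indicator U x *\<^sub>R f x) = f"
    using assms(2) by (auto simp: fun_eq_iff indicator_def)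
  show "integral\<^sup>L (lebesgue_on U) f = integral\<^sup>L lebesgue f"
    using assms(1) * by (subst integral_restrict_space) auto
  show "integrable (lebesgue_on U) f \<longleftrightarrow> integrable lebesgue f"
    using assms(1) * by (subst integrable_restrict_space) auto
qed

lemma L1_loc_continuous:
  fixes f :: "'a::euclidean_space \<Rightarrow> 'b::euclidean_space"
  assumes "continuous_on UNIV f"
  shows "L1_loc U f"
  unfolding L1_loc_def
proof (intro allI impI)
  fix K :: "'a set" assume K: "compact K \<and> K \<subseteq> U"
  have "integrable lborel (\<lambda>x. indicator K x *\<^sub>R f x)"
    using K by (intro borel_integrable_compact continuous_on_subset[OF assms]) auto
  then show "f absolutely_integrable_on K"
    unfolding set_integrable_def by (subst integrable_completion) auto
qed

lemma integral_frechet_derivative_test_function: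
  fixes f :: "'a::euclidean_space \<Rightarrow> 'b::euclidean_space"
  assumes f: "test_function UNIV f"
  shows "integrable lebesgue (\<lambda>x. frechet_derivative f (at x) e)"
    and "(LINT x|lebesgue. frechet_derivative f (at x) e) = 0"
proof -
  obtain K where K: "compact K" "smooth_on f UNIV"
    "\<forall>x. x \<notin> K \<longrightarrow> f x = 0 \<and> (\<forall>e. frechet_derivative f (at x) e = 0)"
    using test_functionD[OF f] by blast
  let ?D = "\<lambda>x. frechet_derivative f (at x) e"
  have "L1_loc UNIV ?D"
    using smooth_on_continuous[OF smooth_on_frechet_derivative[OF K(2)]] by (rule L1_loc_continuous)
  then have "integrable lebesgue (\<lambda>x. indicator K x *\<^sub>R ?D x)"
    using K(1) by (simp add: L1_loc_def set_integrable_def)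
  moreover have "(\<lambda>x. indicator K x *\<^sub>R ?D x) = ?D"
    using K(3) by (auto simp: fun_eq_iff indicator_def)
  ultimately show int: "integrable lebesgue ?D" by simp
  have "(LINT x|lebesgue. ?D x) \<bullet> b = 0" for b
  proof -
    have "((\<lambda>x. f x \<bullet> b) has_derivative (\<lambda>e. frechet_derivative f (at x) e \<bullet> b)) (at x)" for x
      by (intro has_derivative_inner_left smooth_on_has_derivative K(2))
    then have fd: "frechet_derivative (\<lambda>x. f x \<bullet> b) (at x) = (\<lambda>e. frechet_derivative f (at x) e \<bullet> b)" for x
      using frechet_derivative_at by metis
    have "smooth_on (\<lambda>x. f x \<bullet> b) UNIV"
      unfolding smooth_on_def
    proof
      fix k
      have "Ck_on k (\<lambda>x. f x \<bullet> b) UNIV" if "Ck_on k f UNIV" for f :: "'a \<Rightarrow> 'b"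
        using that
      proof (induction k arbitrary: f)
        case 0
        then show ?case by (auto intro: continuous_on_inner continuous_on_const)
      next
        case (Suc k)
        show ?case
        proof (rule Ck_on_SucI)
          show "((\<lambda>x. f x \<bullet> b) has_derivative (\<lambda>e. frechet_derivative f (at x) e \<bullet> b)) (at x)" for x
            by (intro has_derivative_inner_left Ck_on_has_derivative[OF Suc.prems])
          show "Ck_on k (\<lambda>x. frechet_derivative f (at x) e \<bullet> b) UNIV" for e
            using Suc.IH Suc.prems by simp
        qed
      qed
      then show "Ck_on k (\<lambda>x. f x \<bullet> b) UNIV" using K(2) by (simp add: smooth_on_def)
    qed
    then have "test_function UNIV (\<lambda>x. f x \<bullet> b)"
      using K by (intro test_functionI[of _ K]) auto
    from integral_frechet_derivative_test_function_real[OF this, of e]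
    have "(LINT x|lebesgue. ?D x \<bullet> b) = 0" by (simp add: fd)
    then show ?thesis using int by (simp add: integral_inner_left)
  qed
  then show "(LINT x|lebesgue. ?D x) = 0" by (subst euclidean_all_zero_iff[symmetric]) simp
qed

lemma frechet_derivative_scaleR:
  fixes f :: "'a::euclidean_space \<Rightarrow> real"
  assumes "smooth_on f UNIV" "smooth_on g UNIV"
  shows "frechet_derivative (\<lambda>x. f x *\<^sub>R g x) (at x) e
    = f x *\<^sub>R frechet_derivative g (at x) e + frechet_derivative f (at x) e *\<^sub>R g x"
proof -
  have "((\<lambda>x. f x *\<^sub>R g x) has_derivative
      (\<lambda>e. f x *\<^sub>R frechet_derivative g (at x) e + frechet_derivative f (at x) e *\<^sub>R g x)) (at x)"
    by (intro has_derivative_scaleR smooth_on_has_derivative assms)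
  from frechet_derivative_at[OF this, symmetric] show ?thesis by simp
qed

text \<open>Integration by parts: the derivative of \<open>\<phi> u\<close> has integral zero.\<close>

lemma has_weak_deriv_smooth:
  fixes u :: "'a::euclidean_space \<Rightarrow> 'b::euclidean_space"
  assumes U: "open U" and u: "smooth_on u UNIV"
  shows "has_weak_deriv U e u (\<lambda>x. frechet_derivative u (at x) e)"
  unfolding has_weak_deriv_def
proof (intro conjI allI impI)
  show L: "L1_loc U u" "L1_loc U (\<lambda>x. frechet_derivative u (at x) e)"
    using u smooth_on_continuous smooth_on_frechet_derivative by (blast intro: L1_loc_continuous)+
  fix \<phi> :: "'a \<Rightarrow> real" assume \<phi>: "test_function U \<phi>"
  obtain K where K: "compact K" "K \<subseteq> U" "smooth_on \<phi> UNIV"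
    "\<forall>x. x \<notin> K \<longrightarrow> \<phi> x = 0 \<and> (\<forall>e. frechet_derivative \<phi> (at x) e = 0)"
    using test_functionD[OF \<phi>] by blast
  have 0: "\<phi> x = 0" "frechet_derivative \<phi> (at x) e = 0" if "x \<notin> U" for x
    using that K by auto
  have Us: "U \<in> sets lebesgue" using U by simp
  have "test_function UNIV (\<lambda>x. \<phi> x *\<^sub>R u x)"
    using test_function_scaleR_left[OF \<phi> u] by (rule test_function_mono) simp
  from integral_frechet_derivative_test_function(2)[OF this, of e]
  have "0 = (LINT x|lebesgue. \<phi> x *\<^sub>R frechet_derivative u (at x) e + frechet_derivative \<phi> (at x) e *\<^sub>R u x)"
    by (simp add: frechet_derivative_scaleR[OF K(3) u])
  also have "\<dots> = (LINT x|lebesgue_on U. \<phi> x *\<^sub>R frechet_derivative u (at x) e + frechet_derivative \<phi> (at x) e *\<^sub>R u x)"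
    by (rule integral_lebesgue_on_supported[OF Us, symmetric]) (simp add: 0)
  also have "\<dots> = (LINT x|lebesgue_on U. \<phi> x *\<^sub>R frechet_derivative u (at x) e) + (LINT x|lebesgue_on U. frechet_derivative \<phi> (at x) e *\<^sub>R u x)"
    by (rule Bochner_Integration.integral_add[OF integrable_test_function_scaleR(1)[OF U L(2) \<phi>]
        integrable_test_function_scaleR(2)[OF U L(1) \<phi>]])
  finally show "(LINT x|lebesgue_on U. frechet_derivative \<phi> (at x) e *\<^sub>R u x) =
        - (LINT x|lebesgue_on U. \<phi> x *\<^sub>R frechet_derivative u (at x) e)"
    unfolding eq_neg_iff_add_eq_0 by (simp only: add.commute)
qed

lemma L1_loc_add: 
  fixes f g :: "'a::euclidean_space \<Rightarrow> 'b::euclidean_space"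
  shows "L1_loc U f \<Longrightarrow> L1_loc U g \<Longrightarrow> L1_loc U (\<lambda>x. f x + g x)"
  unfolding L1_loc_def using set_integral_add(1) by blast

lemma L1_loc_scaleR:
  fixes f :: "'a::euclidean_space \<Rightarrow> 'b::euclidean_space"
  shows "L1_loc U f \<Longrightarrow> L1_loc U (\<lambda>x. c *\<^sub>R f x)"
  by (rule L1_loc_bounded_linear[OF bounded_linear_scaleR_right])

lemma L1_loc_continuous_scaleR:
  fixes f :: "'a::euclidean_space \<Rightarrow> 'b::euclidean_space" and \<zeta> :: "'a \<Rightarrow> real"
  assumes f: "L1_loc U f" and c: "continuous_on UNIV \<zeta>"
  shows "L1_loc U (\<lambda>x. \<zeta> x *\<^sub>R f x)"
  unfolding L1_loc_def
proof (intro allI impI)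
  fix K assume K: "compact K \<and> K \<subseteq> U"
  then obtain B where B: "\<forall>x\<in>K. \<bar>\<zeta> x\<bar> \<le> B" using continuous_bounded_on_compact[OF c] by blast
  have fK: "integrable lebesgue (\<lambda>x. indicator K x *\<^sub>R f x)"
    using f K by (simp add: L1_loc_def set_integrable_def)
  have "integrable lebesgue (\<lambda>x. \<zeta> x *\<^sub>R (indicator K x *\<^sub>R f x))"
  proof (rule Bochner_Integration.integrable_bound)
    show "integrable lebesgue (\<lambda>x. B *\<^sub>R (indicator K x *\<^sub>R f x))"
      using fK by (rule integrable_scaleR_right)
    have "\<zeta> \<in> borel_measurable lebesgue"
      using borel_measurable_continuous_onI[OF c] by (simp add: measurable_completion)
    then show "(\<lambda>x. \<zeta> x *\<^sub>R (indicator K x *\<^sub>R f x)) \<in> borel_measurable lebesgue"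
      using borel_measurable_integrable[OF fK] by (rule borel_measurable_scaleR)
    show "AE x in lebesgue. norm (\<zeta> x *\<^sub>R (indicator K x *\<^sub>R f x)) \<le> norm (B *\<^sub>R (indicator K x *\<^sub>R f x))"
    proof (rule AE_I2)
      fix x
      show "norm (\<zeta> x *\<^sub>R (indicator K x *\<^sub>R f x)) \<le> norm (B *\<^sub>R (indicator K x *\<^sub>R f x))"
      proof (cases "x \<in> K")
        case True
        then have "\<bar>\<zeta> x\<bar> \<le> \<bar>B\<bar>" using B by fastforce
        then show ?thesis using True by (simp add: mult_right_mono)
      qed simp
    qed
  qed
  then show "(\<lambda>x. \<zeta> x *\<^sub>R f x) absolutely_integrable_on K"
    by (simp add: set_integrable_def mult.commute)
qed

lemma has_weak_deriv_add:
  fixes u v :: "'a::euclidean_space \<Rightarrow> 'b::euclidean_space"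
  assumes U: "open U" and u: "has_weak_deriv U e u d" and v: "has_weak_deriv U e v d'"
  shows "has_weak_deriv U e (\<lambda>x. u x + v x) (\<lambda>x. d x + d' x)"
proof -
  have L: "L1_loc U u" "L1_loc U d" "L1_loc U v" "L1_loc U d'"
    using u v by (simp_all add: has_weak_deriv_def)
  have "(LINT x|lebesgue_on U. frechet_derivative \<phi> (at x) e *\<^sub>R (u x + v x))
      = - (LINT x|lebesgue_on U. \<phi> x *\<^sub>R (d x + d' x))" if \<phi>: "test_function U \<phi>" for \<phi> :: "'a \<Rightarrow> real"
    using u v \<phi> integrable_test_function_scaleR[OF U L(1) \<phi>] integrable_test_function_scaleR[OF U L(2) \<phi>]
      integrable_test_function_scaleR[OF U L(3) \<phi>] integrable_test_function_scaleR[OF U L(4) \<phi>]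
    by (simp add: has_weak_deriv_def scaleR_add_right)
  then show ?thesis using L by (simp add: has_weak_deriv_def L1_loc_add)
qed

lemma has_weak_deriv_scaleR:
  fixes u :: "'a::euclidean_space \<Rightarrow> 'b::euclidean_space"
  assumes u: "has_weak_deriv U e u d"
  shows "has_weak_deriv U e (\<lambda>x. c *\<^sub>R u x) (\<lambda>x. c *\<^sub>R d x)"
proof -
  have *: "a *\<^sub>R (c *\<^sub>R y) = c *\<^sub>R (a *\<^sub>R y)" for a and y :: 'b by simp
  show ?thesis
    using u unfolding has_weak_deriv_def * by (simp add: L1_loc_scaleR del: scaleR_scaleR)
qed

text \<open>If \<open>\<phi>\<close> is a test function, so is \<open>\<phi> \<zeta>\<close>; the weak derivative of \<open>u\<close> is tested with it.\<close>

lemma has_weak_deriv_product: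
  fixes u :: "'a::euclidean_space \<Rightarrow> 'b::euclidean_space" and \<zeta> :: "'a \<Rightarrow> real"
  assumes U: "open U" and u: "has_weak_deriv U e u d" and z: "smooth_on \<zeta> UNIV"
  shows "has_weak_deriv U e (\<lambda>x. \<zeta> x *\<^sub>R u x) (\<lambda>x. \<zeta> x *\<^sub>R d x + frechet_derivative \<zeta> (at x) e *\<^sub>R u x)"
proof -
  note cz = smooth_on_continuous[OF z, of UNIV] smooth_on_continuous[OF smooth_on_frechet_derivative[OF z, of e], of UNIV]
  have L: "L1_loc U u" "L1_loc U d" using u by (simp_all add: has_weak_deriv_def)
  note Lu = L1_loc_continuous_scaleR[OF L(1) cz(1)] and Ld = L1_loc_continuous_scaleR[OF L(2) cz(1)]
    and Lz = L1_loc_continuous_scaleR[OF L(1) cz(2)]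
  have "(LINT x|lebesgue_on U. frechet_derivative \<phi> (at x) e *\<^sub>R (\<zeta> x *\<^sub>R u x))
      = - (LINT x|lebesgue_on U. \<phi> x *\<^sub>R (\<zeta> x *\<^sub>R d x + frechet_derivative \<zeta> (at x) e *\<^sub>R u x))"
    if \<phi>: "test_function U \<phi>" for \<phi> :: "'a \<Rightarrow> real"
  proof -
    have s\<phi>: "smooth_on \<phi> UNIV" using \<phi> by (simp add: test_function_def)
    have t: "test_function U (\<lambda>x. \<phi> x * \<zeta> x)" using test_function_scaleR_left[OF \<phi> z] by simp
    have fd: "frechet_derivative (\<lambda>x. \<phi> x * \<zeta> x) (at x) e
        = \<phi> x * frechet_derivative \<zeta> (at x) e + frechet_derivative \<phi> (at x) e * \<zeta> x" for x
      using frechet_derivative_scaleR[OF s\<phi> z, of x e] by simp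
    note i1 = integrable_test_function_scaleR[OF U L(1) t] integrable_test_function_scaleR[OF U L(2) t]
    note i2 = integrable_test_function_scaleR[OF U Lu \<phi>] integrable_test_function_scaleR[OF U Ld \<phi>]
      integrable_test_function_scaleR[OF U Lz \<phi>]
    have "(LINT x|lebesgue_on U. frechet_derivative \<phi> (at x) e *\<^sub>R (\<zeta> x *\<^sub>R u x))
       = (LINT x|lebesgue_on U. frechet_derivative (\<lambda>x. \<phi> x * \<zeta> x) (at x) e *\<^sub>R u x
            - \<phi> x *\<^sub>R (frechet_derivative \<zeta> (at x) e *\<^sub>R u x))"
      by (simp add: fd scaleR_add_left)
    also have "\<dots> = (LINT x|lebesgue_on U. frechet_derivative (\<lambda>x. \<phi> x * \<zeta> x) (at x) e *\<^sub>R u x)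
        - (LINT x|lebesgue_on U. \<phi> x *\<^sub>R (frechet_derivative \<zeta> (at x) e *\<^sub>R u x))"
      by (rule Bochner_Integration.integral_diff[OF i1(2) i2(5)])
    also have "(LINT x|lebesgue_on U. frechet_derivative (\<lambda>x. \<phi> x * \<zeta> x) (at x) e *\<^sub>R u x)
        = - (LINT x|lebesgue_on U. (\<phi> x * \<zeta> x) *\<^sub>R d x)"
      using u t by (simp add: has_weak_deriv_def)
    also have "- (LINT x|lebesgue_on U. (\<phi> x * \<zeta> x) *\<^sub>R d x)
        - (LINT x|lebesgue_on U. \<phi> x *\<^sub>R (frechet_derivative \<zeta> (at x) e *\<^sub>R u x))
        = - ((LINT x|lebesgue_on U. \<phi> x *\<^sub>R (\<zeta> x *\<^sub>R d x))
        + (LINT x|lebesgue_on U. \<phi> x *\<^sub>R (frechet_derivative \<zeta> (at x) e *\<^sub>R u x)))"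
      by simp
    also have "(LINT x|lebesgue_on U. \<phi> x *\<^sub>R (\<zeta> x *\<^sub>R d x))
        + (LINT x|lebesgue_on U. \<phi> x *\<^sub>R (frechet_derivative \<zeta> (at x) e *\<^sub>R u x))
       = (LINT x|lebesgue_on U. \<phi> x *\<^sub>R (\<zeta> x *\<^sub>R d x) + \<phi> x *\<^sub>R (frechet_derivative \<zeta> (at x) e *\<^sub>R u x))"
      by (rule Bochner_Integration.integral_add[OF i2(3) i2(5), symmetric])
    finally show ?thesis by (simp only: scaleR_add_right)
  qed
  then show ?thesis using Lu L1_loc_add[OF Ld Lz] by (simp add: has_weak_deriv_def)
qed

lemma has_weak_deriv_unique:
  fixes u :: "'a::euclidean_space \<Rightarrow> 'b::euclidean_space"
  assumes U: "open U" and d: "has_weak_deriv U e u d" and d': "has_weak_deriv U e u d'"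
  shows "AE x in lebesgue_on U. d x = d' x"
proof -
  have L: "L1_loc U d" "L1_loc U d'" using d d' by (simp_all add: has_weak_deriv_def)
  have "AE x in lebesgue_on U. d x + (-1) *\<^sub>R d' x = 0"
  proof (rule fundamental_lemma[OF U])
    show "L1_loc U (\<lambda>x. d x + (-1) *\<^sub>R d' x)" by (intro L1_loc_add L1_loc_scaleR L)
    fix \<phi> :: "'a \<Rightarrow> real" assume \<phi>: "test_function U \<phi>"
    note i = integrable_test_function_scaleR(1)[OF U L(1) \<phi>] integrable_test_function_scaleR(1)[OF U L(2) \<phi>]
    have "(LINT x|lebesgue_on U. \<phi> x *\<^sub>R d x) = (LINT x|lebesgue_on U. \<phi> x *\<^sub>R d' x)"
      using d d' \<phi> by (simp add: has_weak_deriv_def)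
    then show "(LINT x|lebesgue_on U. \<phi> x *\<^sub>R (d x + (-1) *\<^sub>R d' x)) = 0"
      using i by (simp add: scaleR_diff_right)
  qed
  then show ?thesis by eventually_elim simp
qed

section \<open>Weak gradients and the space of functions with zero boundary values\<close>

text \<open>The matrix \<open>u p\<^sup>t\<close>, which the derivative of a scalar factor contributes to the gradient of a product.\<close>

definition tensor :: "real ^ 'm \<Rightarrow> real ^ 'n \<Rightarrow> real ^ 'n ^ 'm" where
  "tensor u p = (\<chi> i j. u $ i * p $ j)"

definition jacobi :: "(real ^ 'n \<Rightarrow> real ^ 'm) \<Rightarrow> real ^ 'n \<Rightarrow> real ^ 'n ^ 'm" where
  "jacobi u x = (\<chi> i j. frechet_derivative u (at x) (axis j 1) $ i)"

definition nabla :: "(real ^ 'n \<Rightarrow> real) \<Rightarrow> real ^ 'n \<Rightarrow> real ^ 'n" where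
  "nabla \<zeta> x = (\<chi> j. frechet_derivative \<zeta> (at x) (axis j 1))"

lemma column_add: "column j (A + B :: real ^ 'n ^ 'm) = column j A + column j B"
  and column_diff: "column j (A - B :: real ^ 'n ^ 'm) = column j A - column j B"
  and column_scaleR: "column j (c *\<^sub>R A :: real ^ 'n ^ 'm) = c *\<^sub>R column j A"
  and column_tensor: "column j (tensor u p) = p $ j *\<^sub>R u"
  and column_jacobi: "column j (jacobi w x) = frechet_derivative w (at x) (axis j 1)"
  by (simp_all add: column_def vec_eq_iff tensor_def jacobi_def)

lemma matrix_eq_columns:
  fixes A B :: "real ^ 'n ^ 'm"
  shows "(\<And>j. column j A = column j B) \<Longrightarrow> A = B"
  by (simp add: column_def vec_eq_iff)

lemma norm_tensor: "norm (tensor u p) = norm u * norm p"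
proof -
  have "tensor u p $ i = u $ i *\<^sub>R p" for i by (simp add: tensor_def vec_eq_iff)
  then have row: "norm (tensor u p $ i) = norm (u $ i) * norm p" for i by simp
  have "norm (tensor u p) = L2_set (\<lambda>i. norm (u $ i) * norm p) UNIV"
    unfolding norm_vec_def[of "tensor u p"] row ..
  also have "\<dots> = L2_set (\<lambda>i. norm (u $ i)) UNIV * norm p"
    by (rule L2_set_left_distrib[symmetric]) simp
  finally show ?thesis by (simp only: norm_vec_def[of u])
qed

lemma tensor_diff_left: "tensor (u - w) p = tensor u p - tensor w p"
  by (simp add: tensor_def vec_eq_iff left_diff_distrib)

lemma measurable_tensor:
  fixes u :: "'a \<Rightarrow> real ^ 'm" and p :: "'a \<Rightarrow> real ^ 'n"
  assumes "u \<in> borel_measurable M" "p \<in> borel_measurable M"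
  shows "(\<lambda>x. tensor (u x) (p x)) \<in> borel_measurable M"
proof -
  have "continuous_on UNIV (\<lambda>z. tensor (fst z) (snd z) :: real ^ 'n ^ 'm)"
    unfolding tensor_def by (intro continuous_intros)
  then have c: "(\<lambda>z. tensor (fst z) (snd z) :: real ^ 'n ^ 'm) \<in> borel_measurable borel"
    by (rule borel_measurable_continuous_onI)
  have pair: "(\<lambda>x. (u x, p x)) \<in> borel_measurable M" using assms by (rule borel_measurable_Pair)
  from measurable_compose[OF pair c] show ?thesis by simp
qed

lemma has_weak_grad_add:
  "open \<Omega> \<Longrightarrow> has_weak_grad \<Omega> u G \<Longrightarrow> has_weak_grad \<Omega> v H \<Longrightarrow>
    has_weak_grad \<Omega> (\<lambda>x. u x + v x) (\<lambda>x. G x + H x)"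
  by (simp add: has_weak_grad_def column_add has_weak_deriv_add)

lemma has_weak_grad_scaleR:
  "has_weak_grad \<Omega> u G \<Longrightarrow> has_weak_grad \<Omega> (\<lambda>x. c *\<^sub>R u x) (\<lambda>x. c *\<^sub>R G x)"
  by (simp add: has_weak_grad_def column_scaleR has_weak_deriv_scaleR)

lemma has_weak_grad_diff:
  assumes "open \<Omega>" "has_weak_grad \<Omega> u G" "has_weak_grad \<Omega> v H"
  shows "has_weak_grad \<Omega> (\<lambda>x. u x - v x) (\<lambda>x. G x - H x)"
  using has_weak_grad_add[OF assms(1,2) has_weak_grad_scaleR[OF assms(3), of "-1"]] by simp

lemma has_weak_grad_product:
  assumes "open \<Omega>" "has_weak_grad \<Omega> u G" "smooth_on \<zeta> UNIV"
  shows "has_weak_grad \<Omega> (\<lambda>x. \<zeta> x *\<^sub>R u x) (\<lambda>x. \<zeta> x *\<^sub>R G x + tensor (u x) (nabla \<zeta> x))"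
  unfolding has_weak_grad_def column_add column_scaleR column_tensor nabla_def vec_lambda_beta
proof
  fix j
  have "has_weak_deriv \<Omega> (axis j 1) u (\<lambda>x. column j (G x))"
    using assms(2) by (simp add: has_weak_grad_def)
  then show "has_weak_deriv \<Omega> (axis j 1) (\<lambda>x. \<zeta> x *\<^sub>R u x)
    (\<lambda>x. \<zeta> x *\<^sub>R column j (G x) + frechet_derivative \<zeta> (at x) (axis j 1) *\<^sub>R u x)"
    by (rule has_weak_deriv_product[OF assms(1) _ assms(3)])
qed

lemma has_weak_grad_smooth:
  "open \<Omega> \<Longrightarrow> smooth_on u UNIV \<Longrightarrow> has_weak_grad \<Omega> u (jacobi u)"
  by (simp add: has_weak_grad_def column_jacobi has_weak_deriv_smooth)

lemma has_weak_grad_unique: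
  assumes "open \<Omega>" "has_weak_grad \<Omega> u G" "has_weak_grad \<Omega> u H"
  shows "AE x in lebesgue_on \<Omega>. G x = H x"
proof -
  have "AE x in lebesgue_on \<Omega>. column j (G x) = column j (H x)" for j
    using spec[OF assms(2)[unfolded has_weak_grad_def], of j] spec[OF assms(3)[unfolded has_weak_grad_def], of j]
    by (rule has_weak_deriv_unique[OF assms(1)])
  then have "AE x in lebesgue_on \<Omega>. \<forall>j\<in>UNIV. column j (G x) = column j (H x)"
    by (subst AE_finite_all) simp_all
  then show ?thesis by eventually_elim (auto intro: matrix_eq_columns)
qed

lemma has_weak_grad_wgrad: "has_weak_grad \<Omega> u G \<Longrightarrow> has_weak_grad \<Omega> u (wgrad \<Omega> u)"
  unfolding wgrad_def by (rule someI[of "has_weak_grad \<Omega> u"])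

lemma wgrad_AE_eq:
  "open \<Omega> \<Longrightarrow> has_weak_grad \<Omega> u G \<Longrightarrow> AE x in lebesgue_on \<Omega>. wgrad \<Omega> u x = G x"
  using has_weak_grad_unique has_weak_grad_wgrad by blast

lemma borel_measurable_lebesgue_on_AE:
  fixes f g :: "'a::euclidean_space \<Rightarrow> 'b::euclidean_space"
  assumes S: "S \<in> sets lebesgue" and f: "f \<in> borel_measurable (lebesgue_on S)"
    and ae: "AE x in lebesgue_on S. f x = g x"
  shows "g \<in> borel_measurable (lebesgue_on S)"
proof -
  have "(\<lambda>x. if x \<in> S then f x else 0) \<in> borel_measurable lebesgue"
    using f S by (simp add: borel_measurable_if)
  moreover have "AE x in lebesgue. (if x \<in> S then f x else 0) = (if x \<in> S then g x else 0)"
    using ae S by (auto simp: AE_restrict_space_iff elim: eventually_mono)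
  ultimately have "(\<lambda>x. if x \<in> S then g x else 0) \<in> borel_measurable lebesgue"
    by (rule borel_measurable_AE)
  then show ?thesis using S by (simp add: borel_measurable_if)
qed

lemma square_integrable_AE_cong:
  fixes f g :: "'a::euclidean_space \<Rightarrow> 'b::euclidean_space"
  assumes S: "S \<in> sets lebesgue" and f: "square_integrable (lebesgue_on S) f"
    and ae: "AE x in lebesgue_on S. f x = g x"
  shows "square_integrable (lebesgue_on S) g" "sq_norm (lebesgue_on S) g = sq_norm (lebesgue_on S) f"
proof -
  have mf: "f \<in> borel_measurable (lebesgue_on S)" using f by (rule square_integrable_measurable)
  have mg: "g \<in> borel_measurable (lebesgue_on S)"
    by (rule borel_measurable_lebesgue_on_AE[OF S mf ae])
  have ae2: "AE x in lebesgue_on S. (norm (f x))\<^sup>2 = (norm (g x))\<^sup>2" using ae by eventually_elim simp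
  have "integrable (lebesgue_on S) (\<lambda>x. (norm (g x))\<^sup>2)"
    by (rule integrable_cong_AE_imp[OF square_integrable_integrable[OF f]])
       (use mg ae2 in \<open>auto simp: eq_commute\<close>)
  then show "square_integrable (lebesgue_on S) g" using mg by (simp add: square_integrable_def)
  show "sq_norm (lebesgue_on S) g = sq_norm (lebesgue_on S) f"
    by (rule integral_cong_AE) (use mf mg ae2 in \<open>auto simp: eq_commute\<close>)
qed

lemma bounded_continuous_image:
  fixes f :: "'a::euclidean_space \<Rightarrow> 'b::real_normed_vector"
  assumes "continuous_on UNIV f" "bounded S"
  shows "\<exists>B\<ge>0. \<forall>x\<in>S. norm (f x) \<le> B"
proof -
  have "compact (f ` closure S)"
    by (intro compact_continuous_image continuous_on_subset[OF assms(1)])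
       (use assms(2) in \<open>auto simp: compact_closure\<close>)
  then obtain B where B: "\<forall>y\<in>f ` closure S. norm y \<le> B"
    using compact_imp_bounded[of "f ` closure S"] unfolding bounded_iff by blast
  show ?thesis
  proof (intro exI[of _ "\<bar>B\<bar>"] conjI ballI)
    fix x assume "x \<in> S"
    then have "f x \<in> f ` closure S" using closure_subset by blast
    then show "norm (f x) \<le> \<bar>B\<bar>" using B by fastforce
  qed simp
qed

lemma measurable_lebesgue_on_continuous:
  fixes f :: "'a::euclidean_space \<Rightarrow> 'b::euclidean_space"
  assumes "continuous_on UNIV f"
  shows "f \<in> borel_measurable (lebesgue_on S)"
  by (intro measurable_restrict_space1 measurable_completion)
     (simp add: borel_measurable_continuous_onI[OF assms])

lemma finite_measure_lebesgue_on_open: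
  "open \<Omega> \<Longrightarrow> bounded \<Omega> \<Longrightarrow> finite_measure (lebesgue_on \<Omega>)"
  by (intro finite_measureI) (use lmeasurable_open[of \<Omega>] in \<open>auto simp: emeasure_restrict_space fmeasurable_def\<close>)

lemma square_integrable_continuous:
  fixes f :: "'a::euclidean_space \<Rightarrow> 'b::euclidean_space"
  assumes "continuous_on UNIV f" "open \<Omega>" "bounded \<Omega>"
  shows "square_integrable (lebesgue_on \<Omega>) f"
proof -
  obtain B where B: "\<forall>x\<in>\<Omega>. norm (f x) \<le> B" using bounded_continuous_image[OF assms(1,3)] by blast
  interpret finite_measure "lebesgue_on \<Omega>" by (rule finite_measure_lebesgue_on_open[OF assms(2,3)])
  have m: "f \<in> borel_measurable (lebesgue_on \<Omega>)" by (rule measurable_lebesgue_on_continuous[OF assms(1)])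
  have "integrable (lebesgue_on \<Omega>) (\<lambda>x. (norm (f x))\<^sup>2)"
  proof (rule integrable_const_bound[of _ "B\<^sup>2"])
    show "AE x in lebesgue_on \<Omega>. norm ((norm (f x))\<^sup>2) \<le> B\<^sup>2"
      by (intro AE_I2) (use B in \<open>auto intro!: power_mono\<close>)
    show "(\<lambda>x. (norm (f x))\<^sup>2) \<in> borel_measurable (lebesgue_on \<Omega>)" using m by measurable
  qed
  then show ?thesis using m by (simp add: square_integrable_def)
qed

lemma continuous_jacobi: "smooth_on u UNIV \<Longrightarrow> continuous_on UNIV (jacobi u)"
  unfolding jacobi_def
  by (intro continuous_intros smooth_on_continuous smooth_on_frechet_derivative)

lemma continuous_nabla: "smooth_on \<zeta> UNIV \<Longrightarrow> continuous_on UNIV (nabla \<zeta>)"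
  unfolding nabla_def
  by (intro continuous_intros smooth_on_continuous smooth_on_frechet_derivative)

text \<open>The chosen gradient agrees almost everywhere with a square integrable one, and Lebesgue measure is
  complete, so that the chosen gradient inherits measurability.\<close>

lemma W12_wgrad:
  assumes "open \<Omega>" "W12 \<Omega> u"
  shows "square_integrable (lebesgue_on \<Omega>) u" "has_weak_grad \<Omega> u (wgrad \<Omega> u)"
    "square_integrable (lebesgue_on \<Omega>) (wgrad \<Omega> u)"
proof -
  show "square_integrable (lebesgue_on \<Omega>) u" using assms(2) by (simp add: W12_def L2_on_eq)
  obtain G where G: "has_weak_grad \<Omega> u G" "square_integrable (lebesgue_on \<Omega>) G"
    using assms(2) by (auto simp: W12_def L2_on_eq)
  show "has_weak_grad \<Omega> u (wgrad \<Omega> u)" by (rule has_weak_grad_wgrad[OF G(1)])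
  have "AE x in lebesgue_on \<Omega>. G x = wgrad \<Omega> u x"
    using wgrad_AE_eq[OF assms(1) G(1)] by eventually_elim simp
  then show "square_integrable (lebesgue_on \<Omega>) (wgrad \<Omega> u)"
    using assms(1) by (intro square_integrable_AE_cong(1)[OF _ G(2)]) auto
qed

text \<open>The approximation property in terms of a given weak gradient and classical derivatives, which
  avoids the chosen gradient of a difference.\<close>

definition approximable :: "(real ^ 'n) set \<Rightarrow> (real ^ 'n \<Rightarrow> real ^ 'm) \<Rightarrow> (real ^ 'n \<Rightarrow> real ^ 'n ^ 'm) \<Rightarrow> bool" where
  "approximable \<Omega> u G \<longleftrightarrow> (\<exists>\<phi>. (\<forall>k. test_function \<Omega> (\<phi> k)) \<and>
     (\<lambda>k. sq_norm (lebesgue_on \<Omega>) (\<lambda>x. \<phi> k x - u x)) \<longlonglongrightarrow> 0 \<and>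
     (\<lambda>k. sq_norm (lebesgue_on \<Omega>) (\<lambda>x. jacobi (\<phi> k) x - G x)) \<longlonglongrightarrow> 0)"

lemma test_function_smooth: "test_function U f \<Longrightarrow> smooth_on f UNIV"
  by (simp add: test_function_def)

lemma W12_0_iff_approximable:
  assumes \<Omega>: "open \<Omega>" "bounded \<Omega>" and u: "square_integrable (lebesgue_on \<Omega>) u"
    and G: "has_weak_grad \<Omega> u G" "square_integrable (lebesgue_on \<Omega>) G"
  shows "W12_0 \<Omega> u \<longleftrightarrow> approximable \<Omega> u G"
proof -
  have norm_eq: "(W12_norm \<Omega> (\<lambda>x. \<phi> x - u x))\<^sup>2
      = sq_norm (lebesgue_on \<Omega>) (\<lambda>x. \<phi> x - u x) + sq_norm (lebesgue_on \<Omega>) (\<lambda>x. jacobi \<phi> x - G x)"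
    if \<phi>: "test_function \<Omega> \<phi>" for \<phi>
  proof -
    note s = test_function_smooth[OF \<phi>]
    have wg: "has_weak_grad \<Omega> (\<lambda>x. \<phi> x - u x) (\<lambda>x. jacobi \<phi> x - G x)"
      by (intro has_weak_grad_diff \<Omega>(1) has_weak_grad_smooth s G(1))
    have ae: "AE x in lebesgue_on \<Omega>. jacobi \<phi> x - G x = wgrad \<Omega> (\<lambda>x. \<phi> x - u x) x"
      using wgrad_AE_eq[OF \<Omega>(1) wg] by eventually_elim simp
    have "square_integrable (lebesgue_on \<Omega>) (\<lambda>x. jacobi \<phi> x - G x)"
      by (intro square_integrable_diff G(2) square_integrable_continuous continuous_jacobi s \<Omega>)
    from square_integrable_AE_cong(2)[OF _ this ae] \<Omega>(1)
    show ?thesis by (simp add: W12_norm_def L2_norm_on_def)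
  qed
  have lim_eq: "(\<lambda>k. W12_norm \<Omega> (\<lambda>x. \<phi> k x - u x)) \<longlonglongrightarrow> 0 \<longleftrightarrow>
     (\<lambda>k. sq_norm (lebesgue_on \<Omega>) (\<lambda>x. \<phi> k x - u x)) \<longlonglongrightarrow> 0 \<and>
     (\<lambda>k. sq_norm (lebesgue_on \<Omega>) (\<lambda>x. jacobi (\<phi> k) x - G x)) \<longlonglongrightarrow> 0"
    if \<phi>: "\<forall>k. test_function \<Omega> (\<phi> k)" for \<phi>
  proof -
    let ?a = "\<lambda>k. sq_norm (lebesgue_on \<Omega>) (\<lambda>x. \<phi> k x - u x)"
    let ?b = "\<lambda>k. sq_norm (lebesgue_on \<Omega>) (\<lambda>x. jacobi (\<phi> k) x - G x)"
    let ?W = "\<lambda>k. W12_norm \<Omega> (\<lambda>x. \<phi> k x - u x)"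
    have W0: "0 \<le> ?W k" for k by (simp add: W12_norm_def)
    have W2: "(?W k)\<^sup>2 = ?a k + ?b k" for k using norm_eq \<phi> by blast
    have a0: "0 \<le> ?a k" and b0: "0 \<le> ?b k" for k by simp_all
    show ?thesis
    proof
      assume "?W \<longlonglongrightarrow> 0"
      then have "(\<lambda>k. (?W k)\<^sup>2) \<longlonglongrightarrow> 0\<^sup>2" by (rule tendsto_power)
      then have lim: "(\<lambda>k. ?a k + ?b k) \<longlonglongrightarrow> 0" by (simp only: W2) simp
      have "?a \<longlonglongrightarrow> 0"
        by (rule tendsto_sandwich[OF _ _ tendsto_const lim]) (simp_all add: b0 a0)
      moreover have "?b \<longlonglongrightarrow> 0"
        by (rule tendsto_sandwich[OF _ _ tendsto_const lim]) (simp_all add: b0 a0)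
      ultimately show "?a \<longlonglongrightarrow> 0 \<and> ?b \<longlonglongrightarrow> 0" by blast
    next
      assume "?a \<longlonglongrightarrow> 0 \<and> ?b \<longlonglongrightarrow> 0"
      then have "(\<lambda>k. sqrt (?a k + ?b k)) \<longlonglongrightarrow> sqrt (0 + 0)"
        by (intro tendsto_real_sqrt tendsto_add) blast+
      moreover have "sqrt (?a k + ?b k) = ?W k" for k
        unfolding W2[symmetric] using W0 by simp
      ultimately show "?W \<longlonglongrightarrow> 0" by simp
    qed
  qed
  have "W12 \<Omega> u" using u G by (auto simp: W12_def L2_on_eq)
  then show ?thesis unfolding W12_0_def approximable_def using lim_eq by blast
qed

lemma W12_0D:
  assumes "open \<Omega>" "bounded \<Omega>" "W12_0 \<Omega> u"
  shows "square_integrable (lebesgue_on \<Omega>) u" "has_weak_grad \<Omega> u (wgrad \<Omega> u)"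
    "square_integrable (lebesgue_on \<Omega>) (wgrad \<Omega> u)" "approximable \<Omega> u (wgrad \<Omega> u)"
proof -
  have "W12 \<Omega> u" using assms(3) by (simp add: W12_0_def)
  from W12_wgrad[OF assms(1) this]
  show *: "square_integrable (lebesgue_on \<Omega>) u" "has_weak_grad \<Omega> u (wgrad \<Omega> u)"
    "square_integrable (lebesgue_on \<Omega>) (wgrad \<Omega> u)" .
  show "approximable \<Omega> u (wgrad \<Omega> u)"
    using W12_0_iff_approximable[OF assms(1,2) *] assms(3) by simp
qed

lemma tendsto_zero_sq_norm_bound:
  assumes "a \<longlonglongrightarrow> 0" "b \<longlonglongrightarrow> (0::real)"
    and "\<And>k. c k \<le> p * a k + q * b k" "\<And>k. 0 \<le> c k"
  shows "c \<longlonglongrightarrow> 0"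
proof (rule tendsto_sandwich[OF _ _ tendsto_const])
  have "(\<lambda>k. p * a k + q * b k) \<longlonglongrightarrow> p * 0 + q * 0" by (intro tendsto_intros assms)
  then show "(\<lambda>k. p * a k + q * b k) \<longlonglongrightarrow> 0" by simp
qed (use assms in auto)

lemma jacobi_add_scaleR:
  assumes "smooth_on u UNIV" "smooth_on v UNIV"
  shows "jacobi (\<lambda>x. a *\<^sub>R u x + b *\<^sub>R v x) x = a *\<^sub>R jacobi u x + b *\<^sub>R jacobi v x"
proof -
  have "((\<lambda>x. a *\<^sub>R u x + b *\<^sub>R v x) has_derivative
     (\<lambda>e. a *\<^sub>R frechet_derivative u (at x) e + b *\<^sub>R frechet_derivative v (at x) e)) (at x)"
    by (intro has_derivative_add has_derivative_scaleR_right smooth_on_has_derivative assms)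
  from frechet_derivative_at[OF this, symmetric] show ?thesis
    by (simp add: jacobi_def vec_eq_iff)
qed

lemma jacobi_product:
  assumes "smooth_on \<zeta> UNIV" "smooth_on u UNIV"
  shows "jacobi (\<lambda>x. \<zeta> x *\<^sub>R u x) x = \<zeta> x *\<^sub>R jacobi u x + tensor (u x) (nabla \<zeta> x)"
  by (simp add: jacobi_def vec_eq_iff frechet_derivative_scaleR[OF assms] tensor_def nabla_def mult.commute)

lemma W12_0_combination:
  fixes \<Omega> :: "(real ^ 'n) set"
  assumes \<Omega>: "open \<Omega>" "bounded \<Omega>" and u: "W12_0 \<Omega> u" and v: "W12_0 \<Omega> v"
  shows "W12_0 \<Omega> (\<lambda>x. a *\<^sub>R u x + b *\<^sub>R v x)"
    and "AE x in lebesgue_on \<Omega>. wgrad \<Omega> (\<lambda>x. a *\<^sub>R u x + b *\<^sub>R v x) x = a *\<^sub>R wgrad \<Omega> u x + b *\<^sub>R wgrad \<Omega> v x"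
proof -
  note U = W12_0D[OF \<Omega> u] and V = W12_0D[OF \<Omega> v]
  let ?M = "lebesgue_on \<Omega>"
  let ?G = "\<lambda>x. a *\<^sub>R wgrad \<Omega> u x + b *\<^sub>R wgrad \<Omega> v x"
  have wg: "has_weak_grad \<Omega> (\<lambda>x. a *\<^sub>R u x + b *\<^sub>R v x) ?G"
    by (intro has_weak_grad_add has_weak_grad_scaleR \<Omega>(1) U(2) V(2))
  show "AE x in ?M. wgrad \<Omega> (\<lambda>x. a *\<^sub>R u x + b *\<^sub>R v x) x = ?G x"
    by (rule wgrad_AE_eq[OF \<Omega>(1) wg])
  obtain \<phi> where \<phi>: "\<forall>k. test_function \<Omega> (\<phi> k)" "(\<lambda>k. sq_norm ?M (\<lambda>x. \<phi> k x - u x)) \<longlonglongrightarrow> 0"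
     "(\<lambda>k. sq_norm ?M (\<lambda>x. jacobi (\<phi> k) x - wgrad \<Omega> u x)) \<longlonglongrightarrow> 0"
    using U(4) by (auto simp: approximable_def)
  obtain \<xi> where \<xi>: "\<forall>k. test_function \<Omega> (\<xi> k)" "(\<lambda>k. sq_norm ?M (\<lambda>x. \<xi> k x - v x)) \<longlonglongrightarrow> 0"
     "(\<lambda>k. sq_norm ?M (\<lambda>x. jacobi (\<xi> k) x - wgrad \<Omega> v x)) \<longlonglongrightarrow> 0"
    using V(4) by (auto simp: approximable_def)
  note s\<phi> = test_function_smooth[OF \<phi>(1)[rule_format]] and s\<xi> = test_function_smooth[OF \<xi>(1)[rule_format]]
  have comb: "sq_norm ?M (\<lambda>x. (a *\<^sub>R f x + b *\<^sub>R g x) - (a *\<^sub>R p x + b *\<^sub>R q x))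
      \<le> 2 * a\<^sup>2 * sq_norm ?M (\<lambda>x. f x - p x) + 2 * b\<^sup>2 * sq_norm ?M (\<lambda>x. g x - q x)"
    if "square_integrable ?M (\<lambda>x. f x - p x)" "square_integrable ?M (\<lambda>x. g x - q x)"
    for f g p q :: "real ^ 'n \<Rightarrow> 'c::euclidean_space"
  proof -
    have "(a *\<^sub>R f x + b *\<^sub>R g x) - (a *\<^sub>R p x + b *\<^sub>R q x) = a *\<^sub>R (f x - p x) + b *\<^sub>R (g x - q x)" for x
      by (simp add: algebra_simps)
    then show ?thesis
      using square_integrable_add(2)[OF square_integrable_scaleR(1)[OF that(1), of a] square_integrable_scaleR(1)[OF that(2), of b]]
      unfolding square_integrable_scaleR(2)[OF that(1)] square_integrable_scaleR(2)[OF that(2)] by simp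
  qed
  have "approximable \<Omega> (\<lambda>x. a *\<^sub>R u x + b *\<^sub>R v x) ?G"
    unfolding approximable_def
  proof (intro exI[of _ "\<lambda>k x. a *\<^sub>R \<phi> k x + b *\<^sub>R \<xi> k x"] conjI allI)
    show "test_function \<Omega> (\<lambda>x. a *\<^sub>R \<phi> k x + b *\<^sub>R \<xi> k x)" for k
      by (intro test_function_add test_function_scaleR_right smooth_on_const \<phi>(1)[rule_format] \<xi>(1)[rule_format])
    have d\<phi>: "square_integrable ?M (\<lambda>x. \<phi> k x - u x)" "square_integrable ?M (\<lambda>x. jacobi (\<phi> k) x - wgrad \<Omega> u x)" for k
      by (intro square_integrable_diff U square_integrable_continuous continuous_jacobi s\<phi> \<Omega> smooth_on_continuous[OF s\<phi>])+
    have d\<xi>: "square_integrable ?M (\<lambda>x. \<xi> k x - v x)" "square_integrable ?M (\<lambda>x. jacobi (\<xi> k) x - wgrad \<Omega> v x)" for k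
      by (intro square_integrable_diff V square_integrable_continuous continuous_jacobi s\<xi> \<Omega> smooth_on_continuous[OF s\<xi>])+
    show "(\<lambda>k. sq_norm ?M (\<lambda>x. (a *\<^sub>R \<phi> k x + b *\<^sub>R \<xi> k x) - (a *\<^sub>R u x + b *\<^sub>R v x))) \<longlonglongrightarrow> 0"
      by (rule tendsto_zero_sq_norm_bound[OF \<phi>(2) \<xi>(2) comb[OF d\<phi>(1) d\<xi>(1)]]) simp
    show "(\<lambda>k. sq_norm ?M (\<lambda>x. jacobi (\<lambda>x. a *\<^sub>R \<phi> k x + b *\<^sub>R \<xi> k x) x - ?G x)) \<longlonglongrightarrow> 0"
      unfolding jacobi_add_scaleR[OF s\<phi> s\<xi>]
      by (rule tendsto_zero_sq_norm_bound[OF \<phi>(3) \<xi>(3) comb[OF d\<phi>(2) d\<xi>(2)]]) simp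
  qed
  moreover have "square_integrable ?M (\<lambda>x. a *\<^sub>R u x + b *\<^sub>R v x)" "square_integrable ?M ?G"
    by (intro square_integrable_add square_integrable_scaleR U V)+
  ultimately show "W12_0 \<Omega> (\<lambda>x. a *\<^sub>R u x + b *\<^sub>R v x)"
    using W12_0_iff_approximable[OF \<Omega> _ wg] by blast
qed

text \<open>The products of \<open>\<zeta>\<close> with the test functions that approximate \<open>u\<close> are again test functions. Compact
  support comes from the second factor, so that \<open>\<zeta>\<close> may be nonzero at the boundary; a factor
  that depends on time only is constant on each slice and of this kind.\<close>

lemma W12_0_product:
  assumes \<Omega>: "open \<Omega>" "bounded \<Omega>" and u: "W12_0 \<Omega> u" and z: "smooth_on \<zeta> UNIV"
  shows "W12_0 \<Omega> (\<lambda>x. \<zeta> x *\<^sub>R u x)"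
    and "AE x in lebesgue_on \<Omega>. wgrad \<Omega> (\<lambda>x. \<zeta> x *\<^sub>R u x) x = \<zeta> x *\<^sub>R wgrad \<Omega> u x + tensor (u x) (nabla \<zeta> x)"
proof -
  note U = W12_0D[OF \<Omega> u]
  let ?M = "lebesgue_on \<Omega>"
  let ?G = "\<lambda>x. \<zeta> x *\<^sub>R wgrad \<Omega> u x + tensor (u x) (nabla \<zeta> x)"
  have wg: "has_weak_grad \<Omega> (\<lambda>x. \<zeta> x *\<^sub>R u x) ?G"
    by (intro has_weak_grad_product \<Omega>(1) U(2) z)
  show "AE x in ?M. wgrad \<Omega> (\<lambda>x. \<zeta> x *\<^sub>R u x) x = ?G x"
    by (rule wgrad_AE_eq[OF \<Omega>(1) wg])
  note cz = smooth_on_continuous[OF z, of UNIV] and cn = continuous_nabla[OF z]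
  note mz = measurable_lebesgue_on_continuous[OF cz] and mn = measurable_lebesgue_on_continuous[OF cn]
  obtain B where B: "\<forall>x\<in>\<Omega>. norm (\<zeta> x) \<le> B" using bounded_continuous_image[OF cz \<Omega>(2)] by blast
  obtain D where D: "\<forall>x\<in>\<Omega>. norm (nabla \<zeta> x) \<le> D" using bounded_continuous_image[OF cn \<Omega>(2)] by blast
  have sz: "square_integrable ?M (\<lambda>x. \<zeta> x *\<^sub>R f x)" "sq_norm ?M (\<lambda>x. \<zeta> x *\<^sub>R f x) \<le> B\<^sup>2 * sq_norm ?M f"
    if f: "square_integrable ?M f" for f :: "real ^ 'a \<Rightarrow> 'c::euclidean_space"
  proof -
    have m: "(\<lambda>x. \<zeta> x *\<^sub>R f x) \<in> borel_measurable ?M"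
      by (intro borel_measurable_scaleR mz square_integrable_measurable f)
    have le: "AE x in ?M. norm (\<zeta> x *\<^sub>R f x) \<le> B * norm (f x)"
      by (rule AE_I2) (use B in \<open>simp add: mult_right_mono\<close>)
    show "square_integrable ?M (\<lambda>x. \<zeta> x *\<^sub>R f x)" "sq_norm ?M (\<lambda>x. \<zeta> x *\<^sub>R f x) \<le> B\<^sup>2 * sq_norm ?M f"
      using square_integrable_bound[OF f m le] .
  qed
  have st: "square_integrable ?M (\<lambda>x. tensor (f x) (nabla \<zeta> x))"
      "sq_norm ?M (\<lambda>x. tensor (f x) (nabla \<zeta> x)) \<le> D\<^sup>2 * sq_norm ?M f"
    if f: "square_integrable ?M f" for f :: "real ^ 'a \<Rightarrow> real ^ 'b"
  proof -
    have m: "(\<lambda>x. tensor (f x) (nabla \<zeta> x)) \<in> borel_measurable ?M"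
      by (intro measurable_tensor mn square_integrable_measurable f)
    have le: "AE x in ?M. norm (tensor (f x) (nabla \<zeta> x)) \<le> D * norm (f x)"
      by (rule AE_I2) (use D in \<open>simp add: norm_tensor mult.commute[of D] mult_left_mono\<close>)
    show "square_integrable ?M (\<lambda>x. tensor (f x) (nabla \<zeta> x))"
      "sq_norm ?M (\<lambda>x. tensor (f x) (nabla \<zeta> x)) \<le> D\<^sup>2 * sq_norm ?M f"
      using square_integrable_bound[OF f m le] .
  qed
  obtain \<phi> where \<phi>: "\<forall>k. test_function \<Omega> (\<phi> k)" "(\<lambda>k. sq_norm ?M (\<lambda>x. \<phi> k x - u x)) \<longlonglongrightarrow> 0"
     "(\<lambda>k. sq_norm ?M (\<lambda>x. jacobi (\<phi> k) x - wgrad \<Omega> u x)) \<longlonglongrightarrow> 0"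
    using U(4) by (auto simp: approximable_def)
  note s\<phi> = test_function_smooth[OF \<phi>(1)[rule_format]]
  have d: "square_integrable ?M (\<lambda>x. \<phi> k x - u x)" "square_integrable ?M (\<lambda>x. jacobi (\<phi> k) x - wgrad \<Omega> u x)" for k
    by (intro square_integrable_diff U square_integrable_continuous continuous_jacobi s\<phi> \<Omega> smooth_on_continuous[OF s\<phi>])+
  have "approximable \<Omega> (\<lambda>x. \<zeta> x *\<^sub>R u x) ?G"
    unfolding approximable_def
  proof (intro exI[of _ "\<lambda>k x. \<zeta> x *\<^sub>R \<phi> k x"] conjI allI)
    show "test_function \<Omega> (\<lambda>x. \<zeta> x *\<^sub>R \<phi> k x)" for k
      by (intro test_function_scaleR_right z \<phi>(1)[rule_format])
    show "(\<lambda>k. sq_norm ?M (\<lambda>x. \<zeta> x *\<^sub>R \<phi> k x - \<zeta> x *\<^sub>R u x)) \<longlonglongrightarrow> 0"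
    proof (rule tendsto_zero_sq_norm_bound[OF \<phi>(2) \<phi>(3)])
      show "sq_norm ?M (\<lambda>x. \<zeta> x *\<^sub>R \<phi> k x - \<zeta> x *\<^sub>R u x) \<le> B\<^sup>2 * sq_norm ?M (\<lambda>x. \<phi> k x - u x)
          + 0 * sq_norm ?M (\<lambda>x. jacobi (\<phi> k) x - wgrad \<Omega> u x)" for k
        using sz(2)[OF d(1)[of k]] by (simp add: scaleR_diff_right)
    qed simp
    show "(\<lambda>k. sq_norm ?M (\<lambda>x. jacobi (\<lambda>x. \<zeta> x *\<^sub>R \<phi> k x) x - ?G x)) \<longlonglongrightarrow> 0"
    proof (rule tendsto_zero_sq_norm_bound[OF \<phi>(2) \<phi>(3)])
      fix k
      have "jacobi (\<lambda>x. \<zeta> x *\<^sub>R \<phi> k x) x - ?G x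
          = \<zeta> x *\<^sub>R (jacobi (\<phi> k) x - wgrad \<Omega> u x) + tensor (\<phi> k x - u x) (nabla \<zeta> x)" for x
        by (simp add: jacobi_product[OF z s\<phi>] tensor_diff_left scaleR_diff_right)
      then have "sq_norm ?M (\<lambda>x. jacobi (\<lambda>x. \<zeta> x *\<^sub>R \<phi> k x) x - ?G x)
          \<le> 2 * sq_norm ?M (\<lambda>x. \<zeta> x *\<^sub>R (jacobi (\<phi> k) x - wgrad \<Omega> u x))
            + 2 * sq_norm ?M (\<lambda>x. tensor (\<phi> k x - u x) (nabla \<zeta> x))"
        using square_integrable_add(2)[OF sz(1)[OF d(2)[of k]] st(1)[OF d(1)[of k]]] by simp
      also have "\<dots> \<le> 2 * D\<^sup>2 * sq_norm ?M (\<lambda>x. \<phi> k x - u x)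
            + 2 * B\<^sup>2 * sq_norm ?M (\<lambda>x. jacobi (\<phi> k) x - wgrad \<Omega> u x)"
        using sz(2)[OF d(2)[of k]] st(2)[OF d(1)[of k]] by linarith
      finally show "sq_norm ?M (\<lambda>x. jacobi (\<lambda>x. \<zeta> x *\<^sub>R \<phi> k x) x - ?G x)
          \<le> 2 * D\<^sup>2 * sq_norm ?M (\<lambda>x. \<phi> k x - u x)
            + 2 * B\<^sup>2 * sq_norm ?M (\<lambda>x. jacobi (\<phi> k) x - wgrad \<Omega> u x)" .
    qed simp
  qed
  moreover have "square_integrable ?M (\<lambda>x. \<zeta> x *\<^sub>R u x)" by (rule sz(1)[OF U(1)])
  moreover have "square_integrable ?M ?G" by (intro square_integrable_add sz(1) st(1) U)
  ultimately show "W12_0 \<Omega> (\<lambda>x. \<zeta> x *\<^sub>R u x)"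
    using W12_0_iff_approximable[OF \<Omega> _ wg] by blast
qed

section \<open>Functions with bounded Hessian\<close>

lemma Ck_on_2:
  assumes "Ck_on 2 f UNIV"
  shows "(f has_derivative frechet_derivative f (at x)) (at x)"
    and "((\<lambda>y. frechet_derivative f (at y) e) has_derivative
      frechet_derivative (\<lambda>y. frechet_derivative f (at y) e) (at x)) (at x)"
proof -
  have 2: "Ck_on (Suc (Suc 0)) f UNIV" using assms by (simp only: numeral_2_eq_2)
  show "(f has_derivative frechet_derivative f (at x)) (at x)"
    by (rule Ck_on_has_derivative[OF 2])
  have "Ck_on (Suc 0) (\<lambda>y. frechet_derivative f (at y) e) UNIV"
    using 2 unfolding Ck_on.simps(2)[of "Suc 0"] by blast
  then show "((\<lambda>y. frechet_derivative f (at y) e) has_derivative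
      frechet_derivative (\<lambda>y. frechet_derivative f (at y) e) (at x)) (at x)"
    by (rule Ck_on_has_derivative)
qed

lemma linear_eq_sum_Basis:
  fixes L :: "'a::euclidean_space \<Rightarrow> real"
  assumes "linear L"
  shows "L z = (\<Sum>b\<in>Basis. L b * (z \<bullet> b))"
proof -
  have "L z = L (\<Sum>b\<in>Basis. (z \<bullet> b) *\<^sub>R b)" by (simp add: euclidean_representation)
  also have "\<dots> = (\<Sum>b\<in>Basis. L b * (z \<bullet> b))"
    using assms by (simp add: linear_sum linear_scale mult.commute)
  finally show ?thesis .
qed

lemma grad_inner:
  assumes "(f has_derivative frechet_derivative f (at x)) (at x)"
  shows "grad f x \<bullet> z = frechet_derivative f (at x) z"
  unfolding grad_def
  by (subst linear_eq_sum_Basis[OF has_derivative_linear[OF assms], of z])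
     (simp add: inner_sum_left inner_commute[of z])

lemma second_derivative_along_line:
  assumes "Ck_on 2 f UNIV"
  shows "((\<lambda>s. f (x + s *\<^sub>R z)) has_real_derivative grad f (x + s *\<^sub>R z) \<bullet> z) (at s)"
    and "((\<lambda>s. grad f (x + s *\<^sub>R z) \<bullet> z) has_real_derivative hessian_form f (x + s *\<^sub>R z) z) (at s)"
proof -
  have line: "((\<lambda>s. x + s *\<^sub>R z) has_derivative (\<lambda>t. t *\<^sub>R z)) (at s)" for s
    by (auto intro!: derivative_eq_intros)
  have along: "((\<lambda>s. h (x + s *\<^sub>R z)) has_real_derivative frechet_derivative h (at (x + s *\<^sub>R z)) z) (at s)"
    if "(h has_derivative frechet_derivative h (at (x + s *\<^sub>R z))) (at (x + s *\<^sub>R z))" for h :: "'a \<Rightarrow> real" and s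
  proof -
    from has_derivative_compose[OF line that]
    have "((\<lambda>s. h (x + s *\<^sub>R z)) has_derivative (\<lambda>t. frechet_derivative h (at (x + s *\<^sub>R z)) (t *\<^sub>R z))) (at s)" .
    moreover have "frechet_derivative h (at (x + s *\<^sub>R z)) (t *\<^sub>R z) = frechet_derivative h (at (x + s *\<^sub>R z)) z * t" for t
      using linear_scale[OF has_derivative_linear[OF that], of t z] by simp
    ultimately show ?thesis by (simp add: has_field_derivative_def)
  qed
  note d = Ck_on_2[OF assms]
  show "((\<lambda>s. f (x + s *\<^sub>R z)) has_real_derivative grad f (x + s *\<^sub>R z) \<bullet> z) (at s)"
    unfolding grad_inner[OF d(1)] by (rule along[OF d(1)])
  have eq: "grad f y \<bullet> z = (\<Sum>b\<in>Basis. frechet_derivative f (at y) b * (z \<bullet> b))" for y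
    unfolding grad_inner[OF d(1)] by (rule linear_eq_sum_Basis[OF has_derivative_linear[OF d(1)]])
  have "((\<lambda>s. \<Sum>b\<in>Basis. frechet_derivative f (at (x + s *\<^sub>R z)) b * (z \<bullet> b)) has_real_derivative
      (\<Sum>b\<in>Basis. frechet_derivative (\<lambda>y. frechet_derivative f (at y) b) (at (x + s *\<^sub>R z)) z * (z \<bullet> b))) (at s)"
    by (intro DERIV_sum DERIV_cmult_right along d(2))
  also have "(\<Sum>b\<in>Basis. frechet_derivative (\<lambda>y. frechet_derivative f (at y) b) (at (x + s *\<^sub>R z)) z * (z \<bullet> b))
      = hessian_form f (x + s *\<^sub>R z) z"
    unfolding hessian_form_def
  proof (rule sum.cong[OF refl])
    fix b :: 'a
    have "frechet_derivative (\<lambda>y. frechet_derivative f (at y) b) (at (x + s *\<^sub>R z)) z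
       = (\<Sum>c\<in>Basis. frechet_derivative (\<lambda>y. frechet_derivative f (at y) b) (at (x + s *\<^sub>R z)) c * (z \<bullet> c))"
      by (rule linear_eq_sum_Basis[OF has_derivative_linear[OF d(2)]])
    then show "frechet_derivative (\<lambda>y. frechet_derivative f (at y) b) (at (x + s *\<^sub>R z)) z * (z \<bullet> b)
       = (\<Sum>c\<in>Basis. frechet_derivative (\<lambda>y. frechet_derivative f (at y) b) (at (x + s *\<^sub>R z)) c * (z \<bullet> b) * (z \<bullet> c))"
      by (simp add: sum_distrib_left sum_distrib_right mult.assoc mult.commute mult.left_commute)
  qed
  finally show "((\<lambda>s. grad f (x + s *\<^sub>R z) \<bullet> z) has_real_derivative hessian_form f (x + s *\<^sub>R z) z) (at s)"
    unfolding eq .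
qed

text \<open>Taylor expansion along the segment from \<open>x\<close> to \<open>x + z\<close>.\<close>

lemma quadratic_bounds:
  assumes "C2_hessian_bounds a b f"
  shows "a / 2 * (norm z)\<^sup>2 \<le> f (x + z) - f x - grad f x \<bullet> z"
    and "f (x + z) - f x - grad f x \<bullet> z \<le> b / 2 * (norm z)\<^sup>2"
proof -
  have c2: "Ck_on 2 f UNIV" and h: "a * (norm z)\<^sup>2 \<le> hessian_form f y z" "hessian_form f y z \<le> b * (norm z)\<^sup>2" for y
    using assms by (auto simp: C2_hessian_bounds_def)
  define D where "D m s = (if m = 0 then f (x + s *\<^sub>R z) else if m = 1 then grad f (x + s *\<^sub>R z) \<bullet> z
      else hessian_form f (x + s *\<^sub>R z) z)" for m :: nat and s
  have "\<exists>t>0. t < 1 \<and> D 0 1 = (\<Sum>m<2. D m 0 / fact m * 1 ^ m) + D 2 t / fact 2 * 1 ^ 2"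
  proof (rule Maclaurin)
    show "\<forall>m t. m < 2 \<and> 0 \<le> t \<and> t \<le> 1 \<longrightarrow> (D m has_real_derivative D (Suc m) t) (at t)"
    proof (intro allI impI)
      fix m :: nat and t :: real assume "m < 2 \<and> 0 \<le> t \<and> t \<le> 1"
      then have "m = 0 \<or> m = 1" by linarith
      then show "(D m has_real_derivative D (Suc m) t) (at t)"
        unfolding D_def using second_derivative_along_line[OF c2] by auto
    qed
  qed simp_all
  then obtain t where "D 0 1 = (\<Sum>m<2. D m 0 / fact m * 1 ^ m) + D 2 t / fact 2 * 1 ^ 2" by blast
  then have "f (x + z) - f x - grad f x \<bullet> z = hessian_form f (x + t *\<^sub>R z) z / 2"
    by (simp add: D_def numeral_2_eq_2)
  then show "a / 2 * (norm z)\<^sup>2 \<le> f (x + z) - f x - grad f x \<bullet> z"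
    and "f (x + z) - f x - grad f x \<bullet> z \<le> b / 2 * (norm z)\<^sup>2"
    using h[of "x + t *\<^sub>R z"] by simp_all
qed

lemma grad_strongly_monotone:
  assumes "C2_hessian_bounds a b f"
  shows "a * (norm (y - x))\<^sup>2 \<le> (grad f y - grad f x) \<bullet> (y - x)"
  using quadratic_bounds(1)[OF assms, of "y - x" x] quadratic_bounds(1)[OF assms, of "x - y" y]
  by (simp add: inner_diff norm_minus_commute)

text \<open>The argument of Baillon and Haddad: \<open>f\<close> minus its tangent at \<open>x\<close> is nonnegative also at the point
  that a gradient step of length \<open>1 / b\<close> reaches from \<open>y\<close>, and the upper quadratic bound says how much such
  a step decreases it.\<close>

lemma grad_Lipschitz:
  assumes "C2_hessian_bounds a b f" and a: "0 \<le> a" and b: "0 < b"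
  shows "norm (grad f y - grad f x) \<le> b * norm (y - x)"
proof -
  define D where "D = grad f y - grad f x"
  let ?z = "(- 1 / b) *\<^sub>R D"
  have low: "0 \<le> f (x + (y + ?z - x)) - f x - grad f x \<bullet> (y + ?z - x)"
    using quadratic_bounds(1)[OF assms(1), of "y + ?z - x" x] a
    by (meson order_trans divide_nonneg_pos mult_nonneg_nonneg zero_le_power2 zero_less_numeral)
  have up: "f (y + ?z) - f y - grad f y \<bullet> ?z \<le> b / 2 * (norm ?z)\<^sup>2"
    by (rule quadratic_bounds(2)[OF assms(1)])
  have top: "f (x + (y - x)) - f x - grad f x \<bullet> (y - x) \<le> b / 2 * (norm (y - x))\<^sup>2"
    by (rule quadratic_bounds(2)[OF assms(1)])
  have nz: "b / 2 * (norm ?z)\<^sup>2 = (norm D)\<^sup>2 / (2 * b)"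
    using b by (simp add: power_mult_distrib power2_eq_square field_simps)
  have g: "grad f x \<bullet> (y + ?z - x) = grad f x \<bullet> (y - x) + grad f x \<bullet> ?z"
    by (simp add: inner_simps)
  have gz: "grad f y \<bullet> ?z - grad f x \<bullet> ?z = - (norm D)\<^sup>2 / b"
    unfolding inner_diff_left[symmetric] D_def[symmetric]
    by (simp add: power2_norm_eq_inner)
  have e: "x + (y + ?z - x) = y + ?z" "x + (y - x) = y" by simp_all
  have "(norm D)\<^sup>2 / b - (norm D)\<^sup>2 / (2 * b) \<le> b / 2 * (norm (y - x))\<^sup>2"
    using low up top gz unfolding g nz e by linarith
  then have "(norm D)\<^sup>2 \<le> (b * norm (y - x))\<^sup>2"
    using b by (simp add: field_simps power2_eq_square)
  then show ?thesis
    unfolding D_def by (rule power2_le_imp_le) (use b in simp)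
qed

lemma continuous_grad:
  assumes "C2_hessian_bounds a b f"
  shows "continuous_on UNIV (grad f)" "continuous_on UNIV f"
proof -
  have 2: "Ck_on (Suc (Suc 0)) f UNIV" using assms by (simp add: C2_hessian_bounds_def numeral_2_eq_2)
  then show "continuous_on UNIV f" by (rule Ck_on_continuous)
  have "continuous_on UNIV (\<lambda>y. frechet_derivative f (at y) e)" for e
    using 2 Ck_on_continuous unfolding Ck_on.simps(2)[of "Suc 0"] by blast
  then show "continuous_on UNIV (grad f)"
    unfolding grad_def by (intro continuous_intros)
qed

text \<open>The composition of the Legendre transform of \<open>\<psi>\<close> with its gradient; it is the density that is
  controlled along the time steps.\<close>

definition dual_energy :: "('a::euclidean_space \<Rightarrow> real) \<Rightarrow> 'a \<Rightarrow> real" where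
  "dual_energy \<psi> w = grad \<psi> w \<bullet> w - \<psi> w"

text \<open>Both are the quadratic bounds for \<open>\<psi>\<close> at \<open>w\<close>, evaluated at the origin, where \<open>\<psi>\<close> vanishes.\<close>

lemma dual_energy_bounds:
  assumes "C2_hessian_bounds \<alpha> A \<psi>" "0 \<le> \<alpha>" "\<psi> 0 = 0"
  shows "0 \<le> dual_energy \<psi> w" "dual_energy \<psi> w \<le> A / 2 * (norm w)\<^sup>2"
proof -
  have "0 \<le> \<alpha> / 2 * (norm w)\<^sup>2" using assms(2) by simp
  then show "0 \<le> dual_energy \<psi> w" "dual_energy \<psi> w \<le> A / 2 * (norm w)\<^sup>2"
    using quadratic_bounds[OF assms(1), where z = "- w" and x = w] assms(3) by (simp_all add: dual_energy_def)
qed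

text \<open>The substitute for the chain rule \<open>(D\<psi>(w))' \<bullet> w = (dual_energy \<psi> w)'\<close> in discrete time: it says that
  \<open>\<psi>\<close> lies above its tangent at \<open>w'\<close>.\<close>

lemma dual_energy_diff_le:
  assumes "C2_hessian_bounds \<alpha> A \<psi>" "0 \<le> \<alpha>"
  shows "dual_energy \<psi> w - dual_energy \<psi> w' \<le> (grad \<psi> w - grad \<psi> w') \<bullet> w"
proof -
  have "0 \<le> \<alpha> / 2 * (norm (w - w'))\<^sup>2" using assms(2) by simp
  then show ?thesis
    using quadratic_bounds(1)[OF assms(1), of "w - w'" w'] by (simp add: dual_energy_def inner_simps)
qed

lemma continuous_dual_energy:
  assumes "C2_hessian_bounds \<alpha> A \<psi>"
  shows "continuous_on UNIV (dual_energy \<psi>)"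
  unfolding dual_energy_def by (intro continuous_intros continuous_grad[OF assms])

section \<open>The discrete Caccioppoli inequality\<close>

lemma measurable_continuous_compose:
  assumes "continuous_on UNIV h" "f \<in> borel_measurable M"
  shows "(\<lambda>x. h (f x)) \<in> borel_measurable M"
  by (rule measurable_compose[OF assms(2) borel_measurable_continuous_onI[OF assms(1)]])

lemma square_integrable_grad:
  assumes \<Omega>: "open \<Omega>" "bounded \<Omega>" and f: "C2_hessian_bounds a b f" "0 \<le> a" "0 < b"
    and u: "square_integrable (lebesgue_on \<Omega>) u"
  shows "square_integrable (lebesgue_on \<Omega>) (\<lambda>x. grad f (u x))"
proof -
  let ?M = "lebesgue_on \<Omega>"
  have m: "(\<lambda>x. grad f (u x) - grad f 0) \<in> borel_measurable ?M"
    by (intro borel_measurable_diff borel_measurable_const measurable_continuous_compose[OF continuous_grad(1)[OF f(1)]]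
        square_integrable_measurable u)
  have "square_integrable ?M (\<lambda>x. grad f (u x) - grad f 0)"
  proof (rule square_integrable_bound(1)[OF u m])
    show "AE x in ?M. norm (grad f (u x) - grad f 0) \<le> b * norm (u x)"
      using grad_Lipschitz[OF f, of _ 0] by (intro AE_I2) simp
  qed
  moreover have "square_integrable ?M (\<lambda>x. grad f 0)"
    by (rule square_integrable_continuous[OF continuous_on_const \<Omega>])
  ultimately have "square_integrable ?M (\<lambda>x. (grad f (u x) - grad f 0) + grad f 0)"
    by (rule square_integrable_add(1))
  then show ?thesis by simp
qed

lemma integrable_continuous_mult:
  fixes c f :: "'a::euclidean_space \<Rightarrow> real"
  assumes "continuous_on UNIV c" "bounded \<Omega>" "integrable (lebesgue_on \<Omega>) f"
  shows "integrable (lebesgue_on \<Omega>) (\<lambda>x. c x * f x)"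
proof -
  obtain B where B: "\<forall>x\<in>\<Omega>. norm (c x) \<le> B" using bounded_continuous_image[OF assms(1,2)] by blast
  show ?thesis
  proof (rule Bochner_Integration.integrable_bound)
    show "integrable (lebesgue_on \<Omega>) (\<lambda>x. B * f x)" using assms(3) by simp
    show "(\<lambda>x. c x * f x) \<in> borel_measurable (lebesgue_on \<Omega>)"
      by (intro borel_measurable_times measurable_lebesgue_on_continuous[OF assms(1)] borel_measurable_integrable[OF assms(3)])
    show "AE x in lebesgue_on \<Omega>. norm (c x * f x) \<le> norm (B * f x)"
    proof (rule AE_I2)
      fix x assume "x \<in> space (lebesgue_on \<Omega>)"
      then have "\<bar>c x\<bar> \<le> \<bar>B\<bar>" using B by fastforce
      then show "norm (c x * f x) \<le> norm (B * f x)" by (simp add: abs_mult mult_right_mono)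
    qed
  qed
qed

lemma integrable_dual_energy:
  assumes \<psi>: "C2_hessian_bounds \<alpha> A \<psi>" "0 \<le> \<alpha>" "\<psi> 0 = 0"
    and u: "square_integrable M u"
  shows "integrable M (\<lambda>x. dual_energy \<psi> (u x))"
proof (rule Bochner_Integration.integrable_bound)
  show "integrable M (\<lambda>x. A / 2 * (norm (u x))\<^sup>2)"
    using square_integrable_integrable[OF u] by simp
  show "(\<lambda>x. dual_energy \<psi> (u x)) \<in> borel_measurable M"
    by (intro measurable_continuous_compose[OF continuous_dual_energy[OF \<psi>(1)]] square_integrable_measurable u)
  show "AE x in M. norm (dual_energy \<psi> (u x)) \<le> norm (A / 2 * (norm (u x))\<^sup>2)"
  proof (rule AE_I2)
    fix x
    show "norm (dual_energy \<psi> (u x)) \<le> norm (A / 2 * (norm (u x))\<^sup>2)"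
      unfolding real_norm_def using dual_energy_bounds[OF \<psi>, of "u x"] by linarith
  qed
qed

lemma absorb_cross_term:
  fixes a b \<theta> \<Theta> :: real
  assumes "0 < \<theta>"
  shows "2 * \<Theta> * (a * b) \<le> \<theta> / 2 * a\<^sup>2 + 2 * \<Theta>\<^sup>2 / \<theta> * b\<^sup>2"
proof -
  have "0 \<le> (\<theta> * a - 2 * \<Theta> * b)\<^sup>2 / (2 * \<theta>)" using assms by simp
  also have "\<dots> = \<theta> / 2 * a\<^sup>2 + 2 * \<Theta>\<^sup>2 / \<theta> * b\<^sup>2 - 2 * \<Theta> * (a * b)"
    using assms by (simp add: field_simps power2_eq_square)
  finally show ?thesis by simp
qed

lemma nabla_square:
  assumes "smooth_on \<zeta> UNIV"
  shows "nabla (\<lambda>x. \<zeta> x * \<zeta> x) x = (2 * \<zeta> x) *\<^sub>R nabla \<zeta> x"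
  using frechet_derivative_scaleR[OF assms assms, of x]
  by (simp add: nabla_def vec_eq_iff algebra_simps)

text \<open>Two consecutive equations are subtracted and tested with \<open>\<zeta>\<^sup>2 d\<^sub>2\<close>. Convexity of \<open>\<psi>\<close> bounds the
  first term below by a difference of dual energies, which telescopes in time, and ellipticity of
  \<open>F\<close> produces the gradient of the difference quotient.\<close>

lemma Caccioppoli_one_step:
  fixes \<Omega> :: "(real ^ 'n) set" and u0 u1 u2 :: "real ^ 'n \<Rightarrow> real ^ 'm"
  assumes \<Omega>: "open \<Omega>" "bounded \<Omega>"
    and \<psi>: "C2_hessian_bounds \<alpha> A \<psi>" "0 < \<alpha>" "0 < A" "\<psi> 0 = 0"
    and F: "C2_hessian_bounds \<theta> \<Theta> F" "0 < \<theta>" "0 < \<Theta>" and \<tau>: "0 < \<tau>"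
    and W: "W12_0 \<Omega> u0" "W12_0 \<Omega> u1" "W12_0 \<Omega> u2"
    and d1: "d1 = (\<lambda>x. (u1 x - u0 x) /\<^sub>R \<tau>)" and d2: "d2 = (\<lambda>x. (u2 x - u1 x) /\<^sub>R \<tau>)"
    and eq1: "\<And>w. W12_0 \<Omega> w \<Longrightarrow> (LINT x|lebesgue_on \<Omega>. grad \<psi> (d1 x) \<bullet> w x)
           + (LINT x|lebesgue_on \<Omega>. grad F (wgrad \<Omega> u1 x) \<bullet> wgrad \<Omega> w x) = 0"
    and eq2: "\<And>w. W12_0 \<Omega> w \<Longrightarrow> (LINT x|lebesgue_on \<Omega>. grad \<psi> (d2 x) \<bullet> w x)
           + (LINT x|lebesgue_on \<Omega>. grad F (wgrad \<Omega> u2 x) \<bullet> wgrad \<Omega> w x) = 0"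
    and z: "smooth_on \<zeta> UNIV"
  shows "\<theta> / 2 * \<tau> * (LINT x|lebesgue_on \<Omega>. (\<zeta> x)\<^sup>2 * (norm (wgrad \<Omega> d2 x))\<^sup>2)
    \<le> (LINT x|lebesgue_on \<Omega>. (\<zeta> x)\<^sup>2 * dual_energy \<psi> (d1 x))
      - (LINT x|lebesgue_on \<Omega>. (\<zeta> x)\<^sup>2 * dual_energy \<psi> (d2 x))
      + 2 * \<Theta>\<^sup>2 / \<theta> * \<tau> * (LINT x|lebesgue_on \<Omega>. (norm (nabla \<zeta> x))\<^sup>2 * (norm (d2 x))\<^sup>2)"
proof -
  let ?M = "lebesgue_on \<Omega>"
  have quotient: "W12_0 \<Omega> (\<lambda>x. (v x - u x) /\<^sub>R \<tau>)"
      "AE x in ?M. wgrad \<Omega> (\<lambda>x. (v x - u x) /\<^sub>R \<tau>) x = (wgrad \<Omega> v x - wgrad \<Omega> u x) /\<^sub>R \<tau>"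
    if "W12_0 \<Omega> u" "W12_0 \<Omega> v" for u v :: "real ^ 'n \<Rightarrow> real ^ 'm"
    using W12_0_combination[OF \<Omega> that(2,1), of "inverse \<tau>" "- inverse \<tau>"]
    by (simp_all add: scaleR_diff_right)
  have wd: "W12_0 \<Omega> d1" "W12_0 \<Omega> d2"
    unfolding d1 d2 by (intro quotient(1) W)+
  have Heq: "AE x in ?M. wgrad \<Omega> d2 x = (wgrad \<Omega> u2 x - wgrad \<Omega> u1 x) /\<^sub>R \<tau>"
    unfolding d2 by (rule quotient(2)[OF W(2,3)])
  define w where "w x = (\<zeta> x * \<zeta> x) *\<^sub>R d2 x" for x
  have z2: "smooth_on (\<lambda>x. \<zeta> x * \<zeta> x) UNIV" by (rule smooth_on_mult[OF z z])
  have ww: "W12_0 \<Omega> w" unfolding w_def by (rule W12_0_product(1)[OF \<Omega> wd(2) z2])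
  have Weq: "AE x in ?M. wgrad \<Omega> w x = (\<zeta> x * \<zeta> x) *\<^sub>R wgrad \<Omega> d2 x + tensor (d2 x) ((2 * \<zeta> x) *\<^sub>R nabla \<zeta> x)"
    using W12_0_product(2)[OF \<Omega> wd(2) z2] unfolding w_def nabla_square[OF z] .
  note D1 = W12_0D[OF \<Omega> wd(1)] and D2 = W12_0D[OF \<Omega> wd(2)] and Dw = W12_0D[OF \<Omega> ww]
    and U1 = W12_0D[OF \<Omega> W(2)] and U2 = W12_0D[OF \<Omega> W(3)]
  have \<alpha>0: "0 \<le> \<alpha>" and \<theta>0: "0 \<le> \<theta>" using \<psi>(2) F(2) by simp_all
  note g\<psi> = square_integrable_grad[OF \<Omega> \<psi>(1) \<alpha>0 \<psi>(3)] and gF = square_integrable_grad[OF \<Omega> F(1) \<theta>0 F(3)]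
  note i\<psi>1 = integrable_inner_product[OF g\<psi>[OF D1(1)] Dw(1)]
    and i\<psi>2 = integrable_inner_product[OF g\<psi>[OF D2(1)] Dw(1)]
    and iF1 = integrable_inner_product[OF gF[OF U1(3)] Dw(3)]
    and iF2 = integrable_inner_product[OF gF[OF U2(3)] Dw(3)]
  let ?K = "\<lambda>x. (grad \<psi> (d2 x) \<bullet> w x - grad \<psi> (d1 x) \<bullet> w x)
    + (grad F (wgrad \<Omega> u2 x) \<bullet> wgrad \<Omega> w x - grad F (wgrad \<Omega> u1 x) \<bullet> wgrad \<Omega> w x)"
  have iK: "integrable ?M ?K"
    by (intro Bochner_Integration.integrable_add Bochner_Integration.integrable_diff i\<psi>1 i\<psi>2 iF1 iF2)
  have K0: "integral\<^sup>L ?M ?K = 0"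
    using i\<psi>1 i\<psi>2 iF1 iF2 eq1[OF ww] eq2[OF ww] by simp
  note cz = smooth_on_continuous[OF z, of UNIV]
  have cz2: "continuous_on UNIV (\<lambda>x. (\<zeta> x)\<^sup>2)" by (intro continuous_intros cz)
  have cn2: "continuous_on UNIV (\<lambda>x. (norm (nabla \<zeta> x))\<^sup>2)" by (intro continuous_intros continuous_nabla z)
  note iP1 = integrable_continuous_mult[OF cz2 \<Omega>(2) integrable_dual_energy[OF \<psi>(1) \<alpha>0 \<psi>(4) D1(1)]]
    and iP2 = integrable_continuous_mult[OF cz2 \<Omega>(2) integrable_dual_energy[OF \<psi>(1) \<alpha>0 \<psi>(4) D2(1)]]
    and iH = integrable_continuous_mult[OF cz2 \<Omega>(2) square_integrable_integrable[OF D2(3)]]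
    and iN = integrable_continuous_mult[OF cn2 \<Omega>(2) square_integrable_integrable[OF D2(1)]]
  let ?R = "\<lambda>x. ((\<zeta> x)\<^sup>2 * dual_energy \<psi> (d2 x) - (\<zeta> x)\<^sup>2 * dual_energy \<psi> (d1 x))
    + (\<theta> / 2 * \<tau> * ((\<zeta> x)\<^sup>2 * (norm (wgrad \<Omega> d2 x))\<^sup>2)
      - 2 * \<Theta>\<^sup>2 / \<theta> * \<tau> * ((norm (nabla \<zeta> x))\<^sup>2 * (norm (d2 x))\<^sup>2))"
  have iR: "integrable ?M ?R"
    by (intro Bochner_Integration.integrable_add Bochner_Integration.integrable_diff integrable_mult_right iP1 iP2 iH iN)
  have "AE x in ?M. ?R x \<le> ?K x"
    using Heq Weq
  proof eventually_elim
    case (elim x)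
    define H where "H = wgrad \<Omega> d2 x"
    define \<Delta> where "\<Delta> = grad F (wgrad \<Omega> u2 x) - grad F (wgrad \<Omega> u1 x)"
    define p where "p = nabla \<zeta> x"
    have GH: "wgrad \<Omega> u2 x - wgrad \<Omega> u1 x = \<tau> *\<^sub>R H"
      using elim(1) \<tau> by (simp add: H_def)
    have mono: "\<theta> * \<tau> * (norm H)\<^sup>2 \<le> \<Delta> \<bullet> H"
    proof -
      have "\<theta> * (norm (\<tau> *\<^sub>R H))\<^sup>2 \<le> \<Delta> \<bullet> (\<tau> *\<^sub>R H)"
        using grad_strongly_monotone[OF F(1), of "wgrad \<Omega> u2 x" "wgrad \<Omega> u1 x"] by (simp only: GH \<Delta>_def)
      then have "\<tau> * (\<theta> * \<tau> * (norm H)\<^sup>2) \<le> \<tau> * (\<Delta> \<bullet> H)"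
        by (simp add: power_mult_distrib power2_eq_square[of \<tau>] mult.assoc mult.left_commute)
      then show ?thesis using \<tau> by (rule mult_left_le_imp_le)
    qed
    have lip: "norm \<Delta> \<le> \<Theta> * \<tau> * norm H"
      using grad_Lipschitz[OF F(1) \<theta>0 F(3), of "wgrad \<Omega> u2 x" "wgrad \<Omega> u1 x"] \<tau>
      by (simp add: GH \<Delta>_def)
    have "\<bar>\<Delta> \<bullet> tensor (d2 x) ((2 * \<zeta> x) *\<^sub>R p)\<bar> \<le> norm \<Delta> * norm (tensor (d2 x) ((2 * \<zeta> x) *\<^sub>R p))"
      by (rule Cauchy_Schwarz_ineq2)
    also have "\<dots> \<le> (\<Theta> * \<tau> * norm H) * norm (tensor (d2 x) ((2 * \<zeta> x) *\<^sub>R p))"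
      by (rule mult_right_mono[OF lip]) simp
    also have "\<dots> = \<tau> * (2 * \<Theta> * ((\<bar>\<zeta> x\<bar> * norm H) * (norm p * norm (d2 x))))"
      by (simp add: norm_tensor abs_mult)
    also have "\<dots> \<le> \<tau> * (\<theta> / 2 * (\<bar>\<zeta> x\<bar> * norm H)\<^sup>2 + 2 * \<Theta>\<^sup>2 / \<theta> * (norm p * norm (d2 x))\<^sup>2)"
      by (rule mult_left_mono[OF absorb_cross_term[OF F(2)]]) (use \<tau> in simp)
    also have "\<dots> = \<theta> / 2 * \<tau> * ((\<zeta> x)\<^sup>2 * (norm H)\<^sup>2) + 2 * \<Theta>\<^sup>2 / \<theta> * \<tau> * ((norm p)\<^sup>2 * (norm (d2 x))\<^sup>2)"
      by (simp add: power_mult_distrib algebra_simps)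
    finally have cross: "- (\<theta> / 2 * \<tau> * ((\<zeta> x)\<^sup>2 * (norm H)\<^sup>2) + 2 * \<Theta>\<^sup>2 / \<theta> * \<tau> * ((norm p)\<^sup>2 * (norm (d2 x))\<^sup>2))
        \<le> \<Delta> \<bullet> tensor (d2 x) ((2 * \<zeta> x) *\<^sub>R p)" by linarith
    have "\<theta> * \<tau> * ((\<zeta> x)\<^sup>2 * (norm H)\<^sup>2) = (\<zeta> x)\<^sup>2 * (\<theta> * \<tau> * (norm H)\<^sup>2)" by simp
    also have "\<dots> \<le> (\<zeta> x)\<^sup>2 * (\<Delta> \<bullet> H)" by (rule mult_left_mono[OF mono]) simp
    also have "\<dots> = \<Delta> \<bullet> ((\<zeta> x * \<zeta> x) *\<^sub>R H)" by (simp add: power2_eq_square)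
    finally have main: "\<theta> * \<tau> * ((\<zeta> x)\<^sup>2 * (norm H)\<^sup>2) \<le> \<Delta> \<bullet> ((\<zeta> x * \<zeta> x) *\<^sub>R H)" .
    have half: "\<theta> * \<tau> * ((\<zeta> x)\<^sup>2 * (norm H)\<^sup>2) = 2 * (\<theta> / 2 * \<tau> * ((\<zeta> x)\<^sup>2 * (norm H)\<^sup>2))" by simp
    have "(\<zeta> x)\<^sup>2 * (dual_energy \<psi> (d2 x) - dual_energy \<psi> (d1 x)) \<le> (\<zeta> x)\<^sup>2 * ((grad \<psi> (d2 x) - grad \<psi> (d1 x)) \<bullet> d2 x)"
      by (rule mult_left_mono[OF dual_energy_diff_le[OF \<psi>(1) \<alpha>0]]) simp
    also have "\<dots> = grad \<psi> (d2 x) \<bullet> w x - grad \<psi> (d1 x) \<bullet> w x"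
      by (simp add: w_def inner_diff_left power2_eq_square right_diff_distrib)
    finally have en: "(\<zeta> x)\<^sup>2 * dual_energy \<psi> (d2 x) - (\<zeta> x)\<^sup>2 * dual_energy \<psi> (d1 x)
        \<le> grad \<psi> (d2 x) \<bullet> w x - grad \<psi> (d1 x) \<bullet> w x" by (simp only: right_diff_distrib)
    have Fw: "grad F (wgrad \<Omega> u2 x) \<bullet> wgrad \<Omega> w x - grad F (wgrad \<Omega> u1 x) \<bullet> wgrad \<Omega> w x
        = \<Delta> \<bullet> ((\<zeta> x * \<zeta> x) *\<^sub>R H) + \<Delta> \<bullet> tensor (d2 x) ((2 * \<zeta> x) *\<^sub>R p)"
      unfolding inner_diff_left[symmetric] \<Delta>_def[symmetric] elim(2) H_def p_def by (rule inner_add_right)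
    show ?case
      unfolding Fw H_def[symmetric] p_def[symmetric] using en main cross half by linarith
  qed
  then have "integral\<^sup>L ?M ?R \<le> 0"
    using integral_mono_AE[OF iR iK] K0 by simp
  moreover have "integral\<^sup>L ?M ?R = (LINT x|?M. (\<zeta> x)\<^sup>2 * dual_energy \<psi> (d2 x)) - (LINT x|?M. (\<zeta> x)\<^sup>2 * dual_energy \<psi> (d1 x))
    + (\<theta> / 2 * \<tau> * (LINT x|?M. (\<zeta> x)\<^sup>2 * (norm (wgrad \<Omega> d2 x))\<^sup>2)
      - 2 * \<Theta>\<^sup>2 / \<theta> * \<tau> * (LINT x|?M. (norm (nabla \<zeta> x))\<^sup>2 * (norm (d2 x))\<^sup>2))"
    using iP1 iP2 iH iN by simp
  ultimately show ?thesis by linarith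
qed

lemma smooth_on_slice:
  fixes \<eta> :: "'a::euclidean_space \<times> real \<Rightarrow> real"
  assumes "smooth_on \<eta> UNIV"
  shows "smooth_on (\<lambda>x. \<eta> (x, t)) UNIV"
proof -
  have "linear (\<lambda>x::'a. (x, 0::real))" by (auto intro!: linearI)
  from smooth_on_compose_affine[OF this assms, of "(0, t)"] show ?thesis by simp
qed

lemma frechet_derivative_slice:
  fixes \<eta> :: "'a::euclidean_space \<times> real \<Rightarrow> real"
  assumes "smooth_on \<eta> UNIV"
  shows "frechet_derivative (\<lambda>x. \<eta> (x, t)) (at x) e = frechet_derivative \<eta> (at (x, t)) (e, 0)"
proof -
  have "((\<lambda>x. (x, t)) has_derivative (\<lambda>e. (e, 0))) (at x)"
    by (auto intro!: derivative_eq_intros)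
  from has_derivative_compose[OF this smooth_on_has_derivative[OF assms]]
  have "((\<lambda>x. \<eta> (x, t)) has_derivative (\<lambda>e. frechet_derivative \<eta> (at (x, t)) (e, 0))) (at x)" .
  from frechet_derivative_at[OF this, symmetric] show ?thesis by simp
qed

lemma nabla_slice: "smooth_on \<eta> UNIV \<Longrightarrow> nabla (\<lambda>x. \<eta> (x, t)) x = space_grad \<eta> (x, t)"
  by (simp add: nabla_def space_grad_def frechet_derivative_slice)

definition difference_quotient :: "real \<Rightarrow> (nat \<Rightarrow> 'a \<Rightarrow> 'b::real_vector) \<Rightarrow> nat \<Rightarrow> 'a \<Rightarrow> 'b" where
  "difference_quotient \<tau> V k = (\<lambda>x. (V k x - V (k - 1) x) /\<^sub>R \<tau>)"

lemma W12_0_difference_quotient: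
  assumes "open \<Omega>" "bounded \<Omega>" "W12_0 \<Omega> (V k)" "W12_0 \<Omega> (V (k - 1))"
  shows "W12_0 \<Omega> (difference_quotient \<tau> V k)"
  using W12_0_combination(1)[OF assms, of "inverse \<tau>" "- inverse \<tau>"]
  by (simp add: difference_quotient_def scaleR_diff_right)

lemma summation_by_parts_le:
  fixes a b q :: "nat \<Rightarrow> real"
  assumes "\<And>k. 1 \<le> k \<Longrightarrow> k \<le> n \<Longrightarrow> a (Suc k) - b k \<le> q k" "a 1 = 0"
  shows "(\<Sum>k=1..n. a k - b k) \<le> (\<Sum>k=1..n. q k) - a (Suc n)"
  using assms(1)
proof (induction n)
  case 0
  then show ?case using assms(2) by simp
next
  case (Suc n)
  have "(\<Sum>k=1..n. a k - b k) \<le> (\<Sum>k=1..n. q k) - a (Suc n)" using Suc by simp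
  moreover have "a (Suc (Suc n)) - b (Suc n) \<le> q (Suc n)" using Suc.prems[of "Suc n"] by simp
  ultimately show ?case by simp
qed

text \<open>The one-step inequality is summed by parts in time. It compares a step with the preceding one, so
  that it is available from the second step on; the cutoff is evaluated at the left end of each step
  and vanishes at time zero, which makes the left-hand side of the first step zero.\<close>

lemma Caccioppoli_discrete:
  fixes \<Omega> :: "(real ^ 'n) set" and V :: "nat \<Rightarrow> real ^ 'n \<Rightarrow> real ^ 'm" and \<eta> :: "(real ^ 'n) \<times> real \<Rightarrow> real"
  assumes \<Omega>: "open \<Omega>" "bounded \<Omega>"
    and \<psi>: "C2_hessian_bounds \<alpha> A \<psi>" "0 < \<alpha>" "0 < A" "\<psi> 0 = 0"
    and F: "C2_hessian_bounds \<theta> \<Theta> F" "0 < \<theta>" "0 < \<Theta>" and T: "0 < T" "0 < N"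
    and g: "W12_0 \<Omega> g" and scheme: "implicit_scheme \<Omega> T \<psi> F g N V"
    and \<eta>: "smooth_on \<eta> UNIV" "\<And>x. \<eta> (x, 0) = 0" and \<tau>: "\<tau> = T / real N"
  shows "\<theta> / 2 * (\<Sum>k=1..N. \<tau> * (LINT x|lebesgue_on \<Omega>. (\<eta> (x, real (k - 1) * \<tau>))\<^sup>2 *
        (norm (wgrad \<Omega> (difference_quotient \<tau> V k) x))\<^sup>2))
    \<le> (\<Sum>k=1..N. \<tau> * (LINT x|lebesgue_on \<Omega>.
        (A / 2 * (\<bar>(\<eta> (x, real k * \<tau>))\<^sup>2 - (\<eta> (x, real (k - 1) * \<tau>))\<^sup>2\<bar> / \<tau>)
          + 2 * \<Theta>\<^sup>2 / \<theta> * (norm (space_grad \<eta> (x, real (k - 1) * \<tau>)))\<^sup>2)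
        * (norm (difference_quotient \<tau> V k x))\<^sup>2))"
proof -
  let ?M = "lebesgue_on \<Omega>"
  let ?d = "difference_quotient \<tau> V"
  let ?e = "\<lambda>k x. \<eta> (x, real (k - 1) * \<tau>)"
  let ?P = "\<lambda>k x. dual_energy \<psi> (?d k x)"
  have \<tau>0: "0 < \<tau>" using T \<tau> by simp
  have \<alpha>0: "0 \<le> \<alpha>" using \<psi> by simp
  have W: "W12_0 \<Omega> (V k)" if "k \<le> N" for k
    using scheme g that by (cases "k = 0") (auto simp: implicit_scheme_def)
  have Wd: "W12_0 \<Omega> (?d k)" if "k \<le> N" for k
    using W W[of "k - 1"] that by (intro W12_0_difference_quotient \<Omega>) auto
  have eq: "(LINT x|?M. grad \<psi> (?d k x) \<bullet> w x) + (LINT x|?M. grad F (wgrad \<Omega> (V k) x) \<bullet> wgrad \<Omega> w x) = 0"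
    if "1 \<le> k" "k \<le> N" "W12_0 \<Omega> w" for k w
    using scheme that unfolding implicit_scheme_def difference_quotient_def \<tau> by simp
  have D: "square_integrable ?M (?d k)" if "k \<le> N" for k by (rule W12_0D(1)[OF \<Omega> Wd[OF that]])
  have se: "smooth_on (?e k) UNIV" for k by (rule smooth_on_slice[OF \<eta>(1)])
  have ce: "continuous_on UNIV (?e k)" for k by (rule smooth_on_continuous[OF se])
  have ce2: "continuous_on UNIV (\<lambda>x. (?e k x)\<^sup>2)" for k by (intro continuous_intros ce)
  have iP: "integrable ?M (?P k)" if "k \<le> N" for k
    by (rule integrable_dual_energy[OF \<psi>(1) \<alpha>0 \<psi>(4) D[OF that]])
  have iN: "integrable ?M (\<lambda>x. (norm (nabla (?e k) x))\<^sup>2 * (norm (?d k x))\<^sup>2)" if "k \<le> N" for k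
    by (intro integrable_continuous_mult \<Omega>(2) square_integrable_integrable D that continuous_intros continuous_nabla se)
  let ?a = "\<lambda>k. LINT x|?M. (?e k x)\<^sup>2 * ?P (k - 1) x"
  let ?b = "\<lambda>k. LINT x|?M. (?e k x)\<^sup>2 * ?P k x"
  let ?q = "\<lambda>k. LINT x|?M. \<bar>(?e (Suc k) x)\<^sup>2 - (?e k x)\<^sup>2\<bar> * ?P k x"
  let ?S = "\<lambda>k. LINT x|?M. (?e k x)\<^sup>2 * (norm (wgrad \<Omega> (?d k) x))\<^sup>2"
  let ?t = "\<lambda>k. LINT x|?M. (norm (nabla (?e k) x))\<^sup>2 * (norm (?d k x))\<^sup>2"
  have step: "\<theta> / 2 * (\<tau> * ?S k) \<le> (?a k - ?b k) + 2 * \<Theta>\<^sup>2 / \<theta> * \<tau> * ?t k" if k: "k \<in> {1..N}" for k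
  proof (cases "k = 1")
    case True
    have "0 \<le> 2 * \<Theta>\<^sup>2 / \<theta> * \<tau> * ?t k"
      using F(2) \<tau>0 by (intro mult_nonneg_nonneg divide_nonneg_pos integral_nonneg_AE) auto
    then show ?thesis using True \<eta>(2) by simp
  next
    case False
    then have k2: "2 \<le> k" "k \<le> N" using k by auto
    have k1: "k - 1 - 1 \<le> N" "k - 1 \<le> N" "1 \<le> k - 1" "1 \<le> k" using k2 by auto
    have "\<theta> / 2 * \<tau> * ?S k \<le> ?a k - ?b k + 2 * \<Theta>\<^sup>2 / \<theta> * \<tau> * ?t k"
      by (rule Caccioppoli_one_step[OF \<Omega> \<psi> F \<tau>0 W[OF k1(1)] W[OF k1(2)] W[OF k2(2)]
            difference_quotient_def difference_quotient_def eq[OF k1(3,2)] eq[OF k1(4) k2(2)] se])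
    then show ?thesis by (simp add: mult.assoc)
  qed
  have q: "?a (Suc k) - ?b k \<le> ?q k" if "1 \<le> k" "k \<le> N" for k
  proof -
    have "?a (Suc k) - ?b k = (LINT x|?M. (?e (Suc k) x)\<^sup>2 * ?P k x - (?e k x)\<^sup>2 * ?P k x)"
      using Bochner_Integration.integral_diff[OF integrable_continuous_mult[OF ce2[of "Suc k"] \<Omega>(2) iP[OF that(2)]]
          integrable_continuous_mult[OF ce2[of k] \<Omega>(2) iP[OF that(2)]]] by simp
    also have "\<dots> \<le> ?q k"
    proof (rule integral_mono)
      show "integrable ?M (\<lambda>x. (?e (Suc k) x)\<^sup>2 * ?P k x - (?e k x)\<^sup>2 * ?P k x)"
        by (intro Bochner_Integration.integrable_diff integrable_continuous_mult[OF ce2 \<Omega>(2) iP[OF that(2)]])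
      show "integrable ?M (\<lambda>x. \<bar>(?e (Suc k) x)\<^sup>2 - (?e k x)\<^sup>2\<bar> * ?P k x)"
        by (intro integrable_continuous_mult[OF _ \<Omega>(2) iP[OF that(2)]] continuous_intros ce)
      show "(?e (Suc k) x)\<^sup>2 * ?P k x - (?e k x)\<^sup>2 * ?P k x \<le> \<bar>(?e (Suc k) x)\<^sup>2 - (?e k x)\<^sup>2\<bar> * ?P k x" for x
        unfolding left_diff_distrib[symmetric]
        by (rule mult_right_mono[OF abs_ge_self dual_energy_bounds(1)[OF \<psi>(1) \<alpha>0 \<psi>(4)]])
    qed
    finally show ?thesis .
  qed
  have last: "0 \<le> ?a (Suc N)"
    using dual_energy_bounds(1)[OF \<psi>(1) \<alpha>0 \<psi>(4)] by (intro integral_nonneg_AE AE_I2 mult_nonneg_nonneg) auto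
  have "\<theta> / 2 * (\<Sum>k=1..N. \<tau> * ?S k) \<le> (\<Sum>k=1..N. (?a k - ?b k) + 2 * \<Theta>\<^sup>2 / \<theta> * \<tau> * ?t k)"
    unfolding sum_distrib_left by (rule sum_mono[OF step])
  also have "\<dots> = (\<Sum>k=1..N. ?a k - ?b k) + (\<Sum>k=1..N. 2 * \<Theta>\<^sup>2 / \<theta> * \<tau> * ?t k)"
    by (rule sum.distrib)
  also have "\<dots> \<le> (\<Sum>k=1..N. ?q k) + (\<Sum>k=1..N. 2 * \<Theta>\<^sup>2 / \<theta> * \<tau> * ?t k)"
    using summation_by_parts_le[of N ?a ?b ?q, OF q] last \<eta>(2) by simp
  also have "\<dots> = (\<Sum>k=1..N. ?q k + 2 * \<Theta>\<^sup>2 / \<theta> * \<tau> * ?t k)" by (rule sum.distrib[symmetric])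
  also have "\<dots> \<le> (\<Sum>k=1..N. \<tau> * (LINT x|?M.
        (A / 2 * (\<bar>(\<eta> (x, real k * \<tau>))\<^sup>2 - (?e k x)\<^sup>2\<bar> / \<tau>) + 2 * \<Theta>\<^sup>2 / \<theta> * (norm (space_grad \<eta> (x, real (k - 1) * \<tau>)))\<^sup>2)
        * (norm (?d k x))\<^sup>2))"
  proof (rule sum_mono)
    fix k assume "k \<in> {1..N}"
    then have k: "k \<le> N" by simp
    have cq: "continuous_on UNIV (\<lambda>x. \<tau> * (A / 2 * (\<bar>(?e (Suc k) x)\<^sup>2 - (?e k x)\<^sup>2\<bar> / \<tau>)
        + 2 * \<Theta>\<^sup>2 / \<theta> * (norm (nabla (?e k) x))\<^sup>2))"
      using \<tau>0 F(2) by (intro continuous_intros ce continuous_nabla se) auto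
    have i1: "integrable ?M (\<lambda>x. \<bar>(?e (Suc k) x)\<^sup>2 - (?e k x)\<^sup>2\<bar> * ?P k x)"
      by (intro integrable_continuous_mult[OF _ \<Omega>(2) iP[OF k]] continuous_intros ce)
    have "?q k + 2 * \<Theta>\<^sup>2 / \<theta> * \<tau> * ?t k
        = (LINT x|?M. \<bar>(?e (Suc k) x)\<^sup>2 - (?e k x)\<^sup>2\<bar> * ?P k x
            + 2 * \<Theta>\<^sup>2 / \<theta> * \<tau> * ((norm (nabla (?e k) x))\<^sup>2 * (norm (?d k x))\<^sup>2))"
      using i1 iN[OF k] by (subst Bochner_Integration.integral_add) simp_all
    also have "\<dots> \<le> (LINT x|?M. (\<tau> * (A / 2 * (\<bar>(?e (Suc k) x)\<^sup>2 - (?e k x)\<^sup>2\<bar> / \<tau>)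
        + 2 * \<Theta>\<^sup>2 / \<theta> * (norm (nabla (?e k) x))\<^sup>2)) * (norm (?d k x))\<^sup>2)"
    proof (rule integral_mono)
      show "integrable ?M (\<lambda>x. \<bar>(?e (Suc k) x)\<^sup>2 - (?e k x)\<^sup>2\<bar> * ?P k x
            + 2 * \<Theta>\<^sup>2 / \<theta> * \<tau> * ((norm (nabla (?e k) x))\<^sup>2 * (norm (?d k x))\<^sup>2))"
        by (intro Bochner_Integration.integrable_add integrable_mult_right i1 iN[OF k])
      show "integrable ?M (\<lambda>x. (\<tau> * (A / 2 * (\<bar>(?e (Suc k) x)\<^sup>2 - (?e k x)\<^sup>2\<bar> / \<tau>)
        + 2 * \<Theta>\<^sup>2 / \<theta> * (norm (nabla (?e k) x))\<^sup>2)) * (norm (?d k x))\<^sup>2)"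
        by (rule integrable_continuous_mult[OF cq \<Omega>(2) square_integrable_integrable[OF D[OF k]]])
      fix x
      have "\<bar>(?e (Suc k) x)\<^sup>2 - (?e k x)\<^sup>2\<bar> * ?P k x \<le> \<bar>(?e (Suc k) x)\<^sup>2 - (?e k x)\<^sup>2\<bar> * (A / 2 * (norm (?d k x))\<^sup>2)"
        by (rule mult_left_mono[OF dual_energy_bounds(2)[OF \<psi>(1) \<alpha>0 \<psi>(4)]]) simp
      then show "\<bar>(?e (Suc k) x)\<^sup>2 - (?e k x)\<^sup>2\<bar> * ?P k x
            + 2 * \<Theta>\<^sup>2 / \<theta> * \<tau> * ((norm (nabla (?e k) x))\<^sup>2 * (norm (?d k x))\<^sup>2)
          \<le> (\<tau> * (A / 2 * (\<bar>(?e (Suc k) x)\<^sup>2 - (?e k x)\<^sup>2\<bar> / \<tau>)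
        + 2 * \<Theta>\<^sup>2 / \<theta> * (norm (nabla (?e k) x))\<^sup>2)) * (norm (?d k x))\<^sup>2"
        using \<tau>0 by (simp add: algebra_simps)
    qed
    finally show "?q k + 2 * \<Theta>\<^sup>2 / \<theta> * \<tau> * ?t k \<le> \<tau> * (LINT x|?M.
        (A / 2 * (\<bar>(\<eta> (x, real k * \<tau>))\<^sup>2 - (?e k x)\<^sup>2\<bar> / \<tau>) + 2 * \<Theta>\<^sup>2 / \<theta> * (norm (space_grad \<eta> (x, real (k - 1) * \<tau>)))\<^sup>2)
        * (norm (?d k x))\<^sup>2)"
      by (simp add: mult.assoc nabla_slice[OF \<eta>(1)])
  qed
  finally show ?thesis .
qed

section \<open>Integration on the space-time cylinder\<close>

lemma borel_measurable_fst_snd: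
  "fst \<in> borel_measurable (borel :: ('a::euclidean_space \<times> 'b::euclidean_space) measure)"
  "snd \<in> borel_measurable (borel :: ('a::euclidean_space \<times> 'b::euclidean_space) measure)"
  by (intro borel_measurable_continuous_onI continuous_intros)+

text \<open>Preimages of null sets are null sets because their product with the second factor is one; this is
  what measurability with respect to the completed measures asks for beyond Borel measurability.\<close>

lemma measurable_fst_lebesgue:
  "fst \<in> measurable (lebesgue :: ('a::euclidean_space \<times> 'b::euclidean_space) measure) (lebesgue :: 'a measure)"
proof (rule complete_measure.measurable_completion2)
  show "complete_measure (lebesgue :: ('a \<times> 'b) measure)" by (rule completion.complete_measure_axioms)
  show m: "fst \<in> measurable (lebesgue :: ('a \<times> 'b) measure) (lborel :: 'a measure)"
    by (intro measurable_completion) (simp add: borel_measurable_fst_snd)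
  show "null_sets (lborel :: 'a measure) \<subseteq> null_sets (distr (lebesgue :: ('a \<times> 'b) measure) lborel fst)"
  proof
    fix N :: "'a set" assume N: "N \<in> null_sets lborel"
    then have Nb: "N \<in> sets lborel" "emeasure lborel N = 0" by auto
    have "emeasure (lborel :: ('a \<times> 'b) measure) (N \<times> UNIV) = emeasure lborel N * emeasure lborel (UNIV :: 'b set)"
      using Nb by (subst lborel_prod[symmetric]) (intro lborel.emeasure_pair_measure_Times; simp)
    then have "emeasure (lborel :: ('a \<times> 'b) measure) (N \<times> UNIV) = 0" using Nb by simp
    moreover have "fst -` N \<inter> space (lebesgue :: ('a \<times> 'b) measure) = N \<times> UNIV" by auto
    moreover have "N \<times> (UNIV :: 'b set) \<in> sets lborel" using Nb by (simp add: borel_Times)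
    ultimately show "N \<in> null_sets (distr (lebesgue :: ('a \<times> 'b) measure) lborel fst)"
      using Nb m by (simp add: null_sets_def emeasure_distr emeasure_completion)
  qed
qed

lemma AE_null_superset:
  assumes "AE x in M. P x" "space M = UNIV"
  shows "\<exists>N. N \<in> null_sets M \<and> {x. \<not> P x} \<subseteq> N"
proof -
  obtain N where "{x \<in> space M. \<not> P x} \<subseteq> N" "emeasure M N = 0" "N \<in> sets M"
    using assms(1) by (rule AE_E)
  then have "N \<in> null_sets M \<and> {x. \<not> P x} \<subseteq> N" using assms(2) by (simp add: null_sets_def)
  then show ?thesis ..
qed

lemma lebesgue_measurable_ex_borel:
  fixes f :: "'a::euclidean_space \<Rightarrow> 'b::euclidean_space"
  assumes "f \<in> borel_measurable lebesgue"
  shows "\<exists>g\<in>borel_measurable borel. AE x in lborel. f x = g x"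
proof -
  have "\<exists>g\<in>borel_measurable lborel. AE x in lborel. f x \<bullet> b = g x" for b
    using assms by (intro completion_ex_borel_measurable_real) simp
  then obtain g where g: "\<And>b. g b \<in> borel_measurable borel" "\<And>b. AE x in lborel. f x \<bullet> b = g b x"
    by (metis measurable_lborel2)
  have "AE x in lborel. \<forall>b\<in>Basis. f x \<bullet> b = g b x"
    using g(2) by (subst AE_finite_all) auto
  then have "AE x in lborel. f x = (\<Sum>b\<in>Basis. g b x *\<^sub>R b)"
  proof eventually_elim
    case (elim x)
    have "f x = (\<Sum>b\<in>Basis. (f x \<bullet> b) *\<^sub>R b)" by (simp add: euclidean_representation)
    also have "\<dots> = (\<Sum>b\<in>Basis. g b x *\<^sub>R b)" using elim by (intro sum.cong) auto
    finally show ?case .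
  qed
  moreover have "(\<lambda>x. \<Sum>b\<in>Basis. g b x *\<^sub>R b) \<in> borel_measurable borel"
    using g(1) by (intro borel_measurable_sum borel_measurable_scaleR borel_measurable_const)
  ultimately show ?thesis by (rule bexI[of _ "\<lambda>x. \<Sum>b\<in>Basis. g b x *\<^sub>R b"])
qed

lemma integrable_lebesgue_iff_borel:
  fixes f g :: "'a::euclidean_space \<Rightarrow> 'b::euclidean_space"
  assumes "g \<in> borel_measurable borel" "AE x in lborel. f x = g x" "f \<in> borel_measurable lebesgue"
  shows "integrable lebesgue f \<longleftrightarrow> integrable lborel g" "integral\<^sup>L lebesgue f = integral\<^sup>L lborel g"
proof -
  have ae: "AE x in lebesgue. f x = g x" using assms(2) by (rule AE_completion)
  have gm: "g \<in> borel_measurable lebesgue" using assms(1) by (simp add: measurable_completion)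
  have "integrable lebesgue f \<longleftrightarrow> integrable lebesgue g"
    by (rule integrable_cong_AE[OF assms(3) gm ae])
  then show "integrable lebesgue f \<longleftrightarrow> integrable lborel g"
    using assms(1) by (simp add: integrable_completion)
  show "integral\<^sup>L lebesgue f = integral\<^sup>L lborel g"
    using integral_cong_AE[OF assms(3) gm ae] assms(1) by (simp add: integral_completion)
qed

text \<open>Lebesgue measure on a product is the completion of the product measure. Replacing \<open>h\<close> by a Borel
  version changes almost every slice only on a null set.\<close>

lemma Fubini_lebesgue:
  fixes h :: "'a::euclidean_space \<times> 'b::euclidean_space \<Rightarrow> 'c::euclidean_space"
  assumes h: "integrable lebesgue h"
  shows "(LINT t|lebesgue. LINT x|lebesgue. h (x, t)) = integral\<^sup>L lebesgue h"
proof -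
  have hm: "h \<in> borel_measurable lebesgue" using h by (rule borel_measurable_integrable)
  obtain k where k: "k \<in> borel_measurable borel" "AE p in lborel. h p = k p"
    using lebesgue_measurable_ex_borel[OF hm] by blast
  note eq = integrable_lebesgue_iff_borel[OF k hm]
  have ki: "integrable (lborel \<Otimes>\<^sub>M lborel) (\<lambda>(x, t). k (x, t))"
    using eq(1) h by (simp add: lborel_prod)
  obtain N where N: "N \<in> null_sets (lborel \<Otimes>\<^sub>M lborel)" "{p. h p \<noteq> k p} \<subseteq> N"
    using AE_null_superset[OF k(2)] unfolding lborel_prod by auto
  have Ns: "N \<in> sets (lborel \<Otimes>\<^sub>M lborel)" using N(1) by (rule null_setsD2)
  have "AE x in lborel. AE t in lborel. (x, t) \<notin> N"
    using lborel_pair.AE_pair[OF AE_not_in[OF N(1)]] by simp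
  moreover have "{p \<in> space (lborel \<Otimes>\<^sub>M lborel). (fst p, snd p) \<notin> N} \<in> sets (lborel \<Otimes>\<^sub>M lborel)"
  proof -
    have "{p \<in> space (lborel \<Otimes>\<^sub>M lborel). (fst p, snd p) \<notin> N} = space (lborel \<Otimes>\<^sub>M lborel) - N"
      by auto
    then show ?thesis using sets.compl_sets[OF Ns] by simp
  qed
  ultimately have "AE t in lborel. AE x in lborel. (x, t) \<notin> N"
    using lborel_pair.AE_commute[of "\<lambda>x t. (x, t) \<notin> N"] by blast
  then have "AE t in lborel. AE x in lborel. h (x, t) = k (x, t)"
    by eventually_elim (use N(2) in \<open>auto elim!: eventually_mono\<close>)
  then have ae: "AE t in lborel. (LINT x|lebesgue. h (x, t)) = (LINT x|lborel. k (x, t))"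
  proof eventually_elim
    case (elim t)
    have kb: "(\<lambda>x. k (x, t)) \<in> borel_measurable borel"
      by (rule measurable_compose[OF borel_measurable_continuous_onI k(1)]) (intro continuous_intros)
    have ae2: "AE x in lebesgue. k (x, t) = h (x, t)"
      using AE_completion[OF elim] by eventually_elim simp
    have "(\<lambda>x. h (x, t)) \<in> borel_measurable lebesgue"
      by (rule borel_measurable_AE[OF _ ae2]) (use kb in \<open>simp add: measurable_completion\<close>)
    then show ?case by (rule integrable_lebesgue_iff_borel(2)[OF kb elim])
  qed
  have kI: "(\<lambda>t. LINT x|lborel. k (x, t)) \<in> borel_measurable borel"
    using borel_measurable_integrable[OF lborel_pair.integrable_snd[OF ki]] by simp
  have ae': "AE t in lebesgue. (LINT x|lborel. k (x, t)) = (LINT x|lebesgue. h (x, t))"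
    using AE_completion[OF ae] by eventually_elim simp
  have "(\<lambda>t. LINT x|lebesgue. h (x, t)) \<in> borel_measurable lebesgue"
    by (rule borel_measurable_AE[OF _ ae']) (use kI in \<open>simp add: measurable_completion\<close>)
  then have "(LINT t|lebesgue. LINT x|lebesgue. h (x, t)) = (LINT t|lborel. LINT x|lborel. k (x, t))"
    by (rule integrable_lebesgue_iff_borel(2)[OF kI ae])
  also have "\<dots> = integral\<^sup>L lborel k"
    using lborel_pair.integral_snd[OF ki] by (simp add: lborel_prod)
  finally show ?thesis by (simp add: eq(2))
qed

lemma integrable_indicator_product:
  fixes f :: "'a::euclidean_space \<Rightarrow> 'c::euclidean_space" and J :: "real set"
  assumes f: "integrable lebesgue f" and J: "J \<in> sets borel" "emeasure lborel J < \<infinity>"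
  shows "integrable lebesgue (\<lambda>p. indicator J (snd p) *\<^sub>R f (fst p))"
    and "(LINT p|lebesgue. indicator J (snd p) *\<^sub>R f (fst p)) = measure lborel J *\<^sub>R integral\<^sup>L lebesgue f"
proof -
  have fm: "f \<in> borel_measurable lebesgue" using f by (rule borel_measurable_integrable)
  obtain k where k: "k \<in> borel_measurable borel" "AE x in lborel. f x = k x"
    using lebesgue_measurable_ex_borel[OF fm] by blast
  have kI: "integrable lborel k" using integrable_lebesgue_iff_borel(1)[OF k fm] f by simp
  have iJ: "integrable lborel (indicator J :: real \<Rightarrow> real)"
    using J by (intro integrable_real_indicator) auto
  have m: "(\<lambda>p. indicator J (snd p) *\<^sub>R k (fst p)) \<in> borel_measurable (borel :: ('a \<times> real) measure)"
  proof (rule borel_measurable_scaleR)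
    show "(\<lambda>p::'a \<times> real. indicator J (snd p) :: real) \<in> borel_measurable borel"
      by (rule measurable_compose[OF borel_measurable_fst_snd(2) borel_measurable_indicator[OF J(1)]])
    show "(\<lambda>p::'a \<times> real. k (fst p)) \<in> borel_measurable borel"
      by (rule measurable_compose[OF borel_measurable_fst_snd(1) k(1)])
  qed
  have int: "integrable (lborel \<Otimes>\<^sub>M lborel) (\<lambda>p::'a \<times> real. indicator J (snd p) *\<^sub>R k (fst p))"
  proof (rule lborel_pair.Fubini_integrable)
    show "(\<lambda>p::'a \<times> real. indicator J (snd p) *\<^sub>R k (fst p)) \<in> borel_measurable (lborel \<Otimes>\<^sub>M lborel)"
      unfolding lborel_prod using m by simp
    have "(\<lambda>x. LINT t|lborel. norm (indicator J (snd (x, t)) *\<^sub>R k (fst (x, t)))) = (\<lambda>x. measure lborel J * norm (k x))"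
      by simp
    then show "integrable lborel (\<lambda>x. LINT t|lborel. norm (indicator J (snd (x, t)) *\<^sub>R k (fst (x, t))))"
      using kI by simp
    show "AE x in lborel. integrable lborel (\<lambda>t. indicator J (snd (x, t)) *\<^sub>R k (fst (x, t)))"
      using iJ by simp
  qed
  have fmp: "(\<lambda>p::'a \<times> real. indicator J (snd p) *\<^sub>R f (fst p)) \<in> borel_measurable lebesgue"
  proof (rule borel_measurable_scaleR)
    have "(\<lambda>p::'a \<times> real. indicator J (snd p) :: real) \<in> borel_measurable borel"
      by (rule measurable_compose[OF borel_measurable_fst_snd(2) borel_measurable_indicator[OF J(1)]])
    then show "(\<lambda>p::'a \<times> real. indicator J (snd p) :: real) \<in> borel_measurable lebesgue"
      by (simp add: measurable_completion)
    show "(\<lambda>p::'a \<times> real. f (fst p)) \<in> borel_measurable lebesgue"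
      by (rule measurable_compose[OF measurable_fst_lebesgue fm])
  qed
  have "AE p in (lborel \<Otimes>\<^sub>M lborel :: ('a \<times> real) measure). f (fst p) = k (fst p)"
  proof -
    obtain L where L: "L \<in> null_sets (lborel :: 'a measure)" "{x. f x \<noteq> k x} \<subseteq> L"
      using AE_null_superset[OF k(2)] by auto
    have "L \<times> (UNIV :: real set) \<in> null_sets (lborel \<Otimes>\<^sub>M lborel)"
      using L(1) by (auto simp: null_sets_def lborel.emeasure_pair_measure_Times)
    then show ?thesis by (rule AE_I') (use L(2) in \<open>auto simp: space_pair_measure\<close>)
  qed
  then have aep: "AE p in (lborel :: ('a \<times> real) measure). indicator J (snd p) *\<^sub>R f (fst p) = indicator J (snd p) *\<^sub>R k (fst p)"
    unfolding lborel_prod by eventually_elim simp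
  note eq = integrable_lebesgue_iff_borel[OF m aep fmp]
  show ii: "integrable lebesgue (\<lambda>p::'a \<times> real. indicator J (snd p) *\<^sub>R f (fst p))"
    using eq(1) int by (simp add: lborel_prod)
  have "(LINT p|lebesgue. indicator J (snd p) *\<^sub>R f (fst p))
      = (LINT t|lebesgue. LINT x|lebesgue. indicator J (snd (x, t)) *\<^sub>R f (fst (x, t)))"
    by (rule Fubini_lebesgue[OF ii, symmetric])
  also have "\<dots> = (LINT t|lebesgue. indicator J t *\<^sub>R integral\<^sup>L lebesgue f)" by simp
  also have "\<dots> = (LINT t|lborel. indicator J t *\<^sub>R integral\<^sup>L lebesgue f)"
    using J(1) by (intro integral_completion) simp
  also have "\<dots> = measure lborel J *\<^sub>R integral\<^sup>L lebesgue f"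
    using iJ by (subst integral_scaleR_left) auto
  finally show "(LINT p|lebesgue. indicator J (snd p) *\<^sub>R f (fst p)) = measure lborel J *\<^sub>R integral\<^sup>L lebesgue f" .
qed

text \<open>By completeness \<open>f\<close> and \<open>g\<close> are measurable or not together, and in the second case both integrals
  are zero by convention.\<close>

lemma integral_lebesgue_cong_AE:
  fixes f g :: "'a::euclidean_space \<Rightarrow> 'b::euclidean_space"
  assumes "AE x in lebesgue. f x = g x"
  shows "integral\<^sup>L lebesgue f = integral\<^sup>L lebesgue g"
proof (cases "f \<in> borel_measurable lebesgue")
  case True
  then have "g \<in> borel_measurable lebesgue" using assms by (rule borel_measurable_AE)
  then show ?thesis using True assms by (intro integral_cong_AE)
next
  case False
  have "AE x in lebesgue. g x = f x" using assms by eventually_elim simp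
  then have "g \<notin> borel_measurable lebesgue" using False borel_measurable_AE by blast
  then have "\<not> integrable lebesgue f" "\<not> integrable lebesgue g"
    using False borel_measurable_integrable by blast+
  then show ?thesis by (simp add: not_integrable_integral_eq)
qed

lemma AE_snd_not_in_finite:
  assumes "finite S"
  shows "AE p in (lebesgue :: ('a::euclidean_space \<times> real) measure). snd p \<notin> S"
proof -
  have S: "S \<in> sets lborel" "emeasure lborel S = 0"
    using assms by (auto intro: finite_imp_null_set_lborel[THEN null_setsD1] borel_closed finite_imp_closed)
  have "emeasure (lborel \<Otimes>\<^sub>M lborel) ((UNIV :: 'a set) \<times> S) = 0"
    using S by (subst lborel.emeasure_pair_measure_Times) auto
  moreover have "(UNIV :: 'a set) \<times> S \<in> sets (lborel \<Otimes>\<^sub>M lborel)"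
    using S(1) by (intro pair_measureI) auto
  ultimately have "(UNIV :: 'a set) \<times> S \<in> null_sets (lborel :: ('a \<times> real) measure)"
    unfolding lborel_prod by (simp add: null_sets_def)
  then have "AE p in (lborel :: ('a \<times> real) measure). p \<notin> UNIV \<times> S" by (rule AE_not_in)
  then have "AE p in (lebesgue :: ('a \<times> real) measure). p \<notin> UNIV \<times> S" by (rule AE_completion)
  then show ?thesis by eventually_elim (auto simp: mem_Times_iff)
qed

lemma step_index_eq:
  assumes "0 < \<tau>" "\<tau> = T / real N" "1 \<le> k" "real (k - 1) * \<tau> < t" "t \<le> real k * \<tau>"
  shows "step_index T N t = k"
proof -
  have "real k - 1 < t / \<tau>" "t / \<tau> \<le> real k"
    using assms(1,3-5) by (simp_all add: pos_less_divide_eq pos_divide_le_eq of_nat_diff)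
  then have "\<lceil>t / \<tau>\<rceil> = int k" by (intro ceiling_unique) auto
  then show ?thesis by (simp add: step_index_def assms(2)[symmetric])
qed

lemma step_index_bounds:
  assumes "0 < T" "0 < N" "\<tau> = T / real N" "0 < t" "t \<le> T"
  shows "step_index T N t \<in> {1..N}" "real (step_index T N t - 1) * \<tau> < t" "t \<le> real (step_index T N t) * \<tau>"
proof -
  have \<tau>: "0 < \<tau>" using assms by simp
  define c where "c = \<lceil>t / \<tau>\<rceil>"
  have c: "of_int c - 1 < t / \<tau>" "t / \<tau> \<le> of_int c" by (simp_all add: c_def) linarith
  have "0 < t / \<tau>" using assms \<tau> by simp
  then have "0 < c" using c by linarith
  have "t / \<tau> \<le> real N" using assms \<tau> by (simp add: field_simps)
  then have "c \<le> int N" by (simp add: c_def ceiling_le_iff)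
  have k: "step_index T N t = nat c" by (simp add: step_index_def c_def assms(3)[symmetric])
  then show "step_index T N t \<in> {1..N}" using \<open>0 < c\<close> \<open>c \<le> int N\<close> by auto
  have "real (nat c - 1) = of_int c - 1" "real (nat c) = of_int c" using \<open>0 < c\<close> by (auto simp: of_nat_diff)
  then show "real (step_index T N t - 1) * \<tau> < t" "t \<le> real (step_index T N t) * \<tau>"
    using c \<tau> k by (simp_all add: pos_less_divide_eq pos_divide_le_eq)
qed

definition step_fun :: "real \<Rightarrow> nat \<Rightarrow> (nat \<Rightarrow> 'a \<Rightarrow> 'b) \<Rightarrow> 'a \<times> real \<Rightarrow> 'b" where
  "step_fun T N f p = f (step_index T N (snd p)) (fst p)"

text \<open>The final time is removed from the last interval, so that these intervals partition the open
  interval \<open>(0,T)\<close> exactly.\<close>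

definition step_interval :: "real \<Rightarrow> nat \<Rightarrow> nat \<Rightarrow> real set" where
  "step_interval T N k = {real (k - 1) * (T / real N) <.. real k * (T / real N)} \<inter> {0<..<T}"

lemma step_interval_measure:
  assumes "0 < T" "0 < N" "k \<in> {1..N}"
  shows "step_interval T N k \<in> sets borel" "emeasure lborel (step_interval T N k) = ennreal (T / real N)"
proof -
  let ?\<tau> = "T / real N"
  have \<tau>: "0 < ?\<tau>" using assms by simp
  show m: "step_interval T N k \<in> sets borel" by (simp add: step_interval_def)
  have k: "real k * ?\<tau> - real (k - 1) * ?\<tau> = ?\<tau>" "real (k - 1) * ?\<tau> \<le> real k * ?\<tau>"
  proof -
    have r: "real (k - 1) = real k - 1" using assms by (simp add: of_nat_diff)
    show "real k * ?\<tau> - real (k - 1) * ?\<tau> = ?\<tau>" unfolding r left_diff_distrib by simp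
    show "real (k - 1) * ?\<tau> \<le> real k * ?\<tau>" using \<tau> unfolding r by (intro mult_right_mono) auto
  qed
  have kT: "real k * ?\<tau> \<le> T" using assms by (simp add: field_simps)
  have "{real (k - 1) * ?\<tau> <..< real k * ?\<tau>} \<subseteq> step_interval T N k"
    unfolding step_interval_def
  proof
    fix t assume t: "t \<in> {real (k - 1) * ?\<tau> <..< real k * ?\<tau>}"
    have "0 \<le> real (k - 1) * ?\<tau>" using \<tau> by (intro mult_nonneg_nonneg) auto
    then show "t \<in> {real (k - 1) * ?\<tau> <.. real k * ?\<tau>} \<inter> {0<..<T}" using t kT by auto
  qed
  from emeasure_mono[OF this, of lborel] have "ennreal ?\<tau> \<le> emeasure lborel (step_interval T N k)"
    using m k by simp
  moreover have "step_interval T N k \<subseteq> {real (k - 1) * ?\<tau> <.. real k * ?\<tau>}"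
    by (auto simp: step_interval_def)
  from emeasure_mono[OF this, of lborel] have "emeasure lborel (step_interval T N k) \<le> ennreal ?\<tau>"
    using k by simp
  ultimately show "emeasure lborel (step_interval T N k) = ennreal ?\<tau>" by (rule antisym[rotated])
qed

lemma step_fun_eq_sum:
  fixes f :: "nat \<Rightarrow> 'a::euclidean_space \<Rightarrow> 'b::real_vector"
  assumes "0 < T" "0 < N"
  shows "indicator (\<Omega> \<times> {0<..<T}) p *\<^sub>R step_fun T N f p
    = (\<Sum>k=1..N. indicator (step_interval T N k) (snd p) *\<^sub>R (indicator \<Omega> (fst p) *\<^sub>R f k (fst p)))"
proof (cases "snd p \<in> {0<..<T}")
  case True
  let ?k = "step_index T N (snd p)"
  have k: "?k \<in> {1..N}" "real (?k - 1) * (T / real N) < snd p" "snd p \<le> real ?k * (T / real N)"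
    using step_index_bounds[OF assms refl, of "snd p"] True by auto
  have ind: "indicator (step_interval T N k) (snd p) = (if k = ?k then 1 else (0::real))" if "k \<in> {1..N}" for k
  proof (cases "k = ?k")
    case True
    then show ?thesis using k(2,3) \<open>snd p \<in> {0<..<T}\<close> by (simp add: step_interval_def)
  next
    case False
    have "snd p \<notin> step_interval T N k"
    proof
      assume "snd p \<in> step_interval T N k"
      then have "?k = k" using that assms by (intro step_index_eq[OF _ refl]) (auto simp: step_interval_def)
      then show False using False by simp
    qed
    then show ?thesis using False by simp
  qed
  have "(\<Sum>k=1..N. indicator (step_interval T N k) (snd p) *\<^sub>R (indicator \<Omega> (fst p) *\<^sub>R f k (fst p)))
      = (\<Sum>k=1..N. if k = ?k then indicator \<Omega> (fst p) *\<^sub>R f k (fst p) else 0)"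
    using ind by (intro sum.cong) auto
  also have "\<dots> = indicator \<Omega> (fst p) *\<^sub>R f ?k (fst p)" using k(1) by (subst sum.delta) auto
  also have "\<dots> = indicator (\<Omega> \<times> {0<..<T}) p *\<^sub>R step_fun T N f p"
    using True by (simp add: step_fun_def indicator_def mem_Times_iff)
  finally show ?thesis by simp
next
  case False
  then have "indicator (step_interval T N k) (snd p) = (0::real)" for k by (simp add: step_interval_def)
  moreover have "p \<notin> \<Omega> \<times> {0<..<T}" using False by (auto simp: mem_Times_iff)
  ultimately show ?thesis by simp
qed

lemma cylinder_open: "open \<Omega> \<Longrightarrow> open (\<Omega> \<times> {0<..<T::real})"
  by (intro open_Times) auto

lemma cylinder_sets: "open \<Omega> \<Longrightarrow> \<Omega> \<times> {0<..<T::real} \<in> sets lebesgue"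
  for \<Omega> :: "'a::euclidean_space set"
  using cylinder_open[of \<Omega> T] by simp

lemma measurable_step_fun:
  fixes f :: "nat \<Rightarrow> 'a::euclidean_space \<Rightarrow> 'b::euclidean_space"
  assumes "0 < T" "0 < N" and \<Omega>: "open \<Omega>" and f: "\<And>k. k \<in> {1..N} \<Longrightarrow> f k \<in> borel_measurable (lebesgue_on \<Omega>)"
  shows "step_fun T N f \<in> borel_measurable (lebesgue_on (\<Omega> \<times> {0<..<T}))"
proof -
  have "(\<lambda>p. indicator (\<Omega> \<times> {0<..<T}) p *\<^sub>R step_fun T N f p) \<in> borel_measurable lebesgue"
    unfolding step_fun_eq_sum[OF assms(1,2)]
  proof (rule borel_measurable_sum, rule borel_measurable_scaleR)
    fix k assume k: "k \<in> {1..N}"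
    have "(\<lambda>p::'a \<times> real. indicator (step_interval T N k) (snd p) :: real) \<in> borel_measurable borel"
      by (rule measurable_compose[OF borel_measurable_fst_snd(2) borel_measurable_indicator[OF step_interval_measure(1)[OF assms(1,2) k]]])
    then show "(\<lambda>p::'a \<times> real. indicator (step_interval T N k) (snd p) :: real) \<in> borel_measurable lebesgue"
      by (simp add: measurable_completion)
    have "(\<lambda>x. indicator \<Omega> x *\<^sub>R f k x) \<in> borel_measurable lebesgue"
      using f[OF k] \<Omega> by (subst (asm) borel_measurable_restrict_space_iff) auto
    from measurable_compose[OF measurable_fst_lebesgue this]
    show "(\<lambda>p::'a \<times> real. indicator \<Omega> (fst p) *\<^sub>R f k (fst p)) \<in> borel_measurable lebesgue" .
  qed
  then show ?thesis
    using cylinder_sets[OF \<Omega>] by (subst borel_measurable_restrict_space_iff) auto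
qed

lemma integral_step_fun:
  fixes f :: "nat \<Rightarrow> 'a::euclidean_space \<Rightarrow> 'b::euclidean_space"
  assumes "0 < T" "0 < N" and \<Omega>: "open \<Omega>" and f: "\<And>k. k \<in> {1..N} \<Longrightarrow> integrable (lebesgue_on \<Omega>) (f k)"
  shows "integrable (lebesgue_on (\<Omega> \<times> {0<..<T})) (step_fun T N f)"
    and "integral\<^sup>L (lebesgue_on (\<Omega> \<times> {0<..<T})) (step_fun T N f) = (\<Sum>k=1..N. (T / real N) *\<^sub>R integral\<^sup>L (lebesgue_on \<Omega>) (f k))"
proof -
  have fl: "integrable lebesgue (\<lambda>x. indicator \<Omega> x *\<^sub>R f k x)"
      "integral\<^sup>L lebesgue (\<lambda>x. indicator \<Omega> x *\<^sub>R f k x) = integral\<^sup>L (lebesgue_on \<Omega>) (f k)" if "k \<in> {1..N}" for k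
    using f[OF that] \<Omega> by (subst (asm) integrable_restrict_space; simp) (subst integral_restrict_space; simp add: \<Omega>)
  note J = step_interval_measure[OF assms(1,2)]
  have "emeasure lborel (step_interval T N k) < \<infinity>" if "k \<in> {1..N}" for k by (simp add: J(2)[OF that])
  note prod = integrable_indicator_product[OF fl(1) J(1) this]
  have "integrable lebesgue (\<lambda>p. indicator (\<Omega> \<times> {0<..<T}) p *\<^sub>R step_fun T N f p)"
    unfolding step_fun_eq_sum[OF assms(1,2)] by (rule Bochner_Integration.integrable_sum[OF prod(1)])
  then show "integrable (lebesgue_on (\<Omega> \<times> {0<..<T})) (step_fun T N f)"
    using cylinder_sets[OF \<Omega>] by (subst integrable_restrict_space) auto
  have "integral\<^sup>L (lebesgue_on (\<Omega> \<times> {0<..<T})) (step_fun T N f)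
      = (LINT p|lebesgue. indicator (\<Omega> \<times> {0<..<T}) p *\<^sub>R step_fun T N f p)"
    using cylinder_sets[OF \<Omega>] by (subst integral_restrict_space) auto
  also have "\<dots> = (\<Sum>k=1..N. LINT p|lebesgue. indicator (step_interval T N k) (snd p) *\<^sub>R (indicator \<Omega> (fst p) *\<^sub>R f k (fst p)))"
    unfolding step_fun_eq_sum[OF assms(1,2)] by (rule Bochner_Integration.integral_sum[OF prod(1)])
  also have "\<dots> = (\<Sum>k=1..N. (T / real N) *\<^sub>R integral\<^sup>L (lebesgue_on \<Omega>) (f k))"
  proof (rule sum.cong[OF refl])
    fix k assume k: "k \<in> {1..N}"
    have "measure lborel (step_interval T N k) = T / real N"
      using J(2)[OF k] assms by (simp add: measure_def)
    then show "(LINT p|lebesgue. indicator (step_interval T N k) (snd p) *\<^sub>R (indicator \<Omega> (fst p) *\<^sub>R f k (fst p)))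
        = (T / real N) *\<^sub>R integral\<^sup>L (lebesgue_on \<Omega>) (f k)"
      using prod(2)[OF k k k] fl(2)[OF k] by simp
  qed
  finally show "integral\<^sup>L (lebesgue_on (\<Omega> \<times> {0<..<T})) (step_fun T N f) = (\<Sum>k=1..N. (T / real N) *\<^sub>R integral\<^sup>L (lebesgue_on \<Omega>) (f k))" .
qed

lemma square_integrable_step_fun:
  fixes f :: "nat \<Rightarrow> 'a::euclidean_space \<Rightarrow> 'b::euclidean_space"
  assumes "0 < T" "0 < N" "open \<Omega>" "\<And>k. k \<in> {1..N} \<Longrightarrow> square_integrable (lebesgue_on \<Omega>) (f k)"
  shows "square_integrable (lebesgue_on (\<Omega> \<times> {0<..<T})) (step_fun T N f)"
proof -
  have "integrable (lebesgue_on (\<Omega> \<times> {0<..<T})) (step_fun T N (\<lambda>k x. (norm (f k x))\<^sup>2))"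
    by (intro integral_step_fun assms square_integrable_integrable)
  moreover have "step_fun T N (\<lambda>k x. (norm (f k x))\<^sup>2) = (\<lambda>p. (norm (step_fun T N f p))\<^sup>2)"
    by (simp add: step_fun_def fun_eq_iff)
  ultimately show ?thesis
    unfolding square_integrable_def
    using measurable_step_fun[OF assms(1-3), of f] square_integrable_measurable[OF assms(4)] by simp
qed

lemma cylinder_iterated_integral:
  fixes h :: "'a::euclidean_space \<times> real \<Rightarrow> 'b::euclidean_space"
  assumes \<Omega>: "open \<Omega>" and h: "integrable (lebesgue_on (\<Omega> \<times> {0<..<T})) h"
  shows "(LINT t|lebesgue_on {0..T}. LINT x|lebesgue_on \<Omega>. h (x, t)) = integral\<^sup>L (lebesgue_on (\<Omega> \<times> {0<..<T})) h"
proof -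
  have hl: "integrable lebesgue (\<lambda>p. indicator (\<Omega> \<times> {0<..<T}) p *\<^sub>R h p)"
    using h cylinder_sets[OF \<Omega>, of T] by (subst (asm) integrable_restrict_space) auto
  have "(LINT t|lebesgue_on {0..T}. LINT x|lebesgue_on \<Omega>. h (x, t))
      = (LINT t|lebesgue. indicator {0..T} t *\<^sub>R (LINT x|lebesgue. indicator \<Omega> x *\<^sub>R h (x, t)))"
    using \<Omega> by (simp add: integral_restrict_space)
  also have "\<dots> = (LINT t|lebesgue. LINT x|lebesgue. indicator (\<Omega> \<times> {0<..<T}) (x, t) *\<^sub>R h (x, t))"
  proof (rule integral_lebesgue_cong_AE)
    have "AE t in lborel. t \<notin> {0, T}"
      by (rule AE_not_in[OF finite_imp_null_set_lborel]) simp
    then have "AE t in lebesgue. t \<notin> {0, T}" by (rule AE_completion)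
    then show "AE t in lebesgue. indicator {0..T} t *\<^sub>R (LINT x|lebesgue. indicator \<Omega> x *\<^sub>R h (x, t))
        = (LINT x|lebesgue. indicator (\<Omega> \<times> {0<..<T}) (x, t) *\<^sub>R h (x, t))"
    proof eventually_elim
      case (elim t)
      then have "indicator (\<Omega> \<times> {0<..<T}) (x, t) *\<^sub>R h (x, t) = (indicator {0..T} t :: real) *\<^sub>R (indicator \<Omega> x *\<^sub>R h (x, t))" for x
        by (auto simp: indicator_def)
      then show ?case by (simp only: integral_scaleR_right)
    qed
  qed
  also have "\<dots> = (LINT p|lebesgue. indicator (\<Omega> \<times> {0<..<T}) p *\<^sub>R h p)"
    by (rule Fubini_lebesgue[OF hl])
  also have "\<dots> = integral\<^sup>L (lebesgue_on (\<Omega> \<times> {0<..<T})) h"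
    using cylinder_sets[OF \<Omega>, of T] by (subst integral_restrict_space) auto
  finally show ?thesis .
qed

lemma test_function_slice:
  fixes \<phi> :: "'a::euclidean_space \<times> real \<Rightarrow> real"
  assumes "test_function (\<Omega> \<times> I) \<phi>"
  shows "test_function \<Omega> (\<lambda>x. \<phi> (x, t))"
proof -
  obtain K where K: "compact K" "K \<subseteq> \<Omega> \<times> I" "smooth_on \<phi> UNIV" "\<forall>p. p \<notin> K \<longrightarrow> \<phi> p = 0"
    using test_functionD[OF assms] by blast
  show ?thesis
  proof (rule test_functionI)
    show "smooth_on (\<lambda>x. \<phi> (x, t)) UNIV" by (rule smooth_on_slice[OF K(3)])
    show "compact (fst ` (K \<inter> (UNIV \<times> {t})))"
      by (intro compact_continuous_image continuous_on_fst continuous_on_id compact_Int_closed K(1) closed_Times) auto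
    show "fst ` (K \<inter> (UNIV \<times> {t})) \<subseteq> \<Omega>" using K(2) by auto
    show "\<phi> (x, t) = 0" if "x \<notin> fst ` (K \<inter> (UNIV \<times> {t}))" for x
    proof -
      have "(x, t) \<notin> K" using that by force
      then show ?thesis using K(4) by blast
    qed
  qed
qed

lemma bounded_cylinder: "bounded \<Omega> \<Longrightarrow> bounded (\<Omega> \<times> {0<..<T::real})"
  by (intro bounded_Times) auto

lemma square_integrable_column:
  fixes G :: "'a \<Rightarrow> real ^ 'n ^ 'm"
  assumes "square_integrable M G"
  shows "square_integrable M (\<lambda>x. column j (G x))" "sq_norm M (\<lambda>x. column j (G x)) \<le> sq_norm M G"
proof -
  have m: "(\<lambda>x. column j (G x)) \<in> borel_measurable M"
    by (rule measurable_continuous_compose[OF _ square_integrable_measurable[OF assms]])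
       (auto simp: column_def intro!: continuous_intros)
  have "norm (column j A) \<le> 1 * norm A" for A :: "real ^ 'n ^ 'm"
    unfolding norm_vec_def[of "column j A"] norm_vec_def[of A]
    by (auto simp: column_def component_le_norm_cart intro!: L2_set_mono)
  then have le: "AE x in M. norm (column j (G x)) \<le> 1 * norm (G x)" by (intro AE_I2)
  show "square_integrable M (\<lambda>x. column j (G x))" "sq_norm M (\<lambda>x. column j (G x)) \<le> sq_norm M G"
    using square_integrable_bound[OF assms m le] by simp_all
qed

text \<open>Differentiation in space acts on each time slice separately.\<close>

lemma step_fun_weak_space_derivative:
  fixes u :: "nat \<Rightarrow> real ^ 'n \<Rightarrow> real ^ 'm" and \<phi> :: "(real ^ 'n) \<times> real \<Rightarrow> real"
  assumes T: "0 < T" "0 < N" and \<Omega>: "open \<Omega>" "bounded \<Omega>"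
    and u: "\<And>k. k \<in> {1..N} \<Longrightarrow> square_integrable (lebesgue_on \<Omega>) (u k)"
    and G: "\<And>k. k \<in> {1..N} \<Longrightarrow> square_integrable (lebesgue_on \<Omega>) (G k)"
    and wg: "\<And>k. k \<in> {1..N} \<Longrightarrow> has_weak_grad \<Omega> (u k) (G k)"
    and \<phi>: "test_function (\<Omega> \<times> {0<..<T}) \<phi>"
  shows "(LINT p|lebesgue_on (\<Omega> \<times> {0<..<T}). frechet_derivative \<phi> (at p) (axis j 1, 0) *\<^sub>R step_fun T N u p)
    = - (LINT p|lebesgue_on (\<Omega> \<times> {0<..<T}). \<phi> p *\<^sub>R column j (step_fun T N G p))"
proof -
  let ?M = "lebesgue_on (\<Omega> \<times> {0<..<T})"
  let ?\<phi>' = "\<lambda>p. frechet_derivative \<phi> (at p) (axis j 1, 0)"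
  obtain K where K: "compact K" "K \<subseteq> \<Omega> \<times> {0<..<T}" "smooth_on \<phi> UNIV"
    "\<forall>p. p \<notin> K \<longrightarrow> \<phi> p = 0 \<and> (\<forall>e. frechet_derivative \<phi> (at p) e = 0)"
    using test_functionD[OF \<phi>] by blast
  have c\<phi>: "square_integrable ?M \<phi>" "square_integrable ?M ?\<phi>'"
    by (intro square_integrable_continuous smooth_on_continuous smooth_on_frechet_derivative K(3)
        cylinder_open bounded_cylinder \<Omega>)+
  have su: "square_integrable ?M (step_fun T N u)"
    by (rule square_integrable_step_fun[OF T \<Omega>(1) u])
  have "square_integrable ?M (step_fun T N (\<lambda>k x. column j (G k x)))"
    by (rule square_integrable_step_fun[OF T \<Omega>(1) square_integrable_column(1)[OF G]])
  moreover have "step_fun T N (\<lambda>k x. column j (G k x)) = (\<lambda>p. column j (step_fun T N G p))"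
    by (simp add: step_fun_def fun_eq_iff)
  ultimately have sG: "square_integrable ?M (\<lambda>p. column j (step_fun T N G p))" by simp
  have "(LINT p|?M. ?\<phi>' p *\<^sub>R step_fun T N u p)
      = (LINT t|lebesgue_on {0..T}. LINT x|lebesgue_on \<Omega>. ?\<phi>' (x, t) *\<^sub>R step_fun T N u (x, t))"
    by (rule cylinder_iterated_integral[OF \<Omega>(1) integrable_scaleR_product[OF c\<phi>(2) su], symmetric])
  also have "\<dots> = (LINT t|lebesgue_on {0..T}. - (LINT x|lebesgue_on \<Omega>. \<phi> (x, t) *\<^sub>R column j (step_fun T N G (x, t))))"
  proof (rule Bochner_Integration.integral_cong[OF refl])
    fix t
    show "(LINT x|lebesgue_on \<Omega>. ?\<phi>' (x, t) *\<^sub>R step_fun T N u (x, t))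
        = - (LINT x|lebesgue_on \<Omega>. \<phi> (x, t) *\<^sub>R column j (step_fun T N G (x, t)))"
    proof (cases "t \<in> {0<..<T}")
      case True
      then have k: "step_index T N t \<in> {1..N}" using step_index_bounds(1)[OF T refl] by simp
      have "has_weak_deriv \<Omega> (axis j 1) (u (step_index T N t)) (\<lambda>x. column j (G (step_index T N t) x))"
        using wg[OF k] by (simp add: has_weak_grad_def)
      then have "test_function \<Omega> (\<lambda>x. \<phi> (x, t)) \<longrightarrow>
          (LINT x|lebesgue_on \<Omega>. frechet_derivative (\<lambda>x. \<phi> (x, t)) (at x) (axis j 1) *\<^sub>R u (step_index T N t) x)
          = - (LINT x|lebesgue_on \<Omega>. \<phi> (x, t) *\<^sub>R column j (G (step_index T N t) x))"
        unfolding has_weak_deriv_def by (elim conjE) (erule spec[of _ "\<lambda>x. \<phi> (x, t)"])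
      with test_function_slice[OF \<phi>, of t] show ?thesis
        by (simp add: step_fun_def frechet_derivative_slice[OF K(3)])
    next
      case False
      then have "(x, t) \<notin> K" for x using K(2) by auto
      then show ?thesis using K(4) by simp
    qed
  qed
  also have "\<dots> = - (LINT t|lebesgue_on {0..T}. LINT x|lebesgue_on \<Omega>. \<phi> (x, t) *\<^sub>R column j (step_fun T N G (x, t)))"
    by (rule integral_minus)
  also have "\<dots> = - (LINT p|?M. \<phi> p *\<^sub>R column j (step_fun T N G p))"
    by (simp only: cylinder_iterated_integral[OF \<Omega>(1) integrable_scaleR_product[OF c\<phi>(1) sG]])
  finally show ?thesis .
qed

lemma vector_derivative_linear_interp:
  assumes "0 < T" "0 < N" "\<tau> = T / real N" "1 \<le> k" "real (k - 1) * \<tau> < t" "t < real k * \<tau>"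
  shows "vector_derivative (\<lambda>s. linear_interp T N V (x, s)) (at t) = difference_quotient \<tau> V k x"
proof -
  have \<tau>: "0 < \<tau>" using assms by simp
  have "((\<lambda>s. V (k - 1) x + ((s - real (k - 1) * \<tau>) / \<tau>) *\<^sub>R (V k x - V (k - 1) x)) has_vector_derivative
      (1 / \<tau>) *\<^sub>R (V k x - V (k - 1) x)) (at t)"
    using \<tau> by (auto intro!: derivative_eq_intros)
  then have "((\<lambda>s. linear_interp T N V (x, s)) has_vector_derivative (1 / \<tau>) *\<^sub>R (V k x - V (k - 1) x)) (at t)"
  proof (rule has_vector_derivative_transform_within_open)
    show "open {real (k - 1) * \<tau> <..< real k * \<tau>}" by simp
    show "t \<in> {real (k - 1) * \<tau> <..< real k * \<tau>}" using assms by simp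
    fix s assume "s \<in> {real (k - 1) * \<tau> <..< real k * \<tau>}"
    then have "step_index T N s = k" using step_index_eq[OF \<tau> assms(3,4)] by simp
    then show "V (k - 1) x + ((s - real (k - 1) * \<tau>) / \<tau>) *\<^sub>R (V k x - V (k - 1) x) = linear_interp T N V (x, s)"
      by (simp add: linear_interp_def Let_def assms(3))
  qed
  then show ?thesis
    by (simp add: vector_derivative_at difference_quotient_def inverse_eq_divide)
qed

text \<open>The derivative of the linear interpolation is the difference quotient off the grid points, which form
  a null set in time.\<close>

lemma L2_norm_time_derivative:
  fixes V :: "nat \<Rightarrow> 'a::euclidean_space \<Rightarrow> 'b::euclidean_space"
  assumes T: "0 < T" "0 < N" and \<Omega>: "open \<Omega>"
  shows "(L2_norm_on (\<Omega> \<times> {0..T}) (\<lambda>(x, t). vector_derivative (\<lambda>s. linear_interp T N V (x, s)) (at t) - vt (x, t)))\<^sup>2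
    = sq_norm (lebesgue_on (\<Omega> \<times> {0<..<T})) (\<lambda>p. step_fun T N (difference_quotient (T / real N) V) p - vt p)"
proof -
  let ?\<tau> = "T / real N"
  let ?f = "\<lambda>(x, t). vector_derivative (\<lambda>s. linear_interp T N V (x, s)) (at t) - vt (x, t)"
  let ?g = "\<lambda>p. step_fun T N (difference_quotient ?\<tau> V) p - vt p"
  have "\<Omega> \<in> sets borel" using \<Omega> by simp
  then have "\<Omega> \<times> {0..T} \<in> sets (borel :: ('a \<times> real) measure)" by (intro borel_Times) auto
  then have c: "\<Omega> \<times> {0..T} \<in> sets (lebesgue :: ('a \<times> real) measure)" by simp
  have "(L2_norm_on (\<Omega> \<times> {0..T}) ?f)\<^sup>2 = sq_norm (lebesgue_on (\<Omega> \<times> {0..T})) ?f"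
    by (simp add: L2_norm_on_def)
  also have "\<dots> = (LINT p|lebesgue. indicator (\<Omega> \<times> {0..T}) p *\<^sub>R (norm (?f p))\<^sup>2)"
    using c by (subst integral_restrict_space) auto
  also have "\<dots> = (LINT p|lebesgue. indicator (\<Omega> \<times> {0<..<T}) p *\<^sub>R (norm (?g p))\<^sup>2)"
  proof (rule integral_lebesgue_cong_AE)
    have "AE p in (lebesgue :: ('a \<times> real) measure). snd p \<notin> (\<lambda>k. real k * ?\<tau>) ` {0..N}"
      by (rule AE_snd_not_in_finite) simp
    then show "AE p in lebesgue. indicator (\<Omega> \<times> {0..T}) p *\<^sub>R (norm (?f p))\<^sup>2
        = indicator (\<Omega> \<times> {0<..<T}) p *\<^sub>R (norm (?g p))\<^sup>2"
    proof eventually_elim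
      case (elim p)
      obtain x t where p: "p = (x, t)" by fastforce
      have grid: "t \<noteq> real k * ?\<tau>" if "k \<le> N" for k using elim that p by auto
      have "t \<noteq> 0" "t \<noteq> T" using grid[of 0] grid[of N] T by auto
      show ?case
      proof (cases "t \<in> {0<..<T}")
        case True
        let ?k = "step_index T N t"
        have k: "?k \<in> {1..N}" "real (?k - 1) * ?\<tau> < t" "t \<le> real ?k * ?\<tau>"
          using step_index_bounds[OF T refl, of t] True by auto
        have "t < real ?k * ?\<tau>" using k grid[of ?k] by force
        from vector_derivative_linear_interp[OF T refl _ k(2) this, of V x] k(1)
        have "?f p = ?g p" by (simp add: p step_fun_def)
        then show ?thesis using True by (simp add: p indicator_def)
      next
        case False
        then show ?thesis using \<open>t \<noteq> 0\<close> \<open>t \<noteq> T\<close> by (auto simp: p indicator_def)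
      qed
    qed
  qed
  also have "\<dots> = sq_norm (lebesgue_on (\<Omega> \<times> {0<..<T})) ?g"
    using cylinder_sets[OF \<Omega>, of T] by (subst integral_restrict_space) auto
  finally show ?thesis .
qed

section \<open>Passage to the limit\<close>

lemma weighted_sum_le:
  fixes a :: "nat \<Rightarrow> real"
  assumes "convex_weights n c" "\<And>m. n \<le> m \<Longrightarrow> a m \<le> e"
  shows "weighted_sum a c \<le> e"
proof -
  have "weighted_sum a c \<le> (\<Sum>m | c m \<noteq> 0. c m * e)"
    unfolding weighted_sum_def real_scaleR_def
  proof (rule sum_mono)
    fix m assume "m \<in> {m. c m \<noteq> 0}"
    then have "n \<le> m" using assms(1) by (auto simp: convex_weights_def not_less[symmetric])
    then show "c m * a m \<le> c m * e"
      using assms by (intro mult_left_mono) (auto simp: convex_weights_def)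
  qed
  also have "\<dots> = e" using assms(1) by (simp add: convex_weights_def flip: sum_distrib_right)
  finally show ?thesis .
qed

lemma weighted_sum_cong:
  assumes "convex_weights n c" "\<And>m. n \<le> m \<Longrightarrow> y m = z m"
  shows "weighted_sum y c = weighted_sum z c"
  unfolding weighted_sum_def
proof (rule sum.cong[OF refl])
  fix m assume "m \<in> {m. c m \<noteq> 0}"
  then have "n \<le> m" using assms(1) by (auto simp: convex_weights_def not_less[symmetric])
  then show "c m *\<^sub>R y m = c m *\<^sub>R z m" using assms(2) by simp
qed

lemma weighted_sum_diff_const:
  fixes y :: "nat \<Rightarrow> 'b::real_vector"
  assumes "convex_weights n c"
  shows "weighted_sum (\<lambda>m. y m - z) c = weighted_sum y c - z"
proof -
  have "(\<Sum>m | c m \<noteq> 0. c m *\<^sub>R z) = z"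
    using assms by (simp add: convex_weights_def flip: scaleR_sum_left)
  then show ?thesis by (simp add: weighted_sum_def scaleR_diff_right sum_subtractf)
qed

lemma linear_weighted_sum:
  "linear L \<Longrightarrow> L (weighted_sum y c) = weighted_sum (\<lambda>m. L (y m)) c"
  by (simp add: weighted_sum_def linear_sum linear_scale)

lemma weighted_sum_integral:
  fixes g :: "nat \<Rightarrow> 'a \<Rightarrow> 'b::euclidean_space"
  assumes "\<And>m. integrable M (g m)"
  shows "(LINT x|M. weighted_sum (\<lambda>m. g m x) c) = weighted_sum (\<lambda>m. integral\<^sup>L M (g m)) c"
  unfolding weighted_sum_def using assms by (subst Bochner_Integration.integral_sum) auto

lemma square_integrable_weighted_sum:
  fixes f :: "nat \<Rightarrow> 'a \<Rightarrow> 'b::euclidean_space"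
  assumes "\<And>m. square_integrable M (f m)"
  shows "square_integrable M (\<lambda>x. weighted_sum (\<lambda>m. f m x) c)"
  unfolding weighted_sum_def by (intro square_integrable_sum square_integrable_scaleR assms)

lemma sq_norm_weighted_sum_le:
  fixes f :: "nat \<Rightarrow> 'a \<Rightarrow> 'b::euclidean_space"
  assumes c: "convex_weights n c" and f: "\<And>m. square_integrable M (f m)"
  shows "sq_norm M (\<lambda>x. weighted_sum (\<lambda>m. f m x) c) \<le> weighted_sum (\<lambda>m. sq_norm M (f m)) c"
proof -
  have "sq_norm M (\<lambda>x. weighted_sum (\<lambda>m. f m x) c) \<le> (LINT x|M. weighted_sum (\<lambda>m. (norm (f m x))\<^sup>2) c)"
  proof (rule integral_mono)
    show "integrable M (\<lambda>x. (norm (weighted_sum (\<lambda>m. f m x) c))\<^sup>2)"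
      by (rule square_integrable_integrable[OF square_integrable_weighted_sum[OF f]])
    show "integrable M (\<lambda>x. weighted_sum (\<lambda>m. (norm (f m x))\<^sup>2) c)"
      unfolding weighted_sum_def real_scaleR_def
      by (intro Bochner_Integration.integrable_sum integrable_mult_right square_integrable_integrable f)
  qed (rule norm_weighted_sum_square_le[OF c])
  also have "\<dots> = weighted_sum (\<lambda>m. sq_norm M (f m)) c"
    by (rule weighted_sum_integral[OF square_integrable_integrable[OF f]])
  finally show ?thesis .
qed

lemma uniformly_continuous_in_time:
  fixes \<omega> :: "'a::euclidean_space \<times> real \<Rightarrow> real"
  assumes "continuous_on UNIV \<omega>" "bounded \<Omega>" "0 < \<delta>"
  shows "\<exists>r>0. \<forall>x\<in>\<Omega>. \<forall>s\<in>{0..T}. \<forall>t\<in>{0..T}. \<bar>s - t\<bar> < r \<longrightarrow> \<bar>\<omega> (x, s) - \<omega> (x, t)\<bar> < \<delta>"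
proof -
  have "compact (closure \<Omega> \<times> {0..T})"
    using assms(2) by (intro compact_Times) (auto simp: compact_closure)
  then have "uniformly_continuous_on (closure \<Omega> \<times> {0..T}) \<omega>"
    by (intro compact_uniformly_continuous continuous_on_subset[OF assms(1)]) auto
  then obtain r where r: "0 < r" "\<forall>p\<in>closure \<Omega> \<times> {0..T}. \<forall>q\<in>closure \<Omega> \<times> {0..T}. dist q p < r \<longrightarrow> dist (\<omega> q) (\<omega> p) < \<delta>"
    unfolding uniformly_continuous_on_def using assms(3) by blast
  show ?thesis
  proof (intro exI[of _ r] conjI ballI impI)
    fix x s t assume "x \<in> \<Omega>" "s \<in> {0..T}" "t \<in> {0..T}" "\<bar>s - t\<bar> < r"
    moreover then have "x \<in> closure \<Omega>" using closure_subset by blast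
    ultimately have "dist (\<omega> (x, s)) (\<omega> (x, t)) < \<delta>"
      using r(2)[rule_format, of "(x, t)" "(x, s)"] by (simp add: dist_Pair_Pair dist_real_def)
    then show "\<bar>\<omega> (x, s) - \<omega> (x, t)\<bar> < \<delta>" by (simp add: dist_real_def)
  qed (rule r(1))
qed

lemma continuous_space_grad:
  "smooth_on \<eta> UNIV \<Longrightarrow> continuous_on UNIV (space_grad \<eta>)"
  unfolding space_grad_def
  by (intro continuous_intros smooth_on_continuous smooth_on_frechet_derivative)

lemma continuous_time_deriv:
  "smooth_on \<eta> UNIV \<Longrightarrow> continuous_on UNIV (time_deriv \<eta>)"
  unfolding time_deriv_def
  by (intro smooth_on_continuous smooth_on_frechet_derivative)

lemma time_deriv_has_derivative:
  fixes \<eta> :: "(real ^ 'n) \<times> real \<Rightarrow> real"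
  assumes "smooth_on \<eta> UNIV"
  shows "((\<lambda>s. \<eta> (x, s)) has_real_derivative time_deriv \<eta> (x, s)) (at s)"
proof -
  have "((\<lambda>s. (x, s)) has_derivative (\<lambda>e. (0, e))) (at s)"
    by (auto intro!: derivative_eq_intros)
  from has_derivative_compose[OF this smooth_on_has_derivative[OF assms]]
  have "((\<lambda>s. \<eta> (x, s)) has_derivative (\<lambda>e. frechet_derivative \<eta> (at (x, s)) (0, e))) (at s)" .
  moreover have "frechet_derivative \<eta> (at (x, s)) (0, e) = time_deriv \<eta> (x, s) * e" for e
    using linear_scale[OF has_derivative_linear[OF smooth_on_has_derivative[OF assms]], of "(x, s)" e "(0, 1)"]
    by (simp add: time_deriv_def)
  ultimately show ?thesis by (simp add: has_field_derivative_def)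
qed

text \<open>The weight of \<open>|v\<^sub>t|\<^sup>2\<close> in the limit: \<open>a |\<eta> \<eta>\<^sub>t|\<close> is the limit of \<open>a / 2\<close> times the modulus of the
  difference quotients of \<open>\<eta>\<^sup>2\<close>.\<close>

definition limit_coeff :: "real \<Rightarrow> real \<Rightarrow> ((real ^ 'n) \<times> real \<Rightarrow> real) \<Rightarrow> (real ^ 'n) \<times> real \<Rightarrow> real" where
  "limit_coeff a b \<eta> p = a * (\<bar>\<eta> p\<bar> * \<bar>time_deriv \<eta> p\<bar>) + b * (norm (space_grad \<eta> p))\<^sup>2"

text \<open>By the mean value theorem the difference quotient of \<open>\<eta>\<^sup>2\<close> equals \<open>2 \<eta> \<eta>\<^sub>t\<close> at an intermediate time, and all
  functions involved are uniformly continuous in time on the closed cylinder.\<close>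

lemma discrete_coeff_le:
  fixes \<eta> :: "(real ^ 'n) \<times> real \<Rightarrow> real"
  assumes \<eta>: "smooth_on \<eta> UNIV" and \<Omega>: "bounded \<Omega>" and ab: "0 \<le> a" "0 \<le> b" and \<delta>: "0 < \<delta>"
  shows "\<exists>r>0. \<forall>\<tau> k x t. 0 < \<tau> \<and> \<tau> < r \<and> 1 \<le> k \<and> real k * \<tau> \<le> T \<and> x \<in> \<Omega> \<and> real (k - 1) * \<tau> < t \<and> t \<le> real k * \<tau>
    \<longrightarrow> a / 2 * (\<bar>(\<eta> (x, real k * \<tau>))\<^sup>2 - (\<eta> (x, real (k - 1) * \<tau>))\<^sup>2\<bar> / \<tau>)
        + b * (norm (space_grad \<eta> (x, real (k - 1) * \<tau>)))\<^sup>2 \<le> limit_coeff a b \<eta> (x, t) + \<delta>"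
proof -
  define \<delta>' where "\<delta>' = \<delta> / (a + b + 1)"
  have \<delta>': "0 < \<delta>'" "(a + b) * \<delta>' \<le> \<delta>"
    using \<delta> ab by (simp_all add: \<delta>'_def field_simps)
  have "continuous_on UNIV (\<lambda>p. \<bar>\<eta> p\<bar> * \<bar>time_deriv \<eta> p\<bar>)"
    by (intro continuous_intros smooth_on_continuous[OF \<eta>] continuous_time_deriv[OF \<eta>])
  from uniformly_continuous_in_time[OF this \<Omega> \<delta>'(1), of T]
  obtain r1 where r1: "0 < r1" "\<forall>x\<in>\<Omega>. \<forall>s\<in>{0..T}. \<forall>t\<in>{0..T}. \<bar>s - t\<bar> < r1 \<longrightarrow>
      \<bar>\<bar>\<eta> (x, s)\<bar> * \<bar>time_deriv \<eta> (x, s)\<bar> - \<bar>\<eta> (x, t)\<bar> * \<bar>time_deriv \<eta> (x, t)\<bar>\<bar> < \<delta>'" by blast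
  have "continuous_on UNIV (\<lambda>p. (norm (space_grad \<eta> p))\<^sup>2)"
    by (intro continuous_intros continuous_space_grad[OF \<eta>])
  from uniformly_continuous_in_time[OF this \<Omega> \<delta>'(1), of T]
  obtain r2 where r2: "0 < r2" "\<forall>x\<in>\<Omega>. \<forall>s\<in>{0..T}. \<forall>t\<in>{0..T}. \<bar>s - t\<bar> < r2 \<longrightarrow>
      \<bar>(norm (space_grad \<eta> (x, s)))\<^sup>2 - (norm (space_grad \<eta> (x, t)))\<^sup>2\<bar> < \<delta>'" by blast
  show ?thesis
  proof (intro exI[of _ "min r1 r2"] conjI allI impI)
    show "0 < min r1 r2" using r1 r2 by simp
    fix \<tau> k x t
    assume *: "0 < \<tau> \<and> \<tau> < min r1 r2 \<and> 1 \<le> k \<and> real k * \<tau> \<le> T \<and> x \<in> \<Omega> \<and> real (k - 1) * \<tau> < t \<and> t \<le> real k * \<tau>"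
    let ?s0 = "real (k - 1) * \<tau>" and ?s1 = "real k * \<tau>"
    have gap: "?s1 - ?s0 = \<tau>" using * by (simp add: of_nat_diff algebra_simps)
    have s0: "0 \<le> ?s0" using * by simp
    have lt: "?s0 < ?s1" using gap * by linarith
    have der: "((\<lambda>s. (\<eta> (x, s))\<^sup>2) has_real_derivative 2 * (\<eta> (x, s) * time_deriv \<eta> (x, s))) (at s)" for s
      by (auto intro!: derivative_eq_intros time_deriv_has_derivative[OF \<eta>])
    obtain \<xi> where \<xi>: "?s0 < \<xi>" "\<xi> < ?s1"
      "(\<eta> (x, ?s1))\<^sup>2 - (\<eta> (x, ?s0))\<^sup>2 = (?s1 - ?s0) * (2 * (\<eta> (x, \<xi>) * time_deriv \<eta> (x, \<xi>)))"
      using MVT2[OF lt, of "\<lambda>s. (\<eta> (x, s))\<^sup>2" "\<lambda>s. 2 * (\<eta> (x, s) * time_deriv \<eta> (x, s))"] der by blast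
    have e: "a / 2 * (\<bar>(\<eta> (x, ?s1))\<^sup>2 - (\<eta> (x, ?s0))\<^sup>2\<bar> / \<tau>) = a * (\<bar>\<eta> (x, \<xi>)\<bar> * \<bar>time_deriv \<eta> (x, \<xi>)\<bar>)"
      unfolding \<xi>(3) gap using * by (simp add: abs_mult)
    have t: "?s0 < t" "t \<le> ?s1" "?s1 \<le> T" "x \<in> \<Omega>" "\<tau> < r1" "\<tau> < r2" using * by auto
    have "0 \<le> \<xi>" "\<xi> \<le> T" "0 \<le> t" "t \<le> T" "?s0 \<le> T" using \<xi>(1,2) t s0 by linarith+
    then have in_T: "\<xi> \<in> {0..T}" "t \<in> {0..T}" "?s0 \<in> {0..T}" using s0 by simp_all
    have close: "\<bar>\<xi> - t\<bar> < r1" "\<bar>?s0 - t\<bar> < r2" using \<xi>(1,2) t gap by linarith+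
    have "\<bar>\<eta> (x, \<xi>)\<bar> * \<bar>time_deriv \<eta> (x, \<xi>)\<bar> \<le> \<bar>\<eta> (x, t)\<bar> * \<bar>time_deriv \<eta> (x, t)\<bar> + \<delta>'"
      and "(norm (space_grad \<eta> (x, ?s0)))\<^sup>2 \<le> (norm (space_grad \<eta> (x, t)))\<^sup>2 + \<delta>'"
      using r1(2)[rule_format, OF t(4) in_T(1,2) close(1)] r2(2)[rule_format, OF t(4) in_T(3,2) close(2)]
      by linarith+
    then have "a * (\<bar>\<eta> (x, \<xi>)\<bar> * \<bar>time_deriv \<eta> (x, \<xi>)\<bar>) + b * (norm (space_grad \<eta> (x, ?s0)))\<^sup>2
       \<le> a * (\<bar>\<eta> (x, t)\<bar> * \<bar>time_deriv \<eta> (x, t)\<bar> + \<delta>') + b * ((norm (space_grad \<eta> (x, t)))\<^sup>2 + \<delta>')"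
      using ab by (intro add_mono mult_left_mono)
    also have "\<dots> \<le> limit_coeff a b \<eta> (x, t) + \<delta>"
      using \<delta>'(2) by (simp add: limit_coeff_def algebra_simps)
    finally show "a / 2 * (\<bar>(\<eta> (x, ?s1))\<^sup>2 - (\<eta> (x, ?s0))\<^sup>2\<bar> / \<tau>) + b * (norm (space_grad \<eta> (x, ?s0)))\<^sup>2
        \<le> limit_coeff a b \<eta> (x, t) + \<delta>" unfolding e .
  qed
qed

text \<open>Convergence is stated for the step functions of the difference quotients, which agree almost
  everywhere with the time derivatives of the linear interpolations.\<close>

locale convergent_scheme =
  fixes \<Omega> :: "(real ^ 'n) set" and T \<alpha> A \<theta> \<Theta> :: real
    and \<psi> :: "real ^ 'm \<Rightarrow> real" and F :: "real ^ 'n ^ 'm \<Rightarrow> real" and g :: "real ^ 'n \<Rightarrow> real ^ 'm"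
    and N :: "nat \<Rightarrow> nat" and V :: "nat \<Rightarrow> nat \<Rightarrow> real ^ 'n \<Rightarrow> real ^ 'm"
    and vt :: "(real ^ 'n) \<times> real \<Rightarrow> real ^ 'm"
  assumes \<Omega>: "open \<Omega>" "bounded \<Omega>" and T: "0 < T"
    and \<psi>: "C2_hessian_bounds \<alpha> A \<psi>" "0 < \<alpha>" "0 < A" "\<psi> 0 = 0"
    and F: "C2_hessian_bounds \<theta> \<Theta> F" "0 < \<theta>" "0 < \<Theta>"
    and g: "W12_0 \<Omega> g"
    and N: "filterlim N at_top sequentially" "\<And>j. 0 < N j"
    and scheme: "\<And>j. implicit_scheme \<Omega> T \<psi> F g (N j) (V j)"
    and vt: "square_integrable (lebesgue_on (\<Omega> \<times> {0<..<T})) vt"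
    and conv: "(\<lambda>j. sq_norm (lebesgue_on (\<Omega> \<times> {0<..<T}))
        (\<lambda>p. step_fun T (N j) (difference_quotient (T / real (N j)) (V j)) p - vt p)) \<longlonglongrightarrow> 0"
begin

abbreviation "M \<equiv> lebesgue_on (\<Omega> \<times> {0<..<T})"

definition tau :: "nat \<Rightarrow> real" where "tau j = T / real (N j)"

definition quot :: "nat \<Rightarrow> (real ^ 'n) \<times> real \<Rightarrow> real ^ 'm" where
  "quot j = step_fun T (N j) (difference_quotient (tau j) (V j))"

definition quot_grad :: "nat \<Rightarrow> (real ^ 'n) \<times> real \<Rightarrow> real ^ 'n ^ 'm" where
  "quot_grad j = step_fun T (N j) (\<lambda>k. wgrad \<Omega> (difference_quotient (tau j) (V j) k))"

text \<open>The value of \<open>\<eta>\<close> at the left end of the current time step.\<close>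

definition left_value :: "((real ^ 'n) \<times> real \<Rightarrow> real) \<Rightarrow> nat \<Rightarrow> (real ^ 'n) \<times> real \<Rightarrow> real" where
  "left_value \<eta> j = step_fun T (N j) (\<lambda>k x. \<eta> (x, real (k - 1) * tau j))"

lemma tau_pos: "0 < tau j" using T N(2)[of j] by (simp add: tau_def)

lemma tau_tendsto: "tau \<longlonglongrightarrow> 0"
proof -
  have "filterlim (\<lambda>j. real (N j)) at_top sequentially"
    by (rule filterlim_compose[OF filterlim_real_sequentially N(1)])
  then show ?thesis unfolding tau_def by (rule real_tendsto_divide_at_top[OF tendsto_const])
qed

lemma eventually_tau_less: "0 < r \<Longrightarrow> \<forall>\<^sub>F j in sequentially. tau j < r"
  using order_tendstoD(2)[OF tau_tendsto] .

lemma index: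
  assumes "p \<in> \<Omega> \<times> {0<..<T}"
  shows "step_index T (N j) (snd p) \<in> {1..N j}" "real (step_index T (N j) (snd p) - 1) * tau j < snd p"
    "snd p \<le> real (step_index T (N j) (snd p)) * tau j"
  using step_index_bounds[OF T N(2)[of j] refl, of "snd p"] assms by (auto simp: tau_def mem_Times_iff)

lemma index_time_le: "k \<le> N j \<Longrightarrow> real k * tau j \<le> T"
  using T N(2)[of j] by (simp add: tau_def field_simps)

lemma W12_0_V: "k \<le> N j \<Longrightarrow> W12_0 \<Omega> (V j k)"
  using scheme[of j] g by (cases "k = 0") (auto simp: implicit_scheme_def)

lemma W12_0_quotient: "k \<in> {1..N j} \<Longrightarrow> W12_0 \<Omega> (difference_quotient (tau j) (V j) k)"
  using W12_0_V[of k j] W12_0_V[of "k - 1" j] by (intro W12_0_difference_quotient \<Omega>) auto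

lemma square_integrable_quot: "square_integrable M (quot j)"
  unfolding quot_def
  by (rule square_integrable_step_fun[OF T N(2) \<Omega>(1) W12_0D(1)[OF \<Omega> W12_0_quotient]])

lemma quot_tendsto: "(\<lambda>j. sq_norm M (\<lambda>p. quot j p - vt p)) \<longlonglongrightarrow> 0"
  using conv by (simp add: quot_def tau_def)

lemma integrable_bounded_coeff:
  fixes c f :: "(real ^ 'n) \<times> real \<Rightarrow> real"
  assumes "continuous_on UNIV c" "integrable M f"
  shows "integrable M (\<lambda>p. c p * f p)"
  using assms(1) bounded_cylinder[OF \<Omega>(2)] assms(2) by (rule integrable_continuous_mult)

lemma continuous_limit_coeff:
  "smooth_on \<eta> UNIV \<Longrightarrow> continuous_on UNIV (limit_coeff a b \<eta>)"
  unfolding limit_coeff_def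
  by (intro continuous_intros smooth_on_continuous continuous_time_deriv continuous_space_grad)

lemma integrable_left_value:
  assumes "smooth_on \<eta> UNIV"
  shows "integrable M (\<lambda>p. (left_value \<eta> j p)\<^sup>2 * (norm (quot_grad j p))\<^sup>2)"
proof -
  have "integrable M (step_fun T (N j) (\<lambda>k x. (\<eta> (x, real (k - 1) * tau j))\<^sup>2 *
      (norm (wgrad \<Omega> (difference_quotient (tau j) (V j) k) x))\<^sup>2))"
  proof (rule integral_step_fun(1)[OF T N(2) \<Omega>(1)])
    fix k assume k: "k \<in> {1..N j}"
    have "continuous_on UNIV (\<lambda>x. (\<eta> (x, real (k - 1) * tau j))\<^sup>2)"
      by (intro continuous_on_power smooth_on_continuous[OF smooth_on_slice[OF assms]])
    then show "integrable (lebesgue_on \<Omega>) (\<lambda>x. (\<eta> (x, real (k - 1) * tau j))\<^sup>2 *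
      (norm (wgrad \<Omega> (difference_quotient (tau j) (V j) k) x))\<^sup>2)"
      by (rule integrable_continuous_mult[OF _ \<Omega>(2) square_integrable_integrable[OF W12_0D(3)[OF \<Omega> W12_0_quotient[OF k]]]])
  qed
  then show ?thesis by (simp add: left_value_def quot_grad_def step_fun_def[abs_def])
qed

lemma Caccioppoli_cylinder:
  assumes \<eta>: "smooth_on \<eta> UNIV" "\<And>x. \<eta> (x, 0) = 0" and \<delta>: "0 < \<delta>"
  shows "\<forall>\<^sub>F j in sequentially. \<theta> / 2 * (LINT p|M. (left_value \<eta> j p)\<^sup>2 * (norm (quot_grad j p))\<^sup>2)
    \<le> (LINT p|M. (limit_coeff A (2 * \<Theta>\<^sup>2 / \<theta>) \<eta> p + \<delta>) * (norm (quot j p))\<^sup>2)"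
proof -
  let ?W = "limit_coeff A (2 * \<Theta>\<^sup>2 / \<theta>) \<eta>"
  have ab: "0 \<le> A" "0 \<le> 2 * \<Theta>\<^sup>2 / \<theta>" using \<psi>(3) F(2) by simp_all
  obtain r where r: "0 < r" "\<forall>\<tau> k x t. 0 < \<tau> \<and> \<tau> < r \<and> 1 \<le> k \<and> real k * \<tau> \<le> T \<and> x \<in> \<Omega> \<and> real (k - 1) * \<tau> < t \<and> t \<le> real k * \<tau>
    \<longrightarrow> A / 2 * (\<bar>(\<eta> (x, real k * \<tau>))\<^sup>2 - (\<eta> (x, real (k - 1) * \<tau>))\<^sup>2\<bar> / \<tau>)
        + 2 * \<Theta>\<^sup>2 / \<theta> * (norm (space_grad \<eta> (x, real (k - 1) * \<tau>)))\<^sup>2 \<le> ?W (x, t) + \<delta>"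
    using discrete_coeff_le[OF \<eta>(1) \<Omega>(2) ab \<delta>, of T] by blast
  show ?thesis
    using eventually_tau_less[OF r(1)]
  proof eventually_elim
    case (elim j)
    let ?d = "difference_quotient (tau j) (V j)"
    let ?S = "\<lambda>k x. (\<eta> (x, real (k - 1) * tau j))\<^sup>2 * (norm (wgrad \<Omega> (?d k) x))\<^sup>2"
    let ?c = "\<lambda>k x. A / 2 * (\<bar>(\<eta> (x, real k * tau j))\<^sup>2 - (\<eta> (x, real (k - 1) * tau j))\<^sup>2\<bar> / tau j)
          + 2 * \<Theta>\<^sup>2 / \<theta> * (norm (space_grad \<eta> (x, real (k - 1) * tau j)))\<^sup>2"
    let ?R = "\<lambda>k x. ?c k x * (norm (?d k x))\<^sup>2"
    have nz: "tau j \<noteq> 0" using tau_pos[of j] by simp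
    have se: "smooth_on (\<lambda>x. \<eta> (x, s)) UNIV" for s by (rule smooth_on_slice[OF \<eta>(1)])
    have ce: "continuous_on UNIV (\<lambda>x. \<eta> (x, s))" for s by (rule smooth_on_continuous[OF se])
    have ce2: "continuous_on UNIV (\<lambda>x. (\<eta> (x, s))\<^sup>2)" for s by (intro continuous_intros ce)
    have cn2: "continuous_on UNIV (\<lambda>x. (norm (space_grad \<eta> (x, s)))\<^sup>2)" for s
      unfolding nabla_slice[OF \<eta>(1), symmetric] by (intro continuous_intros continuous_nabla[OF se])
    have iS: "integrable (lebesgue_on \<Omega>) (?S k)" if "k \<in> {1..N j}" for k
      by (rule integrable_continuous_mult[OF ce2 \<Omega>(2) square_integrable_integrable[OF W12_0D(3)[OF \<Omega> W12_0_quotient[OF that]]]])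
    have cc: "continuous_on UNIV (?c k)" for k
      by (intro continuous_on_add continuous_on_mult continuous_on_const continuous_on_divide
          continuous_on_rabs continuous_on_diff ce2 cn2 ballI nz)
    have iR: "integrable (lebesgue_on \<Omega>) (?R k)" if "k \<in> {1..N j}" for k
      by (rule integrable_continuous_mult[OF cc \<Omega>(2) square_integrable_integrable[OF W12_0D(1)[OF \<Omega> W12_0_quotient[OF that]]]])
    have sum: "integral\<^sup>L M (step_fun T (N j) f) = (\<Sum>k=1..N j. tau j * integral\<^sup>L (lebesgue_on \<Omega>) (f k))"
      if "\<And>k. k \<in> {1..N j} \<Longrightarrow> integrable (lebesgue_on \<Omega>) (f k)" for f :: "nat \<Rightarrow> real ^ 'n \<Rightarrow> real"
      using integral_step_fun(2)[OF T N(2)[of j] \<Omega>(1), of f] that by (simp add: tau_def)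
    have eS: "integral\<^sup>L M (step_fun T (N j) ?S) = (\<Sum>k=1..N j. tau j * integral\<^sup>L (lebesgue_on \<Omega>) (?S k))"
      by (rule sum) (rule iS)
    have eR: "integral\<^sup>L M (step_fun T (N j) ?R) = (\<Sum>k=1..N j. tau j * integral\<^sup>L (lebesgue_on \<Omega>) (?R k))"
      by (rule sum) (rule iR)
    have "\<theta> / 2 * integral\<^sup>L M (step_fun T (N j) ?S) \<le> integral\<^sup>L M (step_fun T (N j) ?R)"
      unfolding eS eR
      by (rule Caccioppoli_discrete[OF \<Omega> \<psi> F T N(2) g scheme \<eta> tau_def])
    also have "\<dots> \<le> (LINT p|M. (?W p + \<delta>) * (norm (quot j p))\<^sup>2)"
    proof (rule integral_mono)
      show "integrable M (step_fun T (N j) ?R)" by (rule integral_step_fun(1)[OF T N(2) \<Omega>(1) iR])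
      show "integrable M (\<lambda>p. (?W p + \<delta>) * (norm (quot j p))\<^sup>2)"
        by (intro integrable_bounded_coeff continuous_intros continuous_limit_coeff \<eta>
            square_integrable_integrable square_integrable_quot)
      fix p assume "p \<in> space M"
      then have p: "p \<in> \<Omega> \<times> {0<..<T}" by simp
      let ?k = "step_index T (N j) (snd p)"
      have "0 < tau j \<and> tau j < r \<and> 1 \<le> ?k \<and> real ?k * tau j \<le> T \<and> fst p \<in> \<Omega> \<and> real (?k - 1) * tau j < snd p \<and> snd p \<le> real ?k * tau j"
        using index[OF p, of j] index_time_le[of ?k j] tau_pos[of j] elim p by (auto simp: mem_Times_iff)
      then have "?c ?k (fst p) \<le> ?W (fst p, snd p) + \<delta>" using r(2) by blast
      then have "?c ?k (fst p) * (norm (?d ?k (fst p)))\<^sup>2 \<le> (?W p + \<delta>) * (norm (?d ?k (fst p)))\<^sup>2"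
        by (intro mult_right_mono) simp_all
      then show "step_fun T (N j) ?R p \<le> (?W p + \<delta>) * (norm (quot j p))\<^sup>2"
        by (simp only: step_fun_def quot_def)
    qed
    finally show ?case by (simp add: left_value_def quot_grad_def step_fun_def[abs_def])
  qed
qed

text \<open>The factor is \<open>4 / \<theta>\<close> instead of \<open>2 / \<theta>\<close> because the difference quotients are replaced by their limit
  with the inequality \<open>|a + b|\<^sup>2 \<le> 2 |a|\<^sup>2 + 2 |b|\<^sup>2\<close>.\<close>

lemma energy_estimate:
  assumes \<eta>: "smooth_on \<eta> UNIV" "\<And>x. \<eta> (x, 0) = 0" and \<epsilon>: "0 < \<epsilon>"
  shows "\<forall>\<^sub>F j in sequentially. (LINT p|M. (left_value \<eta> j p)\<^sup>2 * (norm (quot_grad j p))\<^sup>2)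
    \<le> 4 / \<theta> * (LINT p|M. limit_coeff A (2 * \<Theta>\<^sup>2 / \<theta>) \<eta> p * (norm (vt p))\<^sup>2) + \<epsilon>"
proof -
  let ?W = "limit_coeff A (2 * \<Theta>\<^sup>2 / \<theta>) \<eta>"
  let ?I = "LINT p|M. ?W p * (norm (vt p))\<^sup>2"
  obtain B where B: "0 \<le> B" "\<forall>p\<in>\<Omega> \<times> {0<..<T}. norm (?W p) \<le> B"
    using bounded_continuous_image[OF continuous_limit_coeff[OF \<eta>(1)] bounded_cylinder[OF \<Omega>(2)]] by blast
  define S where "S = sq_norm M vt"
  have S: "0 \<le> S" by (simp add: S_def)
  define \<delta> where "\<delta> = \<epsilon> * \<theta> / (8 * (S + 1))"
  have \<delta>: "0 < \<delta>" using \<epsilon> F(2) S by (simp add: \<delta>_def)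
  have \<delta>S: "4 / \<theta> * (\<delta> * S) \<le> \<epsilon> / 2"
  proof -
    have "4 / \<theta> * (\<delta> * S) = \<epsilon> / 2 * (S / (S + 1))" using F(2) S by (simp add: \<delta>_def field_simps)
    also have "\<dots> \<le> \<epsilon> / 2 * 1" using S \<epsilon> by (intro mult_left_mono) auto
    finally show ?thesis by simp
  qed
  have "(\<lambda>j. 4 / \<theta> * ((B + \<delta>) * sq_norm M (\<lambda>p. quot j p - vt p))) \<longlonglongrightarrow> 4 / \<theta> * ((B + \<delta>) * 0)"
    by (intro tendsto_intros quot_tendsto)
  then have "\<forall>\<^sub>F j in sequentially. 4 / \<theta> * ((B + \<delta>) * sq_norm M (\<lambda>p. quot j p - vt p)) < \<epsilon> / 2"
    using \<epsilon> by (intro order_tendstoD(2)[where y = "4 / \<theta> * ((B + \<delta>) * 0)"]) auto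
  then show ?thesis
    using Caccioppoli_cylinder[OF \<eta> \<delta>]
  proof eventually_elim
    case (elim j)
    let ?e = "\<lambda>p. quot j p - vt p"
    have e: "square_integrable M ?e" by (intro square_integrable_diff square_integrable_quot vt)
    have iv: "integrable M (\<lambda>p. ?W p * (norm (vt p))\<^sup>2)"
      by (intro integrable_bounded_coeff continuous_limit_coeff \<eta> square_integrable_integrable vt)
    have "(LINT p|M. (?W p + \<delta>) * (norm (quot j p))\<^sup>2)
        \<le> (LINT p|M. (2 * (?W p * (norm (vt p))\<^sup>2) + 2 * \<delta> * (norm (vt p))\<^sup>2) + 2 * (B + \<delta>) * (norm (?e p))\<^sup>2)"
    proof (rule integral_mono)
      show "integrable M (\<lambda>p. (?W p + \<delta>) * (norm (quot j p))\<^sup>2)"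
        by (intro integrable_bounded_coeff continuous_intros continuous_limit_coeff \<eta>
            square_integrable_integrable square_integrable_quot)
      show "integrable M (\<lambda>p. (2 * (?W p * (norm (vt p))\<^sup>2) + 2 * \<delta> * (norm (vt p))\<^sup>2) + 2 * (B + \<delta>) * (norm (?e p))\<^sup>2)"
        by (intro Bochner_Integration.integrable_add integrable_mult_right iv square_integrable_integrable vt e)
      fix p assume "p \<in> space M"
      then have WB: "0 \<le> ?W p" "?W p \<le> B" using B(2) \<psi>(3) F(2) by (auto simp: limit_coeff_def)
      have "(norm (quot j p))\<^sup>2 \<le> 2 * (norm (vt p))\<^sup>2 + 2 * (norm (?e p))\<^sup>2"
        using norm_add_square_le[of "vt p" "?e p"] by simp
      then have "(?W p + \<delta>) * (norm (quot j p))\<^sup>2 \<le> (?W p + \<delta>) * (2 * (norm (vt p))\<^sup>2 + 2 * (norm (?e p))\<^sup>2)"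
        using WB \<delta> by (intro mult_left_mono) auto
      also have "\<dots> = (2 * (?W p * (norm (vt p))\<^sup>2) + 2 * \<delta> * (norm (vt p))\<^sup>2) + 2 * (?W p + \<delta>) * (norm (?e p))\<^sup>2"
        by (simp add: algebra_simps)
      also have "\<dots> \<le> (2 * (?W p * (norm (vt p))\<^sup>2) + 2 * \<delta> * (norm (vt p))\<^sup>2) + 2 * (B + \<delta>) * (norm (?e p))\<^sup>2"
        using WB by (intro add_left_mono mult_right_mono) auto
      finally show "(?W p + \<delta>) * (norm (quot j p))\<^sup>2
          \<le> (2 * (?W p * (norm (vt p))\<^sup>2) + 2 * \<delta> * (norm (vt p))\<^sup>2) + 2 * (B + \<delta>) * (norm (?e p))\<^sup>2" .
    qed
    also have "\<dots> = 2 * ?I + 2 * \<delta> * S + 2 * (B + \<delta>) * sq_norm M ?e"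
      using iv square_integrable_integrable[OF vt] square_integrable_integrable[OF e] by (simp add: S_def)
    finally have le: "\<theta> / 2 * (LINT p|M. (left_value \<eta> j p)\<^sup>2 * (norm (quot_grad j p))\<^sup>2)
        \<le> 2 * ?I + 2 * \<delta> * S + 2 * (B + \<delta>) * sq_norm M ?e"
      using elim(2) by linarith
    have "(LINT p|M. (left_value \<eta> j p)\<^sup>2 * (norm (quot_grad j p))\<^sup>2)
        = 2 / \<theta> * (\<theta> / 2 * (LINT p|M. (left_value \<eta> j p)\<^sup>2 * (norm (quot_grad j p))\<^sup>2))"
      using F(2) by simp
    also have "\<dots> \<le> 2 / \<theta> * (2 * ?I + 2 * \<delta> * S + 2 * (B + \<delta>) * sq_norm M ?e)"
      using F(2) by (intro mult_left_mono[OF le]) simp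
    also have "\<dots> = 4 / \<theta> * ?I + 4 / \<theta> * (\<delta> * S) + 4 / \<theta> * ((B + \<delta>) * sq_norm M ?e)"
      by (simp add: algebra_simps add_divide_distrib)
    finally show ?case using \<delta>S elim(1) by linarith
  qed
qed

end

lemma square_integrable_subset:
  fixes f :: "'a::euclidean_space \<Rightarrow> 'b::euclidean_space"
  assumes "A \<subseteq> B" "A \<in> sets lebesgue" "B \<in> sets lebesgue" "square_integrable (lebesgue_on B) f"
  shows "square_integrable (lebesgue_on A) f"
proof -
  have m: "(\<lambda>x. indicator B x *\<^sub>R f x) \<in> borel_measurable lebesgue"
    using square_integrable_measurable[OF assms(4)] assms(3) by (subst (asm) borel_measurable_restrict_space_iff) auto
  have i: "integrable lebesgue (\<lambda>x. indicator B x *\<^sub>R (norm (f x))\<^sup>2)"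
    using square_integrable_integrable[OF assms(4)] assms(3) by (subst (asm) integrable_restrict_space) auto
  have ind: "indicator A x *\<^sub>R (indicator B x *\<^sub>R y) = indicator A x *\<^sub>R y" for x and y :: "'c::real_vector"
    using assms(1) by (auto simp: indicator_def)
  have "(\<lambda>x. indicator A x *\<^sub>R (indicator B x *\<^sub>R f x)) \<in> borel_measurable lebesgue"
    using assms(2) by (intro borel_measurable_scaleR m) auto
  then have m': "f \<in> borel_measurable (lebesgue_on A)"
    unfolding ind using assms(2) by (subst borel_measurable_restrict_space_iff) auto
  have "integrable lebesgue (\<lambda>x. indicator A x *\<^sub>R (indicator B x *\<^sub>R (norm (f x))\<^sup>2))"
    by (rule integrable_mult_indicator[OF assms(2) i])
  then have "integrable (lebesgue_on A) (\<lambda>x. (norm (f x))\<^sup>2)"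
    unfolding ind using assms(2) by (subst integrable_restrict_space) auto
  then show ?thesis using m' by (simp add: square_integrable_def)
qed

lemma L2_loc_imp_L1_loc:
  fixes f :: "'a::euclidean_space \<Rightarrow> 'b::euclidean_space"
  assumes "L2_loc U f"
  shows "L1_loc U f"
  unfolding L1_loc_def
proof (intro allI impI)
  fix K :: "'a set" assume K: "compact K \<and> K \<subseteq> U"
  then have Ks: "K \<in> sets lebesgue" by (simp add: borel_compact)
  have f: "square_integrable (lebesgue_on K) f" using assms K by (simp add: L2_loc_def L2_on_eq)
  have "emeasure (lebesgue_on K) (space (lebesgue_on K)) \<noteq> \<infinity>"
    using lmeasurable_compact[of K] K Ks by (auto simp: emeasure_restrict_space fmeasurable_def)
  then have "finite_measure (lebesgue_on K)" by (rule finite_measureI)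
  then have "square_integrable (lebesgue_on K) (\<lambda>x. 1::real)"
    by (simp add: square_integrable_def finite_measure.integrable_const)
  from integrable_scaleR_product[OF this f] have "integrable (lebesgue_on K) f" by simp
  then show "f absolutely_integrable_on K"
    using Ks by (simp add: set_integrable_def integrable_restrict_space)
qed

lemma linear_column: "linear (\<lambda>A :: real ^ 'n ^ 'm. a *\<^sub>R column j A)"
  by (intro linearI) (simp_all add: column_add column_scaleR scaleR_add_right)

lemma compact_in_cylinder_time_bound:
  fixes K :: "('a::euclidean_space \<times> real) set"
  assumes "compact K" "K \<subseteq> \<Omega> \<times> {0<..<T}"
  shows "\<exists>e>0. \<forall>p\<in>K. e \<le> snd p"
proof (cases "K = {}")
  case True
  then show ?thesis by (intro exI[of _ 1]) simp
next
  case False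
  have "compact (snd ` K)" by (intro compact_continuous_image continuous_on_snd continuous_on_id assms(1))
  then obtain e where "e \<in> snd ` K" "\<forall>t\<in>snd ` K. e \<le> t"
    using compact_attains_inf[of "snd ` K"] False by auto
  then show ?thesis using assms(2) by (intro exI[of _ e]) auto
qed

section \<open>The spatial gradient of the time derivative\<close>

context convergent_scheme
begin

text \<open>The energy estimate with \<open>\<eta> = t\<close> gives no information on the first step, where the left end is zero.
  Since each test function vanishes near time zero, the gradient may be set to zero there.\<close>

definition tail_grad :: "nat \<Rightarrow> (real ^ 'n) \<times> real \<Rightarrow> real ^ 'n ^ 'm" where
  "tail_grad j = step_fun T (N j) (\<lambda>k x. if 2 \<le> k then wgrad \<Omega> (difference_quotient (tau j) (V j) k) x else 0)"

definition weighted_grad :: "nat \<Rightarrow> (real ^ 'n) \<times> real \<Rightarrow> real ^ 'n ^ 'm" where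
  "weighted_grad j p = snd p *\<^sub>R tail_grad j p"

lemma tail_grad_eq: "tail_grad j p = (if 2 \<le> step_index T (N j) (snd p) then quot_grad j p else 0)"
  by (simp add: tail_grad_def quot_grad_def step_fun_def)

lemma measurable_snd_M: "snd \<in> borel_measurable M"
  by (rule measurable_lebesgue_on_continuous) (intro continuous_intros)

lemma square_integrable_weighted_grad: "square_integrable M (weighted_grad j)"
proof -
  have t: "square_integrable M (tail_grad j)"
    unfolding tail_grad_def
  proof (rule square_integrable_step_fun[OF T N(2) \<Omega>(1)])
    fix k assume k: "k \<in> {1..N j}"
    show "square_integrable (lebesgue_on \<Omega>) (\<lambda>x. if 2 \<le> k then wgrad \<Omega> (difference_quotient (tau j) (V j) k) x else 0)"
      using W12_0D(3)[OF \<Omega> W12_0_quotient[OF k]] by (cases "2 \<le> k") (simp_all add: square_integrable_zero)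
  qed
  show ?thesis
  proof (rule square_integrable_bound(1)[OF t])
    show "weighted_grad j \<in> borel_measurable M"
      unfolding weighted_grad_def by (intro borel_measurable_scaleR measurable_snd_M square_integrable_measurable t)
    show "AE p in M. norm (weighted_grad j p) \<le> T * norm (tail_grad j p)"
      by (rule AE_I2) (auto simp: weighted_grad_def intro!: mult_right_mono)
  qed
qed

lemma weighted_grad_bounded: "\<exists>B\<ge>0. \<forall>\<^sub>F j in sequentially. sq_norm M (weighted_grad j) \<le> B"
proof -
  have sm: "smooth_on (snd :: (real ^ 'n) \<times> real \<Rightarrow> real) UNIV" by (rule smooth_on_linear[OF linear_snd])
  define B0 where "B0 = 4 / \<theta> * (LINT p|M. limit_coeff A (2 * \<Theta>\<^sup>2 / \<theta>) snd p * (norm (vt p))\<^sup>2) + 1"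
  have "\<forall>\<^sub>F j in sequentially. (LINT p|M. (left_value snd j p)\<^sup>2 * (norm (quot_grad j p))\<^sup>2) \<le> B0"
    unfolding B0_def by (rule energy_estimate[OF sm]) simp_all
  then have "\<forall>\<^sub>F j in sequentially. sq_norm M (weighted_grad j) \<le> \<bar>4 * B0\<bar>"
  proof eventually_elim
    case (elim j)
    have "sq_norm M (weighted_grad j) \<le> (LINT p|M. 4 * ((left_value snd j p)\<^sup>2 * (norm (quot_grad j p))\<^sup>2))"
    proof (rule integral_mono)
      show "integrable M (\<lambda>p. (norm (weighted_grad j p))\<^sup>2)"
        by (rule square_integrable_integrable[OF square_integrable_weighted_grad])
      show "integrable M (\<lambda>p. 4 * ((left_value snd j p)\<^sup>2 * (norm (quot_grad j p))\<^sup>2))"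
        by (intro integrable_mult_right integrable_left_value sm)
      fix p assume "p \<in> space M"
      then have p: "p \<in> \<Omega> \<times> {0<..<T}" by simp
      let ?k = "step_index T (N j) (snd p)"
      show "(norm (weighted_grad j p))\<^sup>2 \<le> 4 * ((left_value snd j p)\<^sup>2 * (norm (quot_grad j p))\<^sup>2)"
      proof (cases "2 \<le> ?k")
        case True
        \<comment> \<open>From the second step on, the right end of a time step is at most twice its left end.\<close>
        have "real ?k \<le> 2 * real (?k - 1)" using True by (simp add: of_nat_diff)
        then have "real ?k * tau j \<le> 2 * real (?k - 1) * tau j" using tau_pos[of j] by (intro mult_right_mono) auto
        then have "snd p \<le> 2 * left_value snd j p"
          using index(3)[OF p, of j] by (simp add: left_value_def step_fun_def)
        then have "(snd p)\<^sup>2 \<le> (2 * left_value snd j p)\<^sup>2" using p by (intro power_mono) auto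
        then have "(snd p)\<^sup>2 * (norm (quot_grad j p))\<^sup>2 \<le> (2 * left_value snd j p)\<^sup>2 * (norm (quot_grad j p))\<^sup>2"
          by (rule mult_right_mono) simp
        then show ?thesis using True by (simp add: weighted_grad_def tail_grad_eq power_mult_distrib)
      qed (simp add: weighted_grad_def tail_grad_eq)
    qed
    also have "\<dots> \<le> 4 * B0" using elim by simp
    finally show ?case by linarith
  qed
  then show ?thesis by (intro exI[of _ "\<bar>4 * B0\<bar>"]) simp
qed

text \<open>A test function differs from its left value only at times that are bounded away from zero, uniformly
  in the step size. At such times the difference is small compared with \<open>t\<close>, and its contribution is
  controlled by the bound on the weighted gradients.\<close>

lemma test_times_tail_grad:
  assumes \<phi>: "test_function (\<Omega> \<times> {0<..<T}) \<phi>" and \<kappa>: "0 < \<kappa>"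
  shows "\<forall>\<^sub>F j in sequentially. \<forall>p\<in>\<Omega> \<times> {0<..<T}. (norm (\<phi> p *\<^sub>R tail_grad j p))\<^sup>2
    \<le> 2 * ((left_value \<phi> j p)\<^sup>2 * (norm (quot_grad j p))\<^sup>2) + \<kappa> * (norm (weighted_grad j p))\<^sup>2"
proof -
  obtain K where K: "compact K" "K \<subseteq> \<Omega> \<times> {0<..<T}" "smooth_on \<phi> UNIV" "\<forall>p. p \<notin> K \<longrightarrow> \<phi> p = 0"
    using test_functionD[OF \<phi>] by blast
  obtain e where e: "0 < e" "\<forall>p\<in>K. e \<le> snd p" using compact_in_cylinder_time_bound[OF K(1,2)] by blast
  define \<delta> where "\<delta> = sqrt (\<kappa> / 2) * e"
  have \<delta>: "0 < \<delta>" "2 * \<delta>\<^sup>2 = \<kappa> * e\<^sup>2" using \<kappa> e by (simp_all add: \<delta>_def power_mult_distrib)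
  obtain r where r: "0 < r" "\<forall>x\<in>\<Omega>. \<forall>s\<in>{0..T}. \<forall>t\<in>{0..T}. \<bar>s - t\<bar> < r \<longrightarrow> \<bar>\<phi> (x, s) - \<phi> (x, t)\<bar> < \<delta>"
    using uniformly_continuous_in_time[OF smooth_on_continuous[OF K(3)] \<Omega>(2) \<delta>(1), of T] by blast
  show ?thesis
  proof (rule eventually_mono[OF eventually_tau_less[OF r(1)]], rule ballI)
    fix j p assume tau: "tau j < r" and p: "p \<in> \<Omega> \<times> {0<..<T}"
    obtain x t where pt: "p = (x, t)" "x \<in> \<Omega>" "0 < t" "t < T" using p by auto
    let ?k = "step_index T (N j) t"
    define s where "s = real (?k - 1) * tau j"
    have k: "1 \<le> ?k" "s < t" "t \<le> real ?k * tau j"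
      using index[OF p, of j] by (auto simp: pt s_def)
    have s0: "0 \<le> s" using tau_pos[of j] by (simp add: s_def)
    have gap: "real ?k * tau j - s = tau j" using k(1) by (simp add: s_def of_nat_diff algebra_simps)
    have left: "left_value \<phi> j p = \<phi> (x, s)" by (simp add: left_value_def step_fun_def pt s_def)
    show "(norm (\<phi> p *\<^sub>R tail_grad j p))\<^sup>2
      \<le> 2 * ((left_value \<phi> j p)\<^sup>2 * (norm (quot_grad j p))\<^sup>2) + \<kappa> * (norm (weighted_grad j p))\<^sup>2"
    proof (cases "2 \<le> ?k")
      case True
      have "2 * (\<phi> p - \<phi> (x, s))\<^sup>2 \<le> \<kappa> * t\<^sup>2"
      proof (cases "p \<in> K \<or> (x, s) \<in> K")
        case True
        then have "e \<le> t" using e(2) k(2) by (auto simp: pt)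
        have "t \<in> {0..T}" "s \<in> {0..T}" "\<bar>t - s\<bar> < r" using s0 k(2,3) pt gap tau by auto
        then have "\<bar>\<phi> p - \<phi> (x, s)\<bar> \<le> \<delta>" using r(2) pt(2) unfolding pt(1) by (meson less_imp_le)
        then have "(\<phi> p - \<phi> (x, s))\<^sup>2 \<le> \<delta>\<^sup>2" by (metis abs_ge_zero power2_abs power_mono)
        then have "2 * (\<phi> p - \<phi> (x, s))\<^sup>2 \<le> \<kappa> * e\<^sup>2" using \<delta>(2) by linarith
        also have "\<dots> \<le> \<kappa> * t\<^sup>2" using \<open>e \<le> t\<close> e(1) \<kappa> by (intro mult_left_mono power_mono) auto
        finally show ?thesis .
      next
        case False
        then have "\<phi> p = 0" "\<phi> (x, s) = 0" using K(4) by blast+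
        then show ?thesis using \<kappa> by simp
      qed
      moreover have "(\<phi> p)\<^sup>2 \<le> 2 * (\<phi> (x, s))\<^sup>2 + 2 * (\<phi> p - \<phi> (x, s))\<^sup>2"
        using norm_add_square_le[of "\<phi> (x, s)" "\<phi> p - \<phi> (x, s)"] by simp
      ultimately have "(\<phi> p)\<^sup>2 \<le> 2 * (\<phi> (x, s))\<^sup>2 + \<kappa> * t\<^sup>2" by linarith
      then have "(\<phi> p)\<^sup>2 * (norm (quot_grad j p))\<^sup>2 \<le> (2 * (\<phi> (x, s))\<^sup>2 + \<kappa> * t\<^sup>2) * (norm (quot_grad j p))\<^sup>2"
        by (rule mult_right_mono) simp
      then show ?thesis
        unfolding left using True by (simp add: tail_grad_eq weighted_grad_def pt(1) power_mult_distrib algebra_simps)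
    next
      case False
      then show ?thesis using \<kappa> by (simp add: tail_grad_eq weighted_grad_def pt(1))
    qed
  qed
qed

lemma test_times_quot_grad:
  assumes e: "\<forall>p. \<phi> p \<noteq> 0 \<longrightarrow> e \<le> snd p" and j: "tau j < e" and p: "p \<in> \<Omega> \<times> {0<..<T}"
  shows "\<phi> p *\<^sub>R quot_grad j p = (\<phi> p * inverse (snd p)) *\<^sub>R weighted_grad j p"
proof (cases "\<phi> p = 0")
  case False
  let ?k = "step_index T (N j) (snd p)"
  have "2 \<le> ?k"
  proof (rule ccontr)
    assume "\<not> 2 \<le> ?k"
    then have "?k = 1" using index(1)[OF p, of j] by simp
    then have "snd p \<le> tau j" using index(3)[OF p, of j] by simp
    moreover have "e \<le> snd p" using e False by blast
    ultimately show False using j by linarith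
  qed
  then show ?thesis using p by (auto simp: weighted_grad_def tail_grad_eq)
qed simp

text \<open>The identity that defines the weak gradient is linear in the pair of a difference quotient and its
  gradient, so that it holds for convex combinations as well, and both sides converge along these. The
  estimate passes to convex combinations because the squared norm is convex. The constant is the
  factor \<open>4 / \<theta>\<close> of the energy estimate, multiplied by \<open>2\<close> for the passage from the test function to its
  left values, and by \<open>2\<close> for the passage from the convex combinations to their strong limit.\<close>

theorem space_gradient_of_limit:
  "\<exists>Dvt. has_weak_space_grad \<Omega> T vt Dvt \<and> L2_loc (\<Omega> \<times> {0<..<T}) Dvt \<and>
    (\<forall>\<phi>. test_function (\<Omega> \<times> {0<..<T}) \<phi> \<longrightarrow> integrable M (\<lambda>p. (\<phi> p)\<^sup>2 * (norm (Dvt p))\<^sup>2) \<and>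
      (LINT p|M. (\<phi> p)\<^sup>2 * (norm (Dvt p))\<^sup>2)
      \<le> 16 / \<theta> * (LINT p|M. limit_coeff A (2 * \<Theta>\<^sup>2 / \<theta>) \<phi> p * (norm (vt p))\<^sup>2))"
proof -
  have Q: "\<Omega> \<times> {0<..<T} \<in> sets lebesgue" "open (\<Omega> \<times> {0<..<T})"
    using cylinder_sets[OF \<Omega>(1)] cylinder_open[OF \<Omega>(1)] by auto
  obtain B where B: "0 \<le> B" "\<forall>\<^sub>F j in sequentially. sq_norm M (weighted_grad j) \<le> B"
    using weighted_grad_bounded by blast
  then obtain J1 where J1: "\<forall>j\<ge>J1. sq_norm M (weighted_grad j) \<le> B"
    unfolding eventually_sequentially by blast
  define f where "f m = weighted_grad (m + J1)" for m
  have sf: "square_integrable M (f m)" for m unfolding f_def by (rule square_integrable_weighted_grad)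
  have fB: "sq_norm M (f m) \<le> B" for m unfolding f_def using J1 by simp
  obtain c h where c: "\<forall>n. convex_weights n (c n)" and h: "square_integrable M h"
    and lim: "(\<lambda>n. sq_norm M (\<lambda>p. weighted_sum (\<lambda>m. f m p) (c n) - h p)) \<longlonglongrightarrow> 0"
    using bounded_L2_convex_combinations_converge[of M f B, OF sf fB] by blast
  define fh where "fh n p = weighted_sum (\<lambda>m. f m p) (c n)" for n p
  have sfh: "square_integrable M (fh n)" for n
    unfolding fh_def by (rule square_integrable_weighted_sum[OF sf])
  have lim: "(\<lambda>n. sq_norm M (\<lambda>p. fh n p - h p)) \<longlonglongrightarrow> 0" using lim by (simp only: fh_def)
  define qh where "qh n p = weighted_sum (\<lambda>m. quot (m + J1) p) (c n)" for n p
  have sqh: "square_integrable M (qh n)" for n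
    unfolding qh_def by (rule square_integrable_weighted_sum[OF square_integrable_quot])
  have qlim: "(\<lambda>n. sq_norm M (\<lambda>p. qh n p - vt p)) \<longlonglongrightarrow> 0"
  proof (rule LIMSEQ_I)
    fix r :: real assume r: "0 < r"
    have "\<forall>\<^sub>F j in sequentially. sq_norm M (\<lambda>p. quot j p - vt p) < r / 2"
      by (rule order_tendstoD(2)[OF quot_tendsto]) (use r in simp)
    then obtain J where J: "\<forall>j\<ge>J. sq_norm M (\<lambda>p. quot j p - vt p) < r / 2"
      unfolding eventually_sequentially by blast
    show "\<exists>no. \<forall>n\<ge>no. norm (sq_norm M (\<lambda>p. qh n p - vt p) - 0) < r"
    proof (intro exI[of _ J] allI impI)
      fix n assume n: "J \<le> n"
      have cn: "convex_weights n (c n)" using c by blast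
      have "sq_norm M (\<lambda>p. qh n p - vt p) = sq_norm M (\<lambda>p. weighted_sum (\<lambda>m. quot (m + J1) p - vt p) (c n))"
        by (simp only: qh_def weighted_sum_diff_const[OF cn])
      also have "\<dots> \<le> weighted_sum (\<lambda>m. sq_norm M (\<lambda>p. quot (m + J1) p - vt p)) (c n)"
        by (rule sq_norm_weighted_sum_le[OF cn]) (intro square_integrable_diff square_integrable_quot vt)
      also have "\<dots> \<le> r / 2"
        by (rule weighted_sum_le[OF cn]) (use J n in \<open>simp add: less_imp_le\<close>)
      finally have "sq_norm M (\<lambda>p. qh n p - vt p) \<le> r / 2" .
      moreover have "0 \<le> sq_norm M (\<lambda>p. qh n p - vt p)" by simp
      ultimately show "norm (sq_norm M (\<lambda>p. qh n p - vt p) - 0) < r" using r by simp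
    qed
  qed
  define Dvt where "Dvt p = inverse (snd p) *\<^sub>R h p" for p
  \<comment> \<open>On the support of a test function \<open>t\<close> is bounded below, so that division by \<open>t\<close> is harmless.\<close>
  have cut: "\<exists>e b. 0 < e \<and> (\<forall>p. \<phi> p \<noteq> 0 \<longrightarrow> e \<le> snd p) \<and>
      square_integrable M (\<lambda>p. \<phi> p * inverse (snd p)) \<and>
      (\<forall>p\<in>\<Omega> \<times> {0<..<T}. \<bar>\<phi> p * inverse (snd p)\<bar> \<le> b)"
    if \<phi>: "test_function (\<Omega> \<times> {0<..<T}) \<phi>" for \<phi>
  proof -
    obtain K where K: "compact K" "K \<subseteq> \<Omega> \<times> {0<..<T}" "smooth_on \<phi> UNIV" "\<forall>p. p \<notin> K \<longrightarrow> \<phi> p = 0"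
      using test_functionD[OF \<phi>] by blast
    obtain e where e: "0 < e" "\<forall>p\<in>K. e \<le> snd p" using compact_in_cylinder_time_bound[OF K(1,2)] by blast
    have supp: "\<forall>p. \<phi> p \<noteq> 0 \<longrightarrow> e \<le> snd p" using K(4) e(2) by blast
    have c\<phi>: "continuous_on UNIV \<phi>" by (rule smooth_on_continuous[OF K(3)])
    have s\<phi>: "square_integrable M \<phi>"
      by (rule square_integrable_continuous[OF c\<phi> Q(2) bounded_cylinder[OF \<Omega>(2)]])
    have le: "\<bar>\<phi> p * inverse (snd p)\<bar> \<le> inverse e * \<bar>\<phi> p\<bar>" for p
    proof (cases "\<phi> p = 0")
      case False
      then have "e \<le> snd p" using supp by blast
      then have "inverse (snd p) \<le> inverse e" "0 \<le> inverse (snd p)" using e(1) by (auto intro: le_imp_inverse_le)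
      then show ?thesis by (simp add: abs_mult mult.commute[of "\<bar>\<phi> p\<bar>"] mult_right_mono)
    qed simp
    have "square_integrable M (\<lambda>p. \<phi> p * inverse (snd p))"
    proof (rule square_integrable_bound(1)[OF s\<phi>])
      show "(\<lambda>p. \<phi> p * inverse (snd p)) \<in> borel_measurable M"
        by (intro borel_measurable_times borel_measurable_inverse measurable_snd_M square_integrable_measurable[OF s\<phi>])
      show "AE p in M. norm (\<phi> p * inverse (snd p)) \<le> inverse e * norm (\<phi> p)"
        using le by (intro AE_I2) simp
    qed
    moreover obtain b where b: "\<forall>p\<in>\<Omega> \<times> {0<..<T}. norm (\<phi> p) \<le> b"
      using bounded_continuous_image[OF c\<phi> bounded_cylinder[OF \<Omega>(2)]] by blast
    have "\<forall>p\<in>\<Omega> \<times> {0<..<T}. \<bar>\<phi> p * inverse (snd p)\<bar> \<le> inverse e * b"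
    proof
      fix p assume "p \<in> \<Omega> \<times> {0<..<T}"
      then have "inverse e * \<bar>\<phi> p\<bar> \<le> inverse e * b" using b e(1) by (intro mult_left_mono) auto
      then show "\<bar>\<phi> p * inverse (snd p)\<bar> \<le> inverse e * b" using le[of p] by linarith
    qed
    ultimately show ?thesis using e(1) supp by blast
  qed
  have sub: "square_integrable (lebesgue_on K) u"
    if "compact K" "K \<subseteq> \<Omega> \<times> {0<..<T}" "square_integrable M u" for K and u :: "(real ^ 'n) \<times> real \<Rightarrow> 'c::euclidean_space"
    by (rule square_integrable_subset[OF that(2) _ Q(1) that(3)]) (simp add: borel_compact that(1))
  have L2: "L2_loc (\<Omega> \<times> {0<..<T}) Dvt"
    unfolding L2_loc_def L2_on_eq
  proof (intro allI impI)
    fix K :: "((real ^ 'n) \<times> real) set" assume K: "compact K \<and> K \<subseteq> \<Omega> \<times> {0<..<T}"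
    then obtain e where e: "0 < e" "\<forall>p\<in>K. e \<le> snd p" using compact_in_cylinder_time_bound by blast
    have hK: "square_integrable (lebesgue_on K) h" using sub[OF _ _ h] K by blast
    show "square_integrable (lebesgue_on K) Dvt"
    proof (rule square_integrable_bound(1)[OF hK])
      have "snd \<in> borel_measurable (lebesgue_on K)"
        by (rule measurable_lebesgue_on_continuous) (intro continuous_intros)
      then show "Dvt \<in> borel_measurable (lebesgue_on K)"
        unfolding Dvt_def by (intro borel_measurable_scaleR borel_measurable_inverse square_integrable_measurable[OF hK])
      show "AE p in lebesgue_on K. norm (Dvt p) \<le> inverse e * norm (h p)"
      proof (rule AE_I2)
        fix p assume "p \<in> space (lebesgue_on K)"
        then have "e \<le> snd p" using e(2) by simp
        then have "inverse (snd p) \<le> inverse e" "0 \<le> inverse (snd p)" using e(1) by (auto intro: le_imp_inverse_le)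
        then show "norm (Dvt p) \<le> inverse e * norm (h p)" by (simp add: Dvt_def mult_right_mono)
      qed
    qed
  qed
  have "L2_loc (\<Omega> \<times> {0<..<T}) vt"
    unfolding L2_loc_def L2_on_eq using sub[OF _ _ vt] by blast
  then have L1v: "L1_loc (\<Omega> \<times> {0<..<T}) vt" by (rule L2_loc_imp_L1_loc)
  have "has_weak_space_grad \<Omega> T vt Dvt"
    unfolding has_weak_space_grad_def has_weak_deriv_def
  proof (intro allI conjI impI)
    fix i
    show "L1_loc (\<Omega> \<times> {0<..<T}) vt" by (rule L1v)
    have "bounded_linear (column i :: real ^ 'n ^ 'm \<Rightarrow> _)"
      using linear_column[of 1 i] by (simp add: linear_conv_bounded_linear)
    then show "L1_loc (\<Omega> \<times> {0<..<T}) (\<lambda>p. column i (Dvt p))"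
      by (rule L1_loc_bounded_linear[OF _ L2_loc_imp_L1_loc[OF L2]])
    fix \<phi> :: "(real ^ 'n) \<times> real \<Rightarrow> real" assume \<phi>: "test_function (\<Omega> \<times> {0<..<T}) \<phi>"
    let ?\<phi>' = "\<lambda>p. frechet_derivative \<phi> (at p) (axis i 1, 0)"
    define \<chi>' where "\<chi>' p = \<phi> p * inverse (snd p)" for p
    obtain e where e: "0 < e" "\<forall>p. \<phi> p \<noteq> 0 \<longrightarrow> e \<le> snd p" and s\<chi>: "square_integrable M \<chi>'"
      using cut[OF \<phi>] unfolding \<chi>'_def[symmetric] by blast
    have s\<phi>': "square_integrable M ?\<phi>'"
      by (intro square_integrable_continuous smooth_on_continuous smooth_on_frechet_derivative
          test_function_smooth[OF \<phi>] Q(2) bounded_cylinder \<Omega>(2))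
    obtain J2 where J2: "\<forall>j\<ge>J2. tau j < e"
      using eventually_tau_less[OF e(1)] unfolding eventually_sequentially by blast
    have id: "(LINT p|M. ?\<phi>' p *\<^sub>R quot j p) = - (LINT p|M. \<chi>' p *\<^sub>R column i (weighted_grad j p))"
      if j: "J2 \<le> j" for j
    proof -
      have "(LINT p|M. ?\<phi>' p *\<^sub>R quot j p) = - (LINT p|M. \<phi> p *\<^sub>R column i (quot_grad j p))"
        unfolding quot_def quot_grad_def
        by (rule step_fun_weak_space_derivative[OF T N(2) \<Omega> W12_0D(1)[OF \<Omega> W12_0_quotient]
              W12_0D(3)[OF \<Omega> W12_0_quotient] W12_0D(2)[OF \<Omega> W12_0_quotient] \<phi>])
      also have "(LINT p|M. \<phi> p *\<^sub>R column i (quot_grad j p)) = (LINT p|M. \<chi>' p *\<^sub>R column i (weighted_grad j p))"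
      proof (rule Bochner_Integration.integral_cong[OF refl])
        fix p assume "p \<in> space M"
        then have "p \<in> \<Omega> \<times> {0<..<T}" by simp
        from test_times_quot_grad[OF e(2) J2[rule_format, OF j] this]
        show "\<phi> p *\<^sub>R column i (quot_grad j p) = \<chi>' p *\<^sub>R column i (weighted_grad j p)"
          unfolding column_scaleR[symmetric] \<chi>'_def by simp
      qed
      finally show ?thesis .
    qed
    have idh: "(LINT p|M. ?\<phi>' p *\<^sub>R qh n p) = - (LINT p|M. \<chi>' p *\<^sub>R column i (fh n p))" if n: "J2 \<le> n" for n
    proof -
      have cn: "convex_weights n (c n)" using c by blast
      have "(LINT p|M. ?\<phi>' p *\<^sub>R qh n p) = (LINT p|M. weighted_sum (\<lambda>m. ?\<phi>' p *\<^sub>R quot (m + J1) p) (c n))"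
        unfolding qh_def by (subst linear_weighted_sum[of "\<lambda>y. _ *\<^sub>R y"]) (simp_all add: linear_scaleR)
      also have "\<dots> = weighted_sum (\<lambda>m. LINT p|M. ?\<phi>' p *\<^sub>R quot (m + J1) p) (c n)"
        by (rule weighted_sum_integral[OF integrable_scaleR_product[OF s\<phi>' square_integrable_quot]])
      also have "\<dots> = weighted_sum (\<lambda>m. - (LINT p|M. \<chi>' p *\<^sub>R column i (f m p))) (c n)"
        by (rule weighted_sum_cong[OF cn]) (use id n in \<open>simp add: f_def\<close>)
      also have "\<dots> = - weighted_sum (\<lambda>m. LINT p|M. \<chi>' p *\<^sub>R column i (f m p)) (c n)"
        by (simp add: weighted_sum_def sum_negf)
      also have "weighted_sum (\<lambda>m. LINT p|M. \<chi>' p *\<^sub>R column i (f m p)) (c n)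
          = (LINT p|M. weighted_sum (\<lambda>m. \<chi>' p *\<^sub>R column i (f m p)) (c n))"
        by (rule weighted_sum_integral[OF integrable_scaleR_product[OF s\<chi> square_integrable_column(1)[OF sf]], symmetric])
      also have "\<dots> = (LINT p|M. \<chi>' p *\<^sub>R column i (fh n p))"
        unfolding fh_def by (simp only: linear_weighted_sum[OF linear_column])
      finally show ?thesis .
    qed
    have "(\<lambda>n. LINT p|M. ?\<phi>' p *\<^sub>R qh n p) \<longlonglongrightarrow> (LINT p|M. ?\<phi>' p *\<^sub>R vt p)"
      by (rule tendsto_integral_scaleR_L2[OF s\<phi>' sqh vt qlim])
    moreover have "(\<lambda>n. LINT p|M. ?\<phi>' p *\<^sub>R qh n p) \<longlonglongrightarrow> - (LINT p|M. \<chi>' p *\<^sub>R column i (h p))"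
    proof (rule Lim_transform_eventually)
      have "(\<lambda>n. sq_norm M (\<lambda>p. column i (fh n p) - column i (h p))) \<longlonglongrightarrow> 0"
      proof (rule tendsto_sandwich[OF _ _ tendsto_const lim])
        have "square_integrable M (\<lambda>p. fh n p - h p)" for n by (intro square_integrable_diff sfh h)
        from square_integrable_column(2)[OF this]
        show "\<forall>\<^sub>F n in sequentially. sq_norm M (\<lambda>p. column i (fh n p) - column i (h p)) \<le> sq_norm M (\<lambda>p. fh n p - h p)"
          by (simp add: column_diff)
      qed simp
      then show "(\<lambda>n. - (LINT p|M. \<chi>' p *\<^sub>R column i (fh n p))) \<longlonglongrightarrow> - (LINT p|M. \<chi>' p *\<^sub>R column i (h p))"
        by (intro tendsto_minus tendsto_integral_scaleR_L2[OF s\<chi>] square_integrable_column(1) sfh h)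
      show "\<forall>\<^sub>F n in sequentially. - (LINT p|M. \<chi>' p *\<^sub>R column i (fh n p)) = (LINT p|M. ?\<phi>' p *\<^sub>R qh n p)"
        using eventually_ge_at_top[of J2] by eventually_elim (simp add: idh)
    qed
    ultimately have "(LINT p|M. ?\<phi>' p *\<^sub>R vt p) = - (LINT p|M. \<chi>' p *\<^sub>R column i (h p))"
      by (rule LIMSEQ_unique)
    also have "\<dots> = - (LINT p|M. \<phi> p *\<^sub>R column i (Dvt p))"
      by (simp add: \<chi>'_def Dvt_def column_scaleR)
    finally show "(LINT p|M. ?\<phi>' p *\<^sub>R vt p) = - (LINT p|M. \<phi> p *\<^sub>R column i (Dvt p))" .
  qed
  moreover have "integrable M (\<lambda>p. (\<phi> p)\<^sup>2 * (norm (Dvt p))\<^sup>2) \<and> (LINT p|M. (\<phi> p)\<^sup>2 * (norm (Dvt p))\<^sup>2)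
      \<le> 16 / \<theta> * (LINT p|M. limit_coeff A (2 * \<Theta>\<^sup>2 / \<theta>) \<phi> p * (norm (vt p))\<^sup>2)"
    if \<phi>: "test_function (\<Omega> \<times> {0<..<T}) \<phi>" for \<phi>
  proof -
    let ?I = "LINT p|M. limit_coeff A (2 * \<Theta>\<^sup>2 / \<theta>) \<phi> p * (norm (vt p))\<^sup>2"
    define \<chi>' where "\<chi>' p = \<phi> p * inverse (snd p)" for p
    obtain b where s\<chi>: "square_integrable M \<chi>'" and b: "\<forall>p\<in>\<Omega> \<times> {0<..<T}. \<bar>\<chi>' p\<bar> \<le> b"
      using cut[OF \<phi>] unfolding \<chi>'_def[symmetric] by blast
    have mult: "square_integrable M (\<lambda>p. \<chi>' p *\<^sub>R u p)" "sq_norm M (\<lambda>p. \<chi>' p *\<^sub>R u p) \<le> b\<^sup>2 * sq_norm M u"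
      if u: "square_integrable M u" for u :: "(real ^ 'n) \<times> real \<Rightarrow> real ^ 'n ^ 'm"
    proof -
      have m: "(\<lambda>p. \<chi>' p *\<^sub>R u p) \<in> borel_measurable M"
        by (intro borel_measurable_scaleR square_integrable_measurable s\<chi> u)
      have le: "AE p in M. norm (\<chi>' p *\<^sub>R u p) \<le> b * norm (u p)"
        by (rule AE_I2) (use b in \<open>auto intro!: mult_right_mono\<close>)
      show "square_integrable M (\<lambda>p. \<chi>' p *\<^sub>R u p)" "sq_norm M (\<lambda>p. \<chi>' p *\<^sub>R u p) \<le> b\<^sup>2 * sq_norm M u"
        using square_integrable_bound[OF u m le] .
    qed
    have eq: "(\<phi> p)\<^sup>2 * (norm (Dvt p))\<^sup>2 = (norm (\<chi>' p *\<^sub>R h p))\<^sup>2" for p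
      by (simp add: Dvt_def \<chi>'_def power_mult_distrib abs_mult)
    have phi0: "\<phi> (x, 0) = 0" for x
    proof -
      obtain K where "K \<subseteq> \<Omega> \<times> {0<..<T}" "\<forall>p. p \<notin> K \<longrightarrow> \<phi> p = 0" using test_functionD[OF \<phi>] by blast
      then show ?thesis by (metis greaterThanLessThan_iff less_irrefl mem_Sigma_iff subsetD)
    qed
    have "sq_norm M (\<lambda>p. \<chi>' p *\<^sub>R h p) \<le> 16 / \<theta> * ?I + \<epsilon>" if \<epsilon>: "0 < \<epsilon>" for \<epsilon>
    proof -
      \<comment> \<open>With these errors in the estimates of the left values and of their deviation from \<open>\<phi>\<close>, the total error is at most \<open>\<epsilon>\<close>.\<close>
      define \<kappa> where "\<kappa> = \<epsilon> / (4 * (B + 1))"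
      have \<kappa>: "0 < \<kappa>" "2 * (\<kappa> * B) \<le> \<epsilon> / 2"
        using \<epsilon> B(1) by (simp_all add: \<kappa>_def field_simps)
      define E where "E = 2 * (4 / \<theta> * ?I + \<epsilon> / 8) + \<kappa> * B"
      have "0 < \<epsilon> / 8" using \<epsilon> by simp
      from test_times_tail_grad[OF \<phi> \<kappa>(1)] energy_estimate[OF test_function_smooth[OF \<phi>] phi0 this] B(2)
      have "\<forall>\<^sub>F j in sequentially. sq_norm M (\<lambda>p. \<chi>' p *\<^sub>R weighted_grad j p) \<le> E"
      proof eventually_elim
        case (elim j)
        have il: "integrable M (\<lambda>p. (left_value \<phi> j p)\<^sup>2 * (norm (quot_grad j p))\<^sup>2)"
          by (rule integrable_left_value[OF test_function_smooth[OF \<phi>]])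
        have iw: "integrable M (\<lambda>p. (norm (weighted_grad j p))\<^sup>2)"
          by (rule square_integrable_integrable[OF square_integrable_weighted_grad])
        have "sq_norm M (\<lambda>p. \<chi>' p *\<^sub>R weighted_grad j p)
            \<le> (LINT p|M. 2 * ((left_value \<phi> j p)\<^sup>2 * (norm (quot_grad j p))\<^sup>2) + \<kappa> * (norm (weighted_grad j p))\<^sup>2)"
        proof (rule integral_mono)
          show "integrable M (\<lambda>p. (norm (\<chi>' p *\<^sub>R weighted_grad j p))\<^sup>2)"
            by (rule square_integrable_integrable[OF mult(1)[OF square_integrable_weighted_grad]])
          show "integrable M (\<lambda>p. 2 * ((left_value \<phi> j p)\<^sup>2 * (norm (quot_grad j p))\<^sup>2) + \<kappa> * (norm (weighted_grad j p))\<^sup>2)"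
            by (intro Bochner_Integration.integrable_add integrable_mult_right il iw)
          fix p assume "p \<in> space M"
          then have p: "p \<in> \<Omega> \<times> {0<..<T}" by simp
          then have "0 < snd p" by auto
          then have "\<chi>' p *\<^sub>R weighted_grad j p = \<phi> p *\<^sub>R tail_grad j p" by (simp add: \<chi>'_def weighted_grad_def)
          then show "(norm (\<chi>' p *\<^sub>R weighted_grad j p))\<^sup>2
              \<le> 2 * ((left_value \<phi> j p)\<^sup>2 * (norm (quot_grad j p))\<^sup>2) + \<kappa> * (norm (weighted_grad j p))\<^sup>2"
            using bspec[OF elim(1) p] by (simp only:)
        qed
        also have "\<dots> = 2 * (LINT p|M. (left_value \<phi> j p)\<^sup>2 * (norm (quot_grad j p))\<^sup>2) + \<kappa> * sq_norm M (weighted_grad j)"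
          using il iw by simp
        also have "\<dots> \<le> E"
          unfolding E_def using elim(2,3) \<kappa>(1) by (intro add_mono mult_left_mono) auto
        finally show ?case .
      qed
      then obtain J3 where J3: "\<forall>j\<ge>J3. sq_norm M (\<lambda>p. \<chi>' p *\<^sub>R weighted_grad j p) \<le> E"
        unfolding eventually_sequentially by blast
      have bound: "sq_norm M (\<lambda>p. \<chi>' p *\<^sub>R h p) \<le> 2 * E + 2 * b\<^sup>2 * sq_norm M (\<lambda>p. fh n p - h p)" if n: "J3 \<le> n" for n
      proof -
        have cn: "convex_weights n (c n)" using c by blast
        have "sq_norm M (\<lambda>p. \<chi>' p *\<^sub>R fh n p) = sq_norm M (\<lambda>p. weighted_sum (\<lambda>m. \<chi>' p *\<^sub>R f m p) (c n))"
          unfolding fh_def by (subst linear_weighted_sum[of "\<lambda>y. _ *\<^sub>R y"]) (simp_all add: linear_scaleR)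
        also have "\<dots> \<le> weighted_sum (\<lambda>m. sq_norm M (\<lambda>p. \<chi>' p *\<^sub>R f m p)) (c n)"
          by (rule sq_norm_weighted_sum_le[OF cn mult(1)[OF sf]])
        also have "\<dots> \<le> E"
          by (rule weighted_sum_le[OF cn]) (use J3 n in \<open>simp add: f_def\<close>)
        finally have hat: "sq_norm M (\<lambda>p. \<chi>' p *\<^sub>R fh n p) \<le> E" .
        have d: "square_integrable M (\<lambda>p. h p - fh n p)" by (intro square_integrable_diff sfh h)
        have "sq_norm M (\<lambda>p. \<chi>' p *\<^sub>R h p) = sq_norm M (\<lambda>p. \<chi>' p *\<^sub>R fh n p + \<chi>' p *\<^sub>R (h p - fh n p))"
          by (simp add: scaleR_diff_right)
        also have "\<dots> \<le> 2 * sq_norm M (\<lambda>p. \<chi>' p *\<^sub>R fh n p) + 2 * sq_norm M (\<lambda>p. \<chi>' p *\<^sub>R (h p - fh n p))"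
          by (rule square_integrable_add(2)[OF mult(1)[OF sfh] mult(1)[OF d]])
        also have "\<dots> \<le> 2 * E + 2 * (b\<^sup>2 * sq_norm M (\<lambda>p. h p - fh n p))"
          using hat mult(2)[OF d] by linarith
        finally show ?thesis by (simp add: norm_minus_commute)
      qed
      have "(\<lambda>n. 2 * E + 2 * b\<^sup>2 * sq_norm M (\<lambda>p. fh n p - h p)) \<longlonglongrightarrow> 2 * E + 2 * b\<^sup>2 * 0"
        by (intro tendsto_intros lim)
      then have "sq_norm M (\<lambda>p. \<chi>' p *\<^sub>R h p) \<le> 2 * E + 2 * b\<^sup>2 * 0"
        by (rule LIMSEQ_le_const) (use bound in blast)
      then show ?thesis using \<kappa>(2) by (simp add: E_def)
    qed
    then have "sq_norm M (\<lambda>p. \<chi>' p *\<^sub>R h p) \<le> 16 / \<theta> * ?I" by (rule field_le_epsilon)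
    then show ?thesis
      unfolding eq using square_integrable_integrable[OF mult(1)[OF h]] by blast
  qed
  ultimately show ?thesis using L2 by blast
qed

end

theorem proposition4p4:
  fixes \<alpha> A \<theta> \<Theta> :: real
  assumes "1 < CARD('m::finite)"
    and "0 < \<alpha>" and "0 < A" and "0 < \<theta>" and "0 < \<Theta>"
  shows "\<exists>C::real.
    \<forall>(\<Omega> :: (real ^ 'n::finite) set) (T :: real)
      (\<psi> :: real ^ 'm \<Rightarrow> real) (F :: real ^ 'n ^ 'm \<Rightarrow> real)
      (g :: real ^ 'n \<Rightarrow> real ^ 'm)
      (v :: (real ^ 'n) \<times> real \<Rightarrow> real ^ 'm) (vt :: (real ^ 'n) \<times> real \<Rightarrow> real ^ 'm).
      bounded_smooth_domain \<Omega> \<and> 0 < T \<and>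
      C2_hessian_bounds \<alpha> A \<psi> \<and> C2_hessian_bounds \<theta> \<Theta> F \<and>
      bdd_below (range \<psi>) \<and> (INF w. \<psi> w) = \<psi> 0 \<and> \<psi> 0 = 0 \<and>
      W12_0 \<Omega> g \<and>
      weak_solution \<Omega> T \<psi> F g v vt \<and> scheme_limit \<Omega> T \<psi> F g v vt
      \<longrightarrow>
      (\<exists>Dvt :: (real ^ 'n) \<times> real \<Rightarrow> real ^ 'n ^ 'm.
         has_weak_space_grad \<Omega> T vt Dvt \<and>
         L2_loc (\<Omega> \<times> {0<..<T}) Dvt \<and>
         (\<forall>\<eta> :: (real ^ 'n) \<times> real \<Rightarrow> real. test_function (\<Omega> \<times> {0<..<T}) \<eta> \<longrightarrow>
            (LINT t|lebesgue_on {0..T}. LINT x|lebesgue_on \<Omega>.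
               (\<eta> (x, t))\<^sup>2 * (norm (Dvt (x, t)))\<^sup>2)
            \<le> C * (LINT t|lebesgue_on {0..T}. LINT x|lebesgue_on \<Omega>.
               (\<bar>\<eta> (x, t)\<bar> * \<bar>time_deriv \<eta> (x, t)\<bar> + (norm (space_grad \<eta> (x, t)))\<^sup>2)
                 * (norm (vt (x, t)))\<^sup>2)))"
proof (intro exI[of _ "16 / \<theta> * (A + 2 * \<Theta>\<^sup>2 / \<theta>)"] allI impI)
  fix \<Omega> :: "(real ^ 'n) set" and T :: real and \<psi> :: "real ^ 'm \<Rightarrow> real" and F :: "real ^ 'n ^ 'm \<Rightarrow> real"
    and g :: "real ^ 'n \<Rightarrow> real ^ 'm" and v vt :: "(real ^ 'n) \<times> real \<Rightarrow> real ^ 'm"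
  assume H: "bounded_smooth_domain \<Omega> \<and> 0 < T \<and>
      C2_hessian_bounds \<alpha> A \<psi> \<and> C2_hessian_bounds \<theta> \<Theta> F \<and>
      bdd_below (range \<psi>) \<and> (INF w. \<psi> w) = \<psi> 0 \<and> \<psi> 0 = 0 \<and>
      W12_0 \<Omega> g \<and>
      weak_solution \<Omega> T \<psi> F g v vt \<and> scheme_limit \<Omega> T \<psi> F g v vt"
  let ?M = "lebesgue_on (\<Omega> \<times> {0<..<T})"
  have \<Omega>: "open \<Omega>" "bounded \<Omega>" using H by (simp_all add: bounded_smooth_domain_def)
  have T: "0 < T" using H by blast
  have vt: "square_integrable ?M vt" using H by (simp add: weak_solution_def L2_on_eq)
  obtain N :: "nat \<Rightarrow> nat" and V :: "nat \<Rightarrow> nat \<Rightarrow> real ^ 'n \<Rightarrow> real ^ 'm"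
    where N: "filterlim N at_top sequentially" "\<And>j. 0 < N j"
      and scheme: "\<And>j. implicit_scheme \<Omega> T \<psi> F g (N j) (V j)"
      and lim: "(\<lambda>j. L2_norm_on (\<Omega> \<times> {0..T})
         (\<lambda>(x, t). vector_derivative (\<lambda>s. linear_interp T (N j) (V j) (x, s)) (at t) - vt (x, t))) \<longlonglongrightarrow> 0"
    using H unfolding scheme_limit_def by blast
  interpret convergent_scheme \<Omega> T \<alpha> A \<theta> \<Theta> \<psi> F g N V vt
  proof
    show "(\<lambda>j. sq_norm ?M (\<lambda>p. step_fun T (N j) (difference_quotient (T / real (N j)) (V j)) p - vt p)) \<longlonglongrightarrow> 0"
      using tendsto_power[OF lim, of 2] by (simp add: L2_norm_time_derivative[OF T N(2) \<Omega>(1)])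
  qed (use H assms \<Omega> N scheme vt in blast)+
  obtain Dvt where D: "has_weak_space_grad \<Omega> T vt Dvt" "L2_loc (\<Omega> \<times> {0<..<T}) Dvt"
    "\<forall>\<phi>. test_function (\<Omega> \<times> {0<..<T}) \<phi> \<longrightarrow> integrable ?M (\<lambda>p. (\<phi> p)\<^sup>2 * (norm (Dvt p))\<^sup>2) \<and>
      (LINT p|?M. (\<phi> p)\<^sup>2 * (norm (Dvt p))\<^sup>2)
      \<le> 16 / \<theta> * (LINT p|?M. limit_coeff A (2 * \<Theta>\<^sup>2 / \<theta>) \<phi> p * (norm (vt p))\<^sup>2)"
    using space_gradient_of_limit by blast
  show "\<exists>Dvt :: (real ^ 'n) \<times> real \<Rightarrow> real ^ 'n ^ 'm.
         has_weak_space_grad \<Omega> T vt Dvt \<and>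
         L2_loc (\<Omega> \<times> {0<..<T}) Dvt \<and>
         (\<forall>\<eta> :: (real ^ 'n) \<times> real \<Rightarrow> real. test_function (\<Omega> \<times> {0<..<T}) \<eta> \<longrightarrow>
            (LINT t|lebesgue_on {0..T}. LINT x|lebesgue_on \<Omega>.
               (\<eta> (x, t))\<^sup>2 * (norm (Dvt (x, t)))\<^sup>2)
            \<le> 16 / \<theta> * (A + 2 * \<Theta>\<^sup>2 / \<theta>) * (LINT t|lebesgue_on {0..T}. LINT x|lebesgue_on \<Omega>.
               (\<bar>\<eta> (x, t)\<bar> * \<bar>time_deriv \<eta> (x, t)\<bar> + (norm (space_grad \<eta> (x, t)))\<^sup>2)
                 * (norm (vt (x, t)))\<^sup>2))"
  proof (intro exI[of _ Dvt] conjI allI impI D(1,2))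
    fix \<eta> :: "(real ^ 'n) \<times> real \<Rightarrow> real" assume \<eta>: "test_function (\<Omega> \<times> {0<..<T}) \<eta>"
    note s\<eta> = test_function_smooth[OF \<eta>]
    let ?b = "2 * \<Theta>\<^sup>2 / \<theta>"
    let ?w = "\<lambda>p. \<bar>\<eta> p\<bar> * \<bar>time_deriv \<eta> p\<bar> + (norm (space_grad \<eta> p))\<^sup>2"
    have b: "0 \<le> ?b" using assms by simp
    have iD: "integrable ?M (\<lambda>p. (\<eta> p)\<^sup>2 * (norm (Dvt p))\<^sup>2)" using D(3) \<eta> by blast
    have iw: "integrable ?M (\<lambda>p. ?w p * (norm (vt p))\<^sup>2)"
      by (intro integrable_bounded_coeff continuous_intros smooth_on_continuous[OF s\<eta>] continuous_time_deriv[OF s\<eta>]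
          continuous_space_grad[OF s\<eta>] square_integrable_integrable vt)
    have il: "integrable ?M (\<lambda>p. limit_coeff A ?b \<eta> p * (norm (vt p))\<^sup>2)"
      by (intro integrable_bounded_coeff continuous_limit_coeff[OF s\<eta>] square_integrable_integrable vt)
    have "(LINT p|?M. limit_coeff A ?b \<eta> p * (norm (vt p))\<^sup>2) \<le> (LINT p|?M. (A + ?b) * (?w p * (norm (vt p))\<^sup>2))"
    proof (rule integral_mono[OF il integrable_mult_right[OF iw]])
      fix p
      have le: "A \<le> A + ?b" "?b \<le> A + ?b" using b assms(3) by linarith+
      have "A * (\<bar>\<eta> p\<bar> * \<bar>time_deriv \<eta> p\<bar>) \<le> (A + ?b) * (\<bar>\<eta> p\<bar> * \<bar>time_deriv \<eta> p\<bar>)"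
        by (rule mult_right_mono[OF le(1)]) simp
      moreover have "?b * (norm (space_grad \<eta> p))\<^sup>2 \<le> (A + ?b) * (norm (space_grad \<eta> p))\<^sup>2"
        by (rule mult_right_mono[OF le(2)]) simp
      ultimately have "limit_coeff A ?b \<eta> p \<le> (A + ?b) * ?w p" unfolding limit_coeff_def distrib_left by linarith
      then have "limit_coeff A ?b \<eta> p * (norm (vt p))\<^sup>2 \<le> ((A + ?b) * ?w p) * (norm (vt p))\<^sup>2" by (rule mult_right_mono) simp
      then show "limit_coeff A ?b \<eta> p * (norm (vt p))\<^sup>2 \<le> (A + ?b) * (?w p * (norm (vt p))\<^sup>2)" by (simp only: mult.assoc)
    qed
    then have rhs: "(LINT p|?M. limit_coeff A ?b \<eta> p * (norm (vt p))\<^sup>2) \<le> (A + ?b) * (LINT p|?M. ?w p * (norm (vt p))\<^sup>2)"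
      by simp
    have "(LINT t|lebesgue_on {0..T}. LINT x|lebesgue_on \<Omega>. (\<eta> (x, t))\<^sup>2 * (norm (Dvt (x, t)))\<^sup>2)
        = (LINT p|?M. (\<eta> p)\<^sup>2 * (norm (Dvt p))\<^sup>2)"
      by (rule cylinder_iterated_integral[OF \<Omega>(1) iD])
    also have "\<dots> \<le> 16 / \<theta> * (LINT p|?M. limit_coeff A ?b \<eta> p * (norm (vt p))\<^sup>2)" using D(3) \<eta> by blast
    also have "\<dots> \<le> 16 / \<theta> * ((A + ?b) * (LINT p|?M. ?w p * (norm (vt p))\<^sup>2))"
      using assms by (intro mult_left_mono[OF rhs]) simp
    also have "(LINT p|?M. ?w p * (norm (vt p))\<^sup>2)
        = (LINT t|lebesgue_on {0..T}. LINT x|lebesgue_on \<Omega>. ?w (x, t) * (norm (vt (x, t)))\<^sup>2)"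
      by (rule cylinder_iterated_integral[OF \<Omega>(1) iw, symmetric])
    finally show "(LINT t|lebesgue_on {0..T}. LINT x|lebesgue_on \<Omega>. (\<eta> (x, t))\<^sup>2 * (norm (Dvt (x, t)))\<^sup>2)
            \<le> 16 / \<theta> * (A + ?b) * (LINT t|lebesgue_on {0..T}. LINT x|lebesgue_on \<Omega>.
               (\<bar>\<eta> (x, t)\<bar> * \<bar>time_deriv \<eta> (x, t)\<bar> + (norm (space_grad \<eta> (x, t)))\<^sup>2) * (norm (vt (x, t)))\<^sup>2)"
      by (simp only: mult.assoc)
  qed
qed

end
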